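(* Consider the peak-constrained Gaussian broadcast channel $Y_i=X+Z_i$, $i=1,2$, with input constrained to $X\in[0,A]$ ($A>0$) and $Z_i\sim\mathcal{N}(0,\sigma_i^2)$, $0<\sigma_1<\sigma_2$, where the transmitter sends independent messages to receivers 1 and 2 at rates $R_1,R_2$. Let $K_1\ge 2$ and $K_2\ge1$ be integers. Then every pair $(R_1,R_2)\in\mathbb{R}_+^2$ satisfying $$R_1\le \mathsf{F}\Bigl(\tfrac{(K_1-1)A}{K_1K_2-1},K_1,\sigma_1\Bigr),\qquad R_2\le \mathsf{F}(A,K_1K_2,\sigma_2)-\mathsf{G}\Bigl(\tfrac{(K_1-1)A}{K_1K_2-1},K_1,\sigma_2\Bigr)$$ is achievable (in the standard Shannon sense: there exist codes with vanishing error probability at both receivers).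
   Context: All logarithms are base 2. $H(p)$ is the binary entropy, $\mathsf{Q}$ the standard Gaussian tail function. For $a>0,\sigma>0$: $\underline{C}(a,\sigma)=\frac12\log(1+\frac{a^2}{2\pi e\sigma^2})$; $\overline{C}(a,\sigma)=\min\{\frac12\log(1+\frac{a^2}{4\sigma^2}),\log(1+\frac{a}{\sqrt{2\pi e}\sigma})\}$; $\mathsf{E}(a,\sigma)=\min\{\overline{C}(a,\sigma),\frac12\log(1+\frac{a^2}{12\sigma^2})\}$. For $a>0$ and integer $K\ge2$: $\mathsf{F}(a,K,\sigma)=\max\{\mathsf{F}_1,\mathsf{F}_2,\mathsf{F}_3\}(a,K,\sigma)$ with $\mathsf{F}_1(a,K,\sigma)=\log K-H(\xi)-\xi\log(K-1)$, $\xi=\frac{2(K-1)}{K}\mathsf{Q}(\frac{a}{2(K-1)\sigma})$; $\mathsf{F}_2(a,K,\sigma)=\underline{C}(\frac{Ka}{K-1},\sigma)-\mathsf{E}(\frac{a}{K-1},\sigma)$; $\mathsf{F}_3(a,K,\sigma)=-\log\bigl(\sum_{i,j=1}^K\frac{\sqrt{e/2}}{K^2}e^{-\frac{(i-j)^2a^2}{4(K-1)^2\sigma^2}}\bigr)$. Also $\mathsf{G}(a,K,\sigma)=\min\{\log K,\overline{C}(a,\sigma),\frac12\log(2^{2\mathsf{E}(\frac{Ka}{K-1},\sigma)}-\frac{a^2}{2\pi e(K-1)^2\sigma^2})\}$. *)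

theory Defs
  imports "HOL-Probability.Probability"
begin

definition Qfun :: "real \<Rightarrow> real" where
  "Qfun x = measure (density lborel std_normal_density) {x<..}"

definition Hb :: "real \<Rightarrow> real" where
  "Hb p = (if p \<le> 0 \<or> p \<ge> 1 then 0 else - p * log 2 p - (1 - p) * log 2 (1 - p))"

definition Clow :: "real \<Rightarrow> real \<Rightarrow> real" where
  "Clow a \<sigma> = 1/2 * log 2 (1 + a\<^sup>2 / (2 * pi * exp 1 * \<sigma>\<^sup>2))"

definition Cbar :: "real \<Rightarrow> real \<Rightarrow> real" where
  "Cbar a \<sigma> = min (1/2 * log 2 (1 + a\<^sup>2 / (4 * \<sigma>\<^sup>2)))
                    (log 2 (1 + a / (sqrt (2 * pi * exp 1) * \<sigma>)))"

definition Efun :: "real \<Rightarrow> real \<Rightarrow> real" where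
  "Efun a \<sigma> = min (Cbar a \<sigma>) (1/2 * log 2 (1 + a\<^sup>2 / (12 * \<sigma>\<^sup>2)))"

definition F1 :: "real \<Rightarrow> nat \<Rightarrow> real \<Rightarrow> real" where
  "F1 a K \<sigma> = (let \<xi> = 2 * (real K - 1) / real K * Qfun (a / (2 * (real K - 1) * \<sigma>))
               in log 2 (real K) - Hb \<xi> - \<xi> * log 2 (real K - 1))"

definition F2 :: "real \<Rightarrow> nat \<Rightarrow> real \<Rightarrow> real" where
  "F2 a K \<sigma> = Clow (real K * a / (real K - 1)) \<sigma> - Efun (a / (real K - 1)) \<sigma>"

definition F3 :: "real \<Rightarrow> nat \<Rightarrow> real \<Rightarrow> real" where
  "F3 a K \<sigma> = - log 2 (\<Sum>i\<in>{1..K}. \<Sum>j\<in>{1..K}.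
      sqrt (exp 1 / 2) / (real K)\<^sup>2 *
      exp (- ((real i - real j)\<^sup>2 * a\<^sup>2) / (4 * (real K - 1)\<^sup>2 * \<sigma>\<^sup>2)))"

definition Ffun :: "real \<Rightarrow> nat \<Rightarrow> real \<Rightarrow> real" where
  "Ffun a K \<sigma> = max (F1 a K \<sigma>) (max (F2 a K \<sigma>) (F3 a K \<sigma>))"

definition Gfun :: "real \<Rightarrow> nat \<Rightarrow> real \<Rightarrow> real" where
  "Gfun a K \<sigma> = min (log 2 (real K)) (min (Cbar a \<sigma>)
      (1/2 * log 2 (2 powr (2 * Efun (real K * a / (real K - 1)) \<sigma>)
                    - a\<^sup>2 / (2 * pi * exp 1 * (real K - 1)\<^sup>2 * \<sigma>\<^sup>2))))"

definition noise :: "nat \<Rightarrow> real \<Rightarrow> (nat \<Rightarrow> real) measure" where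
  "noise n \<sigma> = PiM {..<n} (\<lambda>_. density lborel (normal_density 0 \<sigma>))"

definition chan_out :: "nat \<Rightarrow> (nat \<Rightarrow> real) \<Rightarrow> (nat \<Rightarrow> real) \<Rightarrow> (nat \<Rightarrow> real)" where
  "chan_out n x z = (\<lambda>i\<in>{..<n}. x i + z i)"

definition avg_err :: "nat \<Rightarrow> real \<Rightarrow> nat \<Rightarrow> nat \<Rightarrow> (nat \<Rightarrow> nat \<Rightarrow> nat \<Rightarrow> real)
    \<Rightarrow> ((nat \<Rightarrow> real) \<Rightarrow> nat) \<Rightarrow> (nat \<Rightarrow> nat \<Rightarrow> nat) \<Rightarrow> real" where
  "avg_err n \<sigma> m1 m2 enc dec tgt =
     (\<Sum>w1<m1. \<Sum>w2<m2. measure (noise n \<sigma>)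
         {z \<in> space (noise n \<sigma>). dec (chan_out n (enc w1 w2) z) \<noteq> tgt w1 w2})
     / (real m1 * real m2)"

definition achievable :: "real \<Rightarrow> real \<Rightarrow> real \<Rightarrow> real \<Rightarrow> real \<Rightarrow> bool" where
  "achievable A \<sigma>1 \<sigma>2 R1 R2 \<longleftrightarrow>
    (\<exists>(M1 :: nat \<Rightarrow> nat) (M2 :: nat \<Rightarrow> nat)
       (enc :: nat \<Rightarrow> nat \<Rightarrow> nat \<Rightarrow> nat \<Rightarrow> real)
       (dec1 :: nat \<Rightarrow> (nat \<Rightarrow> real) \<Rightarrow> nat) (dec2 :: nat \<Rightarrow> (nat \<Rightarrow> real) \<Rightarrow> nat).
       (\<forall>n. 2 powr (real n * R1) \<le> real (M1 n) \<and> 2 powr (real n * R2) \<le> real (M2 n)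
          \<and> (\<forall>w1 w2 i. w1 < M1 n \<longrightarrow> w2 < M2 n \<longrightarrow> i < n \<longrightarrow> enc n w1 w2 i \<in> {0..A})
          \<and> dec1 n \<in> measurable (PiM {..<n} (\<lambda>_. borel)) (count_space UNIV)
          \<and> dec2 n \<in> measurable (PiM {..<n} (\<lambda>_. borel)) (count_space UNIV))
     \<and> (\<lambda>n. avg_err n \<sigma>1 (M1 n) (M2 n) (enc n) (dec1 n) (\<lambda>w1 w2. w1)) \<longlonglongrightarrow> 0
     \<and> (\<lambda>n. avg_err n \<sigma>2 (M1 n) (M2 n) (enc n) (dec2 n) (\<lambda>w1 w2. w2)) \<longlonglongrightarrow> 0)"

end

theory Submission
  imports Defs
begin

text \<open>
  Superposition coding with cloud letters \<open>U\<close> uniform on \<open>{0..<K\<^sub>2}\<close> and satellite letters \<open>S\<close> uniform on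
  \<open>{0..<K\<^sub>1}\<close>, sent as \<open>X = L (K\<^sub>1 U + S)\<close> with \<open>L = A / (K\<^sub>1 K\<^sub>2 - 1)\<close>, achieves all rates with
  \<open>R\<^sub>1 < I(X;Y\<^sub>1|U)\<close> and \<open>R\<^sub>2 < I(U;Y\<^sub>2) = I(X;Y\<^sub>2) - I(X;Y\<^sub>2|U)\<close>; receiver 1 also decodes the cloud, since
  \<open>I(U;Y\<^sub>1) \<ge> I(U;Y\<^sub>2)\<close> by data processing.  As the rates may lie on the boundary of the claimed region, the
  bound \<open>F\<close> has to be strictly below the mutual information of \<open>K\<close> equispaced inputs, while \<open>G\<close> is an upper
  bound for it.  \<open>F\<^sub>1\<close> and \<open>F\<^sub>3\<close> are instances of Gibbs' inequality.  For \<open>F\<^sub>2\<close> the constellation is smeared by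
  a uniform variable of width \<open>L\<close>, which turns it into a uniform variable on \<open>[0, K L]\<close>, to which the entropy
  power inequality applies.  The third term of \<open>G\<close> needs no entropy power inequality: it already dominates the
  maximum entropy bounds for \<open>K\<close> points because \<open>(K - 1)\<^sup>2 + 1 \<le> K\<^sup>2\<close> and \<open>12 < 2\<pi>e\<close>.
\<close>

section \<open>Gibbs' inequality and Gaussian mixtures\<close>

text \<open>Achievability asks for at least \<open>2 powr (n * R)\<close> messages at every
  \<open>n\<close>, so the rate has no slack, and a boundary point is reached only because each
  bound in \<open>F\<close> lies strictly below the information. The strictness has three sources:
  for F1 the hard-decision reference differs from the true law almost everywhere on a half line; for
  F3 the output density is not constant; for F2 the Gaussian density is not constant, so a use of
  the concavity of \<open>ln\<close> is strict. The factor sqrt(e/2) in F3 is sqrt(2 pi e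
  \<sigma>^2) / sqrt(4 pi \<sigma>^2), which makes F3 the Renyi entropy of order two of the output
  minus the noise entropy. The coding part needs neither typical sets nor a law of large numbers.
  Decoders threshold a sum of log-likelihood ratios; missing the right codeword costs a Chernoff
  exponent, accepting a wrong one is bounded by Markov's inequality, and codebooks are averaged by
  counting. One satellite codebook serves all clouds. Entropies are in nats; the factor
  \<open>ln 2\<close> appears where they meet F and G.\<close>

lemma gibbs_pointwise:
  fixes a b :: real
  assumes "0 < a" "0 < b"
  shows "a * ln (b / a) \<le> b - a" and "a \<noteq> b \<Longrightarrow> a * ln (b / a) \<noteq> b - a"
proof -
  have "ln (b / a) \<le> b / a - 1"
    using assms by (intro ln_le_minus_one) auto
  then have "a * ln (b / a) \<le> a * (b / a - 1)"
    using assms by (intro mult_left_mono) auto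
  also have "a * (b / a - 1) = b - a"
    using assms by (simp add: right_diff_distrib)
  finally show "a * ln (b / a) \<le> b - a" .
  assume "a \<noteq> b"
  show "a * ln (b / a) \<noteq> b - a"
  proof
    assume "a * ln (b / a) = b - a"
    then have "ln (b / a) = b / a - 1"
      using assms by (simp add: field_simps)
    then have "b / a = 1"
      using assms by (intro ln_eq_minus_one) auto
    then show False
      using \<open>a \<noteq> b\<close> assms by (simp add: field_simps)
  qed
qed

text \<open>The two masses are kept on the right instead of being normalised to 1, since in several
  applications only a sum of masses over all messages, or a bound on a mass, is available.\<close>

lemma gibbs_integral_le:
  fixes a b :: "'a \<Rightarrow> real"
  assumes "integrable M a" "integrable M b" "\<And>x. 0 < a x" "\<And>x. 0 < b x"
    and "integrable M (\<lambda>x. a x * ln (b x / a x))"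
  shows "(\<integral>x. a x * ln (b x / a x) \<partial>M) \<le> integral\<^sup>L M b - integral\<^sup>L M a"
proof -
  have "(\<integral>x. a x * ln (b x / a x) \<partial>M) \<le> (\<integral>x. b x - a x \<partial>M)"
    using assms by (intro integral_mono gibbs_pointwise(1)) auto
  then show ?thesis
    using assms by simp
qed

text \<open>Equality would make the nonnegative defect \<open>D\<close> vanish almost everywhere,
  hence \<open>a = b\<close> almost everywhere. The set \<open>A\<close> localises the disagreement,
  so that it has to be exhibited only where it is easy to see.\<close>

lemma gibbs_integral_less:
  fixes a b :: "'a \<Rightarrow> real"
  assumes "integrable M a" "integrable M b" "\<And>x. 0 < a x" "\<And>x. 0 < b x"
    and "integrable M (\<lambda>x. a x * ln (b x / a x))"
    and "A \<in> sets M" "emeasure M A \<noteq> 0" "AE x in M. x \<in> A \<longrightarrow> a x \<noteq> b x"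
  shows "(\<integral>x. a x * ln (b x / a x) \<partial>M) < integral\<^sup>L M b - integral\<^sup>L M a"
proof -
  define D where "D x = b x - a x - a x * ln (b x / a x)" for x
  have intD: "integrable M D"
    unfolding D_def using assms by auto
  have D0: "0 \<le> D x" for x
    using gibbs_pointwise(1)[of "a x" "b x"] assms(3,4) by (simp add: D_def)
  have "integral\<^sup>L M D \<noteq> 0"
  proof
    assume "integral\<^sup>L M D = 0"
    then have "AE x in M. D x = 0"
      using integral_nonneg_eq_0_iff_AE[OF intD] D0 by auto
    with assms(8) have "AE x in M. x \<notin> A"
    proof eventually_elim
      case (elim x)
      then show ?case
        using gibbs_pointwise(2)[of "a x" "b x"] assms(3,4) by (auto simp: D_def)
    qed
    then show False
      using AE_iff_null_sets[OF assms(6)] assms(7) by (auto simp: null_sets_def)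
  qed
  moreover have "0 \<le> integral\<^sup>L M D"
    using D0 by (simp add: integral_nonneg_AE)
  moreover have "integral\<^sup>L M D = integral\<^sup>L M b - integral\<^sup>L M a - (\<integral>x. a x * ln (b x / a x) \<partial>M)"
    unfolding D_def using assms by simp
  ultimately show ?thesis
    by linarith
qed

text \<open>A class of integrands large enough to contain the logarithm of every bounded-input
  Gaussian mixture and small enough to be integrable against every Gaussian. Closure under sums,
  multiples and shifts then settles nearly all integrability questions about entropies.\<close>

definition quadratic_growth :: "(real \<Rightarrow> real) \<Rightarrow> bool" where
  "quadratic_growth \<psi> \<longleftrightarrow> \<psi> \<in> borel_measurable borel \<and> (\<exists>D. \<forall>y. \<bar>\<psi> y\<bar> \<le> D * (1 + y\<^sup>2))"

lemma quadratic_growthI: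
  assumes "\<psi> \<in> borel_measurable borel" "\<And>y. \<bar>\<psi> y\<bar> \<le> D * (1 + y\<^sup>2)"
  shows "quadratic_growth \<psi>"
  using assms unfolding quadratic_growth_def by blast

lemma quadratic_growth_measurable: "quadratic_growth \<psi> \<Longrightarrow> \<psi> \<in> borel_measurable borel"
  unfolding quadratic_growth_def by blast

lemma quadratic_growth_add:
  assumes "quadratic_growth \<psi>" "quadratic_growth \<eta>"
  shows "quadratic_growth (\<lambda>y. \<psi> y + \<eta> y)"
proof -
  obtain D E where "\<And>y. \<bar>\<psi> y\<bar> \<le> D * (1 + y\<^sup>2)" "\<And>y. \<bar>\<eta> y\<bar> \<le> E * (1 + y\<^sup>2)"
    using assms unfolding quadratic_growth_def by blast
  then have "\<bar>\<psi> y + \<eta> y\<bar> \<le> (D + E) * (1 + y\<^sup>2)" for y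
    using abs_triangle_ineq[of "\<psi> y" "\<eta> y"] by (smt (verit) distrib_right)
  then show ?thesis
    using assms[THEN quadratic_growth_measurable] by (intro quadratic_growthI) auto
qed

lemma quadratic_growth_cmult:
  assumes "quadratic_growth \<psi>"
  shows "quadratic_growth (\<lambda>y. c * \<psi> y)"
proof -
  obtain D where D: "\<And>y. \<bar>\<psi> y\<bar> \<le> D * (1 + y\<^sup>2)"
    using assms unfolding quadratic_growth_def by blast
  have "\<bar>c * \<psi> y\<bar> \<le> (\<bar>c\<bar> * D) * (1 + y\<^sup>2)" for y
    using mult_left_mono[OF D[of y], of "\<bar>c\<bar>"] by (simp add: abs_mult mult_ac)
  then show ?thesis
    using assms[THEN quadratic_growth_measurable] by (intro quadratic_growthI) auto
qed

lemma quadratic_growth_const: "quadratic_growth (\<lambda>_. k)"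
  by (rule quadratic_growthI[of _ "\<bar>k\<bar>"]) (auto simp: distrib_left)

lemma quadratic_growth_diff:
  "quadratic_growth \<psi> \<Longrightarrow> quadratic_growth \<eta> \<Longrightarrow> quadratic_growth (\<lambda>y. \<psi> y - \<eta> y)"
  using quadratic_growth_add[of \<psi> "\<lambda>y. -1 * \<eta> y"] quadratic_growth_cmult[of \<eta> "-1"] by simp

lemma quadratic_growth_shift:
  assumes "quadratic_growth \<psi>"
  shows "quadratic_growth (\<lambda>y. \<psi> (y - c))"
proof -
  obtain D where D: "\<And>y. \<bar>\<psi> y\<bar> \<le> D * (1 + y\<^sup>2)"
    using assms unfolding quadratic_growth_def by blast
  have D0: "0 \<le> D" using D[of 0] by simp
  have "\<bar>\<psi> (y - c)\<bar> \<le> (D * (2 + 2 * c\<^sup>2)) * (1 + y\<^sup>2)" for y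
  proof -
    have "1 + (y - c)\<^sup>2 \<le> 1 + 2 * y\<^sup>2 + 2 * c\<^sup>2"
      using zero_le_power2[of "y + c"] by (simp add: power2_eq_square algebra_simps)
    also have "\<dots> \<le> (2 + 2 * c\<^sup>2) * (1 + y\<^sup>2)"
      by (simp add: algebra_simps)
    finally show ?thesis
      using D[of "y - c"] mult_left_mono[of "1 + (y - c)\<^sup>2" "(2 + 2 * c\<^sup>2) * (1 + y\<^sup>2)" D] D0
      by (simp add: mult_ac)
  qed
  then show ?thesis
    using assms[THEN quadratic_growth_measurable] by (intro quadratic_growthI) auto
qed

section \<open>Gaussian densities: identities, second moments and logarithms\<close>

lemma measurable_normal_density_joint[measurable]:
  assumes [measurable]: "f \<in> borel_measurable M" "g \<in> borel_measurable M"
  shows "(\<lambda>x. normal_density (f x) \<sigma> (g x)) \<in> borel_measurable M"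
  unfolding normal_density_def by measurable

lemma normal_density_commute: "normal_density x \<sigma> y = normal_density y \<sigma> x"
  by (simp add: normal_density_def power2_commute)

lemma normal_density_shift: "normal_density x \<sigma> (y - c) = normal_density (x + c) \<sigma> y"
  by (simp add: normal_density_def algebra_simps)

lemma normal_density_reflect: "normal_density x \<sigma> (c - y) = normal_density (c - x) \<sigma> y"
  by (simp add: normal_density_def power2_commute algebra_simps)

lemma ln_normal_density:
  assumes "0 < \<sigma>"
  shows "ln (normal_density x \<sigma> y) = - (1/2) * ln (2 * pi * \<sigma>\<^sup>2) - (y - x)\<^sup>2 / (2 * \<sigma>\<^sup>2)"
  using assms by (simp add: normal_density_def ln_mult ln_div ln_sqrt)

lemma
  assumes [arith]: "0 < \<sigma>"
  shows integrable_normal_square: "integrable lborel (\<lambda>y. normal_density x \<sigma> y * (y - m)\<^sup>2)"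
    and integral_normal_square: "(\<integral>y. normal_density x \<sigma> y * (y - m)\<^sup>2 \<partial>lborel) = \<sigma>\<^sup>2 + (x - m)\<^sup>2"
proof -
  have eq: "normal_density x \<sigma> y * (y - m)\<^sup>2 = normal_density x \<sigma> y * (y - x)^2
      + (2 * (x - m)) * (normal_density x \<sigma> y * (y - x)^1) + (x - m)\<^sup>2 * normal_density x \<sigma> y" for y
    by (simp add: power2_eq_square algebra_simps)
  have 1: "has_bochner_integral lborel (\<lambda>y. normal_density x \<sigma> y * (y - x)^2) (\<sigma>\<^sup>2)"
    using normal_moment_even[of \<sigma> x 1] by simp
  have 2: "has_bochner_integral lborel (\<lambda>y. normal_density x \<sigma> y * (y - x)^1) 0"
    using normal_moment_odd[of \<sigma> x 0] by simp
  have 3: "has_bochner_integral lborel (normal_density x \<sigma>) 1"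
    by (simp add: has_bochner_integral_iff)
  have "has_bochner_integral lborel (\<lambda>y. normal_density x \<sigma> y * (y - m)\<^sup>2) (\<sigma>\<^sup>2 + (2 * (x - m)) * 0 + (x - m)\<^sup>2 * 1)"
    unfolding eq by (intro has_bochner_integral_add has_bochner_integral_mult_right 1 2 3)
  then show "integrable lborel (\<lambda>y. normal_density x \<sigma> y * (y - m)\<^sup>2)"
    "(\<integral>y. normal_density x \<sigma> y * (y - m)\<^sup>2 \<partial>lborel) = \<sigma>\<^sup>2 + (x - m)\<^sup>2"
    by (auto simp: has_bochner_integral_iff)
qed

lemma integrable_normal_quadratic_growth:
  assumes "0 < \<sigma>" "quadratic_growth \<psi>"
  shows "integrable lborel (\<lambda>y. normal_density x \<sigma> y * \<psi> y)"
proof -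
  obtain D where D: "\<And>y. \<bar>\<psi> y\<bar> \<le> D * (1 + y\<^sup>2)"
    using assms unfolding quadratic_growth_def by blast
  note [measurable] = quadratic_growth_measurable[OF assms(2)]
  have "integrable lborel (\<lambda>y. D * (normal_density x \<sigma> y + normal_density x \<sigma> y * (y - 0)\<^sup>2))"
    using assms(1) integrable_normal_square[of \<sigma> x 0]
    by (intro integrable_mult_right Bochner_Integration.integrable_add) auto
  then show ?thesis
  proof (rule Bochner_Integration.integrable_bound)
    show "AE y in lborel. norm (normal_density x \<sigma> y * \<psi> y)
        \<le> norm (D * (normal_density x \<sigma> y + normal_density x \<sigma> y * (y - 0)\<^sup>2))"
    proof (intro AE_I2)
      fix y
      have "normal_density x \<sigma> y * \<bar>\<psi> y\<bar> \<le> normal_density x \<sigma> y * (D * (1 + y\<^sup>2))"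
        by (intro mult_left_mono D) simp
      also have "\<dots> = D * (normal_density x \<sigma> y + normal_density x \<sigma> y * (y - 0)\<^sup>2)"
        by (simp add: algebra_simps)
      finally show "norm (normal_density x \<sigma> y * \<psi> y)
        \<le> norm (D * (normal_density x \<sigma> y + normal_density x \<sigma> y * (y - 0)\<^sup>2))"
        using abs_ge_self[of "D * (normal_density x \<sigma> y + normal_density x \<sigma> y * (y - 0)\<^sup>2)"]
        by (simp only: real_norm_def abs_mult[of "normal_density x \<sigma> y" "\<psi> y"]) simp
    qed
  qed simp
qed

text \<open>Coefficient of a bound on the log-density that is uniform over all locations of modulus
  at most \<open>B\<close>; uniformity is what lets it pass to mixtures.\<close>

definition normal_log_bound :: "real \<Rightarrow> real \<Rightarrow> real" where
  "normal_log_bound \<sigma> B = \<bar>ln (2 * pi * \<sigma>\<^sup>2)\<bar> + (1 + B\<^sup>2) / \<sigma>\<^sup>2"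

lemma abs_ln_normal_density_le:
  assumes "0 < \<sigma>" "\<bar>x\<bar> \<le> B"
  shows "\<bar>ln (normal_density x \<sigma> y)\<bar> \<le> normal_log_bound \<sigma> B * (1 + y\<^sup>2)"
proof -
  have "x\<^sup>2 \<le> B\<^sup>2"
    using assms(2) by (metis abs_ge_zero power2_abs power_mono)
  then have "(y - x)\<^sup>2 \<le> 2 * y\<^sup>2 + 2 * B\<^sup>2"
    using zero_le_power2[of "y + x"] by (simp add: power2_eq_square algebra_simps)
  also have "\<dots> \<le> 2 * ((1 + B\<^sup>2) * (1 + y\<^sup>2))"
    by (simp add: algebra_simps)
  finally have "(y - x)\<^sup>2 / (2 * \<sigma>\<^sup>2) \<le> (1 + B\<^sup>2) / \<sigma>\<^sup>2 * (1 + y\<^sup>2)"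
    using assms(1) by (simp add: field_simps)
  moreover have "\<bar>ln (2 * pi * \<sigma>\<^sup>2)\<bar> \<le> \<bar>ln (2 * pi * \<sigma>\<^sup>2)\<bar> * (1 + y\<^sup>2)"
    by (simp add: algebra_simps)
  moreover have "0 \<le> (y - x)\<^sup>2 / (2 * \<sigma>\<^sup>2)"
    by simp
  ultimately show ?thesis
    unfolding ln_normal_density[OF assms(1)] normal_log_bound_def distrib_right by linarith
qed

lemma quadratic_growth_ln_normal_density:
  "0 < \<sigma> \<Longrightarrow> quadratic_growth (\<lambda>y. ln (normal_density x \<sigma> y))"
  by (rule quadratic_growthI[OF _ abs_ln_normal_density_le[of \<sigma> x "\<bar>x\<bar>"]]) auto

lemma normal_density_le_peak: "0 < \<sigma> \<Longrightarrow> normal_density x \<sigma> y \<le> 1 / sqrt (2 * pi * \<sigma>\<^sup>2)"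
  unfolding normal_density_def by (intro mult_left_le) auto

text \<open>Differential entropy in nats.\<close>

definition entropy_density :: "(real \<Rightarrow> real) \<Rightarrow> real" where
  "entropy_density f = - (\<integral>y. f y * ln (f y) \<partial>lborel)"

text \<open>The output density of the Gaussian channel when the input is \<open>loc\<close> of a random element of \<open>P\<close>;
  this covers both finite constellations and uniformly distributed inputs.\<close>

definition gmix :: "'a measure \<Rightarrow> ('a \<Rightarrow> real) \<Rightarrow> real \<Rightarrow> real \<Rightarrow> real" where
  "gmix P loc \<sigma> y = (\<integral>x. normal_density (loc x) \<sigma> y \<partial>P)"

locale gauss_mixture = prob_space P for P :: "'a measure" +
  fixes loc :: "'a \<Rightarrow> real" and B \<sigma> :: real
  assumes loc_measurable[measurable]: "loc \<in> borel_measurable P"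
    and loc_bound: "x \<in> space P \<Longrightarrow> 0 \<le> loc x \<and> loc x \<le> B"
    and sigma_pos[simp]: "0 < \<sigma>"
begin

abbreviation "f \<equiv> gmix P loc \<sigma>"

lemma integrable_density_at: "integrable P (\<lambda>x. normal_density (loc x) \<sigma> y)"
  by (rule integrable_const_bound[where B = "1 / sqrt (2 * pi * \<sigma>\<^sup>2)"])
     (auto intro!: normal_density_le_peak)

lemma gmix_measurable[measurable]: "f \<in> borel_measurable borel"
  unfolding gmix_def by measurable

text \<open>The two-sided bound on a single Gaussian is uniform in the location, so it survives
  averaging over the input law. This is the source of the quadratic growth of
  \<open>ln f\<close>.\<close>

lemma gmix_bounds:
  "exp (- (normal_log_bound \<sigma> B * (1 + y\<^sup>2))) \<le> f y" "f y \<le> exp (normal_log_bound \<sigma> B * (1 + y\<^sup>2))"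
proof -
  have *: "exp (- (normal_log_bound \<sigma> B * (1 + y\<^sup>2))) \<le> normal_density (loc x) \<sigma> y"
      "normal_density (loc x) \<sigma> y \<le> exp (normal_log_bound \<sigma> B * (1 + y\<^sup>2))" if "x \<in> space P" for x
    using abs_ln_normal_density_le[of \<sigma> "loc x" B y] loc_bound[OF that]
      normal_density_pos[of \<sigma> "loc x" y]
    by (simp_all add: abs_le_iff flip: ln_ge_iff ln_le_cancel_iff[of _ "exp _"])
  have "(\<integral>x. exp (- (normal_log_bound \<sigma> B * (1 + y\<^sup>2))) \<partial>P) \<le> f y"
    unfolding gmix_def using * by (intro integral_mono integrable_density_at) auto
  then show "exp (- (normal_log_bound \<sigma> B * (1 + y\<^sup>2))) \<le> f y"
    by (simp add: prob_space)
  have "f y \<le> (\<integral>x. exp (normal_log_bound \<sigma> B * (1 + y\<^sup>2)) \<partial>P)"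
    unfolding gmix_def using * by (intro integral_mono integrable_density_at) auto
  then show "f y \<le> exp (normal_log_bound \<sigma> B * (1 + y\<^sup>2))"
    by (simp add: prob_space)
qed

lemma gmix_pos[simp]: "0 < f y"
  using gmix_bounds(1)[of y] by (rule less_le_trans[rotated]) simp

lemma quadratic_growth_ln_gmix: "quadratic_growth (\<lambda>y. ln (f y))"
proof (rule quadratic_growthI)
  show "\<bar>ln (f y)\<bar> \<le> normal_log_bound \<sigma> B * (1 + y\<^sup>2)" for y
    using gmix_bounds[of y] gmix_pos[of y]
    by (smt (verit) ln_exp ln_le_cancel_iff exp_gt_zero)
qed simp

text \<open>Fubini applies because, for a location in \<open>[0, B]\<close>, the Gaussian mean of
  |\<psi>| is at most \<open>D * (1 + \<sigma>\<^sup>2 + B\<^sup>2)\<close>, uniformly in the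
  location.\<close>

lemma
  assumes \<psi>: "quadratic_growth \<psi>"
  shows integrable_gmix: "integrable lborel (\<lambda>y. f y * \<psi> y)"
    and integral_gmix: "(\<integral>y. f y * \<psi> y \<partial>lborel) = (\<integral>x. (\<integral>y. normal_density (loc x) \<sigma> y * \<psi> y \<partial>lborel) \<partial>P)"
    and integrable_gmix_inner: "integrable P (\<lambda>x. \<integral>y. normal_density (loc x) \<sigma> y * \<psi> y \<partial>lborel)"
proof -
  interpret pair_sigma_finite P lborel
    by unfold_locales
  note [measurable] = quadratic_growth_measurable[OF \<psi>]
  obtain D where D: "\<And>y. \<bar>\<psi> y\<bar> \<le> D * (1 + y\<^sup>2)"
    using \<psi> unfolding quadratic_growth_def by blast
  have D0: "0 \<le> D" using D[of 0] by simp
  have qa: "quadratic_growth (\<lambda>y. \<bar>\<psi> y\<bar>)"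
    using D by (intro quadratic_growthI[of _ D]) auto
  have int: "integrable (P \<Otimes>\<^sub>M lborel) (\<lambda>(x, y). normal_density (loc x) \<sigma> y * \<psi> y)"
  proof (rule Fubini_integrable)
    show "(\<lambda>(x, y). normal_density (loc x) \<sigma> y * \<psi> y) \<in> borel_measurable (P \<Otimes>\<^sub>M lborel)"
      by measurable
    show "AE x in P. integrable lborel (\<lambda>y. case (x, y) of (x, y) \<Rightarrow> normal_density (loc x) \<sigma> y * \<psi> y)"
      using integrable_normal_quadratic_growth[OF _ \<psi>] by simp
    have "norm (\<integral>y. normal_density (loc x) \<sigma> y * \<bar>\<psi> y\<bar> \<partial>lborel) \<le> D * (1 + (\<sigma>\<^sup>2 + B\<^sup>2))" if "x \<in> space P" for x
    proof -
      have "(\<integral>y. normal_density (loc x) \<sigma> y * \<bar>\<psi> y\<bar> \<partial>lborel) \<le>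
          (\<integral>y. D * (normal_density (loc x) \<sigma> y + normal_density (loc x) \<sigma> y * (y - 0)\<^sup>2) \<partial>lborel)"
      proof (intro integral_mono integrable_normal_quadratic_growth qa)
        show "integrable lborel (\<lambda>y. D * (normal_density (loc x) \<sigma> y + normal_density (loc x) \<sigma> y * (y - 0)\<^sup>2))"
          using integrable_normal_square[of \<sigma> "loc x" 0]
          by (intro integrable_mult_right Bochner_Integration.integrable_add) auto
        fix y
        have "normal_density (loc x) \<sigma> y * \<bar>\<psi> y\<bar> \<le> normal_density (loc x) \<sigma> y * (D * (1 + y\<^sup>2))"
          by (intro mult_left_mono D) simp
        then show "normal_density (loc x) \<sigma> y * \<bar>\<psi> y\<bar> \<le> D * (normal_density (loc x) \<sigma> y + normal_density (loc x) \<sigma> y * (y - 0)\<^sup>2)"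
          by (simp add: algebra_simps)
      qed simp
      also have "\<dots> = D * (1 + (\<sigma>\<^sup>2 + (loc x)\<^sup>2))"
        using integrable_normal_square[of \<sigma> "loc x" 0] integral_normal_square[of \<sigma> "loc x" 0] by simp
      also have "\<dots> \<le> D * (1 + (\<sigma>\<^sup>2 + B\<^sup>2))"
        using loc_bound[OF that] D0 by (intro mult_left_mono add_left_mono power_mono) auto
      finally show ?thesis
        by (simp add: integral_nonneg_AE)
    qed
    then show "integrable P (\<lambda>x. \<integral>y. norm (case (x, y) of (x, y) \<Rightarrow> normal_density (loc x) \<sigma> y * \<psi> y) \<partial>lborel)"
      by (intro integrable_const_bound[where B = "D * (1 + (\<sigma>\<^sup>2 + B\<^sup>2))"]) (auto simp: abs_mult)
  qed
  show "integrable lborel (\<lambda>y. f y * \<psi> y)"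
    using integrable_snd[of "\<lambda>x y. normal_density (loc x) \<sigma> y * \<psi> y"] int by (simp add: gmix_def)
  show "integrable P (\<lambda>x. \<integral>y. normal_density (loc x) \<sigma> y * \<psi> y \<partial>lborel)"
    using integrable_fst[of "\<lambda>x y. normal_density (loc x) \<sigma> y * \<psi> y"] int by simp
  show "(\<integral>y. f y * \<psi> y \<partial>lborel) = (\<integral>x. (\<integral>y. normal_density (loc x) \<sigma> y * \<psi> y \<partial>lborel) \<partial>P)"
    using Fubini_integral[of "\<lambda>x y. normal_density (loc x) \<sigma> y * \<psi> y"] int by (simp add: gmix_def)
qed

lemma
  shows integrable_gmix_density: "integrable lborel f" and integral_gmix_density: "integral\<^sup>L lborel f = 1"
proof -
  have "quadratic_growth (\<lambda>_. 1)"
    by (rule quadratic_growthI[of _ 1]) auto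
  from integrable_gmix[OF this] integral_gmix[OF this]
  show "integrable lborel f" "integral\<^sup>L lborel f = 1"
    by (auto simp: prob_space)
qed

text \<open>Every reference density \<open>g\<close> of mass at most 1 bounds the output entropy by
  a cross entropy, which is an average over the input of a one-Gaussian integral. The maximum
  entropy bounds below are two choices of \<open>g\<close>.\<close>

lemma entropy_gmix_le_cross:
  assumes g: "integrable lborel g" "integral\<^sup>L lborel g \<le> 1" "\<And>y. 0 < g y" "quadratic_growth (\<lambda>y. ln (g y))"
    and bound: "(\<integral>x. - (\<integral>y. normal_density (loc x) \<sigma> y * ln (g y) \<partial>lborel) \<partial>P) \<le> c"
  shows "entropy_density f \<le> c"
proof -
  have eq: "f y * ln (g y / f y) = f y * ln (g y) - f y * ln (f y)" for y
    by (simp add: ln_div g(3) right_diff_distrib less_imp_neq[symmetric])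
  have "(\<integral>y. f y * ln (g y / f y) \<partial>lborel) \<le> integral\<^sup>L lborel g - integral\<^sup>L lborel f"
    using g integrable_gmix_density integrable_gmix[OF g(4)] integrable_gmix[OF quadratic_growth_ln_gmix]
    by (intro gibbs_integral_le) (auto simp: eq)
  also have "\<dots> \<le> 0"
    using g(2) integral_gmix_density by simp
  finally have "entropy_density f \<le> - (\<integral>y. f y * ln (g y) \<partial>lborel)"
    unfolding eq entropy_density_def
    using integrable_gmix[OF g(4)] integrable_gmix[OF quadratic_growth_ln_gmix] by simp
  also have "\<dots> = (\<integral>x. - (\<integral>y. normal_density (loc x) \<sigma> y * ln (g y) \<partial>lborel) \<partial>P)"
    unfolding integral_gmix[OF g(4)] by simp
  finally show ?thesis
    using bound by linarith
qed

end

section \<open>Upper bounds on output entropies\<close>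

lemma mult_square_plus_one_le: "0 \<le> r \<Longrightarrow> r * y\<^sup>2 + 1 \<le> (r + 1) * (1 + y\<^sup>2)" for r y :: real
  by (simp add: algebra_simps)

context gauss_mixture
begin

lemma sigma_nonzero[simp]: "\<sigma> \<noteq> 0"
  using sigma_pos by linarith

text \<open>With a Gaussian reference centred at \<open>m\<close>, the cross entropy sees the input
  only through its second moment about \<open>m\<close>; the reference variance \<sigma>^2 + v is
  matched to it.\<close>

lemma entropy_gmix_le_gaussian:
  assumes v: "(\<integral>x. (loc x - m)\<^sup>2 \<partial>P) = v" and "0 \<le> v"
  shows "entropy_density f \<le> 1/2 * ln (2 * pi * exp 1 * \<sigma>\<^sup>2) + 1/2 * ln (1 + v / \<sigma>\<^sup>2)"
proof -
  define s where "s = sqrt (\<sigma>\<^sup>2 + v)"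
  have s2: "s\<^sup>2 = \<sigma>\<^sup>2 + v" and s: "0 < s"
    using \<open>0 \<le> v\<close> add_pos_nonneg[OF zero_less_power[OF sigma_pos, of 2] \<open>0 \<le> v\<close>] by (simp_all add: s_def)
  have inner: "- (\<integral>y. normal_density (loc x) \<sigma> y * ln (normal_density m s y) \<partial>lborel)
      = 1/2 * ln (2 * pi * s\<^sup>2) + (\<sigma>\<^sup>2 + (loc x - m)\<^sup>2) / (2 * s\<^sup>2)" for x
  proof -
    have "(\<integral>y. normal_density (loc x) \<sigma> y * ln (normal_density m s y) \<partial>lborel)
        = (\<integral>y. (- 1/2 * ln (2 * pi * s\<^sup>2)) * normal_density (loc x) \<sigma> y
            - (normal_density (loc x) \<sigma> y * (y - m)\<^sup>2) / (2 * s\<^sup>2) \<partial>lborel)"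
      unfolding ln_normal_density[OF s] by (simp add: algebra_simps)
    also have "\<dots> = - 1/2 * ln (2 * pi * s\<^sup>2) - (\<sigma>\<^sup>2 + (loc x - m)\<^sup>2) / (2 * s\<^sup>2)"
      using integrable_normal_square[of \<sigma> "loc x" m] integral_normal_square[of \<sigma> "loc x" m] by simp
    finally show ?thesis
      by simp
  qed
  have sq: "integrable P (\<lambda>x. (loc x - m)\<^sup>2)"
  proof (rule integrable_const_bound[where B = "(\<bar>B\<bar> + \<bar>m\<bar>)\<^sup>2"])
    have "\<bar>loc x - m\<bar> \<le> \<bar>B\<bar> + \<bar>m\<bar>" if "x \<in> space P" for x
      using loc_bound[OF that] by linarith
    then show "AE x in P. norm ((loc x - m)\<^sup>2) \<le> (\<bar>B\<bar> + \<bar>m\<bar>)\<^sup>2"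
      by (intro AE_I2) (metis abs_ge_zero norm_power power_mono real_norm_def)
  qed simp
  have "entropy_density f \<le> 1/2 * ln (2 * pi * s\<^sup>2) + (\<sigma>\<^sup>2 + v) / (2 * s\<^sup>2)"
  proof (rule entropy_gmix_le_cross[of "normal_density m s"])
    show "(\<integral>x. - (\<integral>y. normal_density (loc x) \<sigma> y * ln (normal_density m s y) \<partial>lborel) \<partial>P)
        \<le> 1/2 * ln (2 * pi * s\<^sup>2) + (\<sigma>\<^sup>2 + v) / (2 * s\<^sup>2)"
      unfolding inner using sq v by (simp add: prob_space)
  qed (use s in \<open>auto intro!: quadratic_growth_ln_normal_density normal_density_pos\<close>)
  also have "\<dots> = 1/2 * ln (2 * pi * s\<^sup>2) + 1/2"
    using s by (simp add: s2[symmetric])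
  also have "\<dots> = 1/2 * ln (2 * pi * exp 1 * \<sigma>\<^sup>2 * (1 + v / \<sigma>\<^sup>2))"
  proof -
    have "2 * pi * exp 1 * \<sigma>\<^sup>2 * (1 + v / \<sigma>\<^sup>2) = (2 * pi * s\<^sup>2) * exp 1"
      using sigma_pos by (simp add: s2 field_simps)
    then have "ln (2 * pi * exp 1 * \<sigma>\<^sup>2 * (1 + v / \<sigma>\<^sup>2)) = ln (2 * pi * s\<^sup>2) + ln (exp 1)"
      using s by (simp only: ln_mult_pos zero_less_mult_iff) (simp add: ln_mult)
    then show ?thesis
      by simp
  qed
  also have "\<dots> = 1/2 * ln (2 * pi * exp 1 * \<sigma>\<^sup>2) + 1/2 * ln (1 + v / \<sigma>\<^sup>2)"
    using \<open>0 \<le> v\<close> by (subst ln_mult_pos) (auto intro!: add_pos_nonneg mult_pos_pos simp: zero_less_power2)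
  finally show ?thesis .
qed

end

section \<open>The reference law with a flat part and Gaussian tails\<close>

lemma integral_reflect_lborel:
  fixes g :: "real \<Rightarrow> real"
  shows "(\<integral>y. g (c - y) \<partial>lborel) = integral\<^sup>L lborel g"
    and "integrable lborel (\<lambda>y. g (c - y)) \<longleftrightarrow> integrable lborel g"
  using lborel_integral_real_affine[of "-1" g c] lborel_integrable_real_affine_iff[of "-1" g c] by auto

text \<open>Since \<open>y\<^sup>2/\<sigma>\<^sup>2 - 1\<close> and the likelihood ratio of \<open>N(x,\<sigma>)\<close> against \<open>N(0,\<sigma>)\<close> are oppositely
  monotone on the negative half line, Chebyshev's argument compares with the case \<open>x = 0\<close>.\<close>

lemma normal_left_tail_excess_nonpos:
  assumes [simp]: "0 < \<sigma>" and "0 \<le> x"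
  shows "(\<integral>y. normal_density x \<sigma> y * (indicator {..<0} y * (y\<^sup>2 / \<sigma>\<^sup>2 - 1)) \<partial>lborel) \<le> 0"
proof -
  have [simp]: "\<sigma> \<noteq> 0"
    using \<open>0 < \<sigma>\<close> by linarith
  define e where "e y = y\<^sup>2 / \<sigma>\<^sup>2 - 1" for y :: real
  have eg: "quadratic_growth e"
  proof (rule quadratic_growthI)
    show "\<bar>e y\<bar> \<le> (1 / \<sigma>\<^sup>2 + 1) * (1 + y\<^sup>2)" for y
    proof -
      have "\<bar>e y\<bar> \<le> y\<^sup>2 / \<sigma>\<^sup>2 + 1"
        by (auto simp: e_def abs_le_iff)
      also have "\<dots> \<le> (1 / \<sigma>\<^sup>2 + 1) * (1 + y\<^sup>2)"
        using mult_square_plus_one_le[of "1 / \<sigma>\<^sup>2" y] by simp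
      finally show ?thesis .
    qed
  qed (simp add: e_def[abs_def])
  have [measurable]: "e \<in> borel_measurable borel"
    by (rule quadratic_growth_measurable[OF eg])
  have eig: "quadratic_growth (\<lambda>y. indicator S y * e y)" if [measurable]: "S \<in> sets borel" for S
  proof -
    obtain D where D: "\<And>y. \<bar>e y\<bar> \<le> D * (1 + y\<^sup>2)"
      using eg unfolding quadratic_growth_def by blast
    have "\<bar>indicator S y * e y\<bar> \<le> D * (1 + y\<^sup>2)" for y
      using D[of y] by (auto simp: indicator_def)
    then show ?thesis
      by (intro quadratic_growthI) auto
  qed
  note int = integrable_normal_quadratic_growth[OF _ eg] integrable_normal_quadratic_growth[OF _ eig]
  \<comment> \<open>For \<open>x = 0\<close> the two half-line integrals agree by symmetry and add
    up to the mean of y^2/\<sigma>^2 - 1, which is 0; hence each of them vanishes.\<close>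
  have "(\<integral>y. normal_density 0 \<sigma> y * (indicator {..<0} y * e y) \<partial>lborel)
      = (\<integral>y. normal_density 0 \<sigma> y * (indicator {0<..} y * e y) \<partial>lborel)"
    using integral_reflect_lborel(1)[of "\<lambda>y. normal_density 0 \<sigma> y * (indicator {..<0} y * e y)" 0, symmetric]
    by (simp add: normal_density_def e_def indicator_def cong: if_cong)
  moreover have "(\<integral>y. normal_density 0 \<sigma> y * (indicator {..<0} y * e y) \<partial>lborel)
      + (\<integral>y. normal_density 0 \<sigma> y * (indicator {0<..} y * e y) \<partial>lborel)
      = (\<integral>y. normal_density 0 \<sigma> y * e y \<partial>lborel)"
  proof -
    have "(\<integral>y. normal_density 0 \<sigma> y * (indicator {..<0} y * e y)
          + normal_density 0 \<sigma> y * (indicator {0<..} y * e y) \<partial>lborel)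
        = (\<integral>y. normal_density 0 \<sigma> y * e y \<partial>lborel)"
      by (intro integral_cong_AE) (auto intro!: AE_I[where N="{0}"] simp: indicator_def)
    then show ?thesis
      using int by simp
  qed
  moreover have "(\<integral>y. normal_density 0 \<sigma> y * e y \<partial>lborel) = 0"
  proof -
    have "(\<integral>y. normal_density 0 \<sigma> y * e y \<partial>lborel)
        = (\<integral>y. (normal_density 0 \<sigma> y * (y - 0)\<^sup>2) / \<sigma>\<^sup>2 - normal_density 0 \<sigma> y \<partial>lborel)"
      by (simp add: e_def algebra_simps)
    also have "\<dots> = 0"
      using integrable_normal_square[of \<sigma> 0 0] integral_normal_square[of \<sigma> 0 0] by simp
    finally show ?thesis .
  qed
  ultimately have 0: "(\<integral>y. normal_density 0 \<sigma> y * (indicator {..<0} y * e y) \<partial>lborel) = 0"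
    by linarith
  \<comment> \<open>\<open>C\<close> is the likelihood ratio of N(x,\<sigma>) against N(0,\<sigma>)
    at y = -\<sigma>, the point of the negative half line where \<open>e\<close> changes sign. On
    either side of it, replacing the ratio by \<open>C\<close> can only increase the
    integrand.\<close>
  define C where "C = exp (- x\<^sup>2 / (2 * \<sigma>\<^sup>2)) * exp (- x / \<sigma>)"
  have "(\<integral>y. normal_density x \<sigma> y * (indicator {..<0} y * e y) \<partial>lborel)
      \<le> (\<integral>y. C * (normal_density 0 \<sigma> y * (indicator {..<0} y * e y)) \<partial>lborel)"
  proof (intro integral_mono integrable_mult_right int)
    fix y :: real
    have N: "normal_density x \<sigma> y = normal_density 0 \<sigma> y * (exp (- x\<^sup>2 / (2 * \<sigma>\<^sup>2)) * exp (x * y / \<sigma>\<^sup>2))"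
    proof -
      have "- (y - x)\<^sup>2 / (2 * \<sigma>\<^sup>2) = - (y - 0)\<^sup>2 / (2 * \<sigma>\<^sup>2) + (- x\<^sup>2 / (2 * \<sigma>\<^sup>2) + x * y / \<sigma>\<^sup>2)"
        by (simp add: field_simps power2_eq_square)
      then have "exp (- (y - x)\<^sup>2 / (2 * \<sigma>\<^sup>2)) = exp (- (y - 0)\<^sup>2 / (2 * \<sigma>\<^sup>2)) * (exp (- x\<^sup>2 / (2 * \<sigma>\<^sup>2)) * exp (x * y / \<sigma>\<^sup>2))"
        by (simp only: exp_add)
      then show ?thesis
        by (simp only: normal_density_def mult.assoc)
    qed
    have "exp (x * y / \<sigma>\<^sup>2) * e y \<le> exp (- x / \<sigma>) * e y" if "y < 0"
    proof (cases "y \<le> - \<sigma>")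
      case True
      then have "\<sigma>\<^sup>2 \<le> (- y)\<^sup>2"
        by (intro power_mono) (auto intro: less_imp_le)
      then have "0 \<le> e y"
        by (simp add: e_def field_simps)
      moreover have "x * y / \<sigma>\<^sup>2 \<le> - x / \<sigma>"
        using mult_left_mono[OF True \<open>0 \<le> x\<close>] by (simp add: field_simps power2_eq_square)
      ultimately show ?thesis
        by (intro mult_right_mono) auto
    next
      case False
      then have "(- y)\<^sup>2 \<le> \<sigma>\<^sup>2"
        using \<open>y < 0\<close> by (intro power_mono) auto
      then have "e y \<le> 0"
        by (simp add: e_def field_simps)
      moreover have "- x / \<sigma> \<le> x * y / \<sigma>\<^sup>2"
        using mult_left_mono[of "-\<sigma>" y x] False \<open>0 \<le> x\<close> by (simp add: field_simps power2_eq_square)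
      ultimately show ?thesis
        by (intro mult_right_mono_neg) auto
    qed
    then have "indicator {..<0} y * (exp (x * y / \<sigma>\<^sup>2) * e y) \<le> indicator {..<0} y * (exp (- x / \<sigma>) * e y)"
      by (auto split: split_indicator)
    then have "(normal_density 0 \<sigma> y * exp (- x\<^sup>2 / (2 * \<sigma>\<^sup>2))) * (indicator {..<0} y * (exp (x * y / \<sigma>\<^sup>2) * e y))
        \<le> (normal_density 0 \<sigma> y * exp (- x\<^sup>2 / (2 * \<sigma>\<^sup>2))) * (indicator {..<0} y * (exp (- x / \<sigma>) * e y))"
      by (rule mult_left_mono) simp
    then show "normal_density x \<sigma> y * (indicator {..<0} y * e y)
        \<le> C * (normal_density 0 \<sigma> y * (indicator {..<0} y * e y))"
      unfolding N C_def by (simp only: mult_ac)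
  qed auto
  then show ?thesis
    using 0 by (simp add: e_def)
qed

text \<open>The flat height is \<open>exp\<close> of minus the noise entropy, not the peak value of
  the Gaussian, so the function jumps at \<open>0\<close> and \<open>B\<close>. With this height,
  minus its logarithm is the noise entropy on \<open>[0, B]\<close> and differs from it in the tails
  by half of the excess y^2/\<sigma>^2 - 1.\<close>

definition flat_gauss :: "real \<Rightarrow> real \<Rightarrow> real \<Rightarrow> real" where
  "flat_gauss B \<sigma> y = (if y < 0 then normal_density 0 \<sigma> y
     else if y \<le> B then 1 / sqrt (2 * pi * exp 1 * \<sigma>\<^sup>2) else normal_density B \<sigma> y)"

lemma integral_flat_gauss:
  assumes "0 < \<sigma>" "0 \<le> B"
  shows "integrable lborel (flat_gauss B \<sigma>)"
    and "integral\<^sup>L lborel (flat_gauss B \<sigma>) = 1 + B / sqrt (2 * pi * exp 1 * \<sigma>\<^sup>2)"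
proof -
  define k where "k = 1 / sqrt (2 * pi * exp 1 * \<sigma>\<^sup>2)"
  have eq: "flat_gauss B \<sigma> y = indicator {..<0} y *\<^sub>R normal_density 0 \<sigma> y + k * indicator {0..B} y
      + indicator {B<..} y *\<^sub>R normal_density B \<sigma> y" for y
    using assms by (auto simp: flat_gauss_def k_def indicator_def)
  have i1: "integrable lborel (\<lambda>y. indicator {..<0} y *\<^sub>R normal_density 0 \<sigma> y)"
    and i2: "integrable lborel (\<lambda>y. indicator {B<..} y *\<^sub>R normal_density B \<sigma> y)"
    and i2': "integrable lborel (\<lambda>y. indicator {0<..} y *\<^sub>R normal_density 0 \<sigma> y)"
    and i3: "integrable lborel (\<lambda>y. k * indicator {0..B} y)"
    using assms by (intro integrable_mult_indicator integrable_mult_right integrable_real_indicator; simp)+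
  show "integrable lborel (flat_gauss B \<sigma>)"
    unfolding eq[abs_def] using i1 i2 i3 by auto
  have "(\<integral>y. indicator {B<..} y *\<^sub>R normal_density B \<sigma> y \<partial>lborel)
      = (\<integral>y. indicator {0<..} y *\<^sub>R normal_density 0 \<sigma> y \<partial>lborel)"
    using lborel_integral_real_affine[of 1 "\<lambda>y. indicator {B<..} y *\<^sub>R normal_density B \<sigma> y" B]
    by (simp add: normal_density_def indicator_def)
  moreover have "(\<integral>y. indicator {..<0} y *\<^sub>R normal_density 0 \<sigma> y \<partial>lborel)
      + (\<integral>y. indicator {0<..} y *\<^sub>R normal_density 0 \<sigma> y \<partial>lborel) = 1"
  proof -
    have "(\<integral>y. indicator {..<0} y *\<^sub>R normal_density 0 \<sigma> y + indicator {0<..} y *\<^sub>R normal_density 0 \<sigma> y \<partial>lborel)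
        = (\<integral>y. normal_density 0 \<sigma> y \<partial>lborel)"
      by (intro integral_cong_AE) (auto intro!: AE_I[where N="{0}"] simp: indicator_def)
    then show ?thesis
      using i1 i2' assms by simp
  qed
  moreover have "measure lborel {0..B} = B"
    using assms by simp
  ultimately show "integral\<^sup>L lborel (flat_gauss B \<sigma>) = 1 + B / sqrt (2 * pi * exp 1 * \<sigma>\<^sup>2)"
    unfolding eq[abs_def] using i1 i2 i3 by (simp add: k_def del: measure_lborel_Icc content_real_if)
qed

context gauss_mixture
begin

text \<open>The bound of McKellips: the reference output law is flat on \<open>[0,B]\<close> with Gaussian tails.\<close>

lemma entropy_gmix_le_peak:
  assumes "0 \<le> B"
  shows "entropy_density f \<le> 1/2 * ln (2 * pi * exp 1 * \<sigma>\<^sup>2) + ln (1 + B / sqrt (2 * pi * exp 1 * \<sigma>\<^sup>2))"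
proof -
  define \<delta> where "\<delta> = B / sqrt (2 * pi * exp 1 * \<sigma>\<^sup>2)"
  define h0 where "h0 = 1/2 * ln (2 * pi * exp 1 * \<sigma>\<^sup>2)"
  define g where "g y = flat_gauss B \<sigma> y / (1 + \<delta>)" for y
  have d: "0 \<le> \<delta>"
    using assms by (simp add: \<delta>_def)
  \<comment> \<open>Up to the constant \<open>ln (1 + \<delta>) + h0\<close>, minus the logarithm of
    the reference is half the sum of these two excesses, and each has nonpositive mean for every
    input in \<open>[0, B]\<close>; the right one reduces to the left one by reflection.\<close>
  define tl where "tl y = indicator {..<0} y * (y\<^sup>2 / \<sigma>\<^sup>2 - 1)" for y :: real
  define tr where "tr y = indicator {B<..} y * ((y - B)\<^sup>2 / \<sigma>\<^sup>2 - 1)" for y :: real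
  have h0: "h0 = 1/2 * ln (2 * pi * \<sigma>\<^sup>2) + 1/2"
    using sigma_pos by (simp add: h0_def ln_mult)
  have gpos: "0 < g y" for y
    using d by (auto simp: g_def flat_gauss_def normal_density_pos intro!: divide_pos_pos)
  have lng: "ln (g y) = - (ln (1 + \<delta>) + h0) + (- (1/2) * tl y + - (1/2) * tr y)" for y
  proof -
    have "ln (g y) = ln (flat_gauss B \<sigma> y) - ln (1 + \<delta>)"
      using d by (simp add: g_def flat_gauss_def ln_div normal_density_pos less_imp_neq[OF normal_density_pos, symmetric])
    moreover have "ln (flat_gauss B \<sigma> y) = - h0 - 1/2 * tl y - 1/2 * tr y"
    proof -
      consider "y < 0" | "0 \<le> y" "y \<le> B" | "B < y" by linarith
      then show ?thesis
      proof cases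
        case 1
        then show ?thesis
          using assms by (simp add: flat_gauss_def tl_def tr_def h0 ln_normal_density[OF sigma_pos] algebra_simps)
      next
        case 2
        then show ?thesis
          by (simp add: flat_gauss_def tl_def tr_def h0_def ln_div ln_sqrt)
      next
        case 3
        then show ?thesis
          using assms by (simp add: flat_gauss_def tl_def tr_def h0 ln_normal_density[OF sigma_pos] algebra_simps)
      qed
    qed
    ultimately show ?thesis by simp
  qed
  have q1: "quadratic_growth tl"
  proof (rule quadratic_growthI)
    show "\<bar>tl y\<bar> \<le> (1 / \<sigma>\<^sup>2 + 1) * (1 + y\<^sup>2)" for y
    proof -
      have "\<bar>tl y\<bar> \<le> y\<^sup>2 / \<sigma>\<^sup>2 + 1"
        by (auto simp: tl_def indicator_def abs_le_iff)
      also have "\<dots> \<le> (1 / \<sigma>\<^sup>2 + 1) * (1 + y\<^sup>2)"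
        using mult_square_plus_one_le[of "1 / \<sigma>\<^sup>2" y] by simp
      finally show ?thesis .
    qed
  qed (simp add: tl_def[abs_def])
  have tr_eq: "tr y = tl (B - y)" for y
    by (auto simp: tl_def tr_def indicator_def power2_commute)
  have "quadratic_growth (\<lambda>y. indicator {0<..} (y - B) * ((y - B)\<^sup>2 / \<sigma>\<^sup>2 - 1))"
  proof (rule quadratic_growth_shift[of "\<lambda>y. indicator {0<..} y * (y\<^sup>2 / \<sigma>\<^sup>2 - 1)"], rule quadratic_growthI)
    show "\<bar>indicator {0<..} y * (y\<^sup>2 / \<sigma>\<^sup>2 - 1)\<bar> \<le> (1 / \<sigma>\<^sup>2 + 1) * (1 + y\<^sup>2)" for y :: real
    proof -
      have "\<bar>indicator {0<..} y * (y\<^sup>2 / \<sigma>\<^sup>2 - 1)\<bar> \<le> y\<^sup>2 / \<sigma>\<^sup>2 + 1"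
        by (auto simp: indicator_def abs_le_iff)
      also have "\<dots> \<le> (1 / \<sigma>\<^sup>2 + 1) * (1 + y\<^sup>2)"
        using mult_square_plus_one_le[of "1 / \<sigma>\<^sup>2" y] by simp
      finally show ?thesis .
    qed
  qed simp
  then have q2: "quadratic_growth tr"
    by (simp add: tr_def[abs_def] indicator_def)
  have qc: "quadratic_growth (\<lambda>_. c)" for c
    by (rule quadratic_growthI[of _ "\<bar>c\<bar>"]) (auto simp: algebra_simps)
  have inner: "- (\<integral>y. normal_density (loc x) \<sigma> y * ln (g y) \<partial>lborel) \<le> ln (1 + \<delta>) + h0" if x: "x \<in> space P" for x
  proof -
    have "(\<integral>y. normal_density (loc x) \<sigma> y * tr y \<partial>lborel) = (\<integral>y. normal_density (B - loc x) \<sigma> y * tl y \<partial>lborel)"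
      using integral_reflect_lborel(1)[of "\<lambda>y. normal_density (loc x) \<sigma> y * tr y" B]
      by (simp add: tr_eq normal_density_reflect)
    also have "\<dots> \<le> 0"
      unfolding tl_def using loc_bound[OF x] by (intro normal_left_tail_excess_nonpos) auto
    finally have 1: "(\<integral>y. normal_density (loc x) \<sigma> y * tr y \<partial>lborel) \<le> 0" .
    have 2: "(\<integral>y. normal_density (loc x) \<sigma> y * tl y \<partial>lborel) \<le> 0"
      unfolding tl_def using loc_bound[OF x] by (intro normal_left_tail_excess_nonpos) auto
    have "(\<integral>y. normal_density (loc x) \<sigma> y * ln (g y) \<partial>lborel)
        = (\<integral>y. - (ln (1 + \<delta>) + h0) * normal_density (loc x) \<sigma> y
            - (1/2) * (normal_density (loc x) \<sigma> y * tl y) - (1/2) * (normal_density (loc x) \<sigma> y * tr y) \<partial>lborel)"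
      by (simp add: lng algebra_simps)
    also have "\<dots> = - (ln (1 + \<delta>) + h0) - (1/2) * (\<integral>y. normal_density (loc x) \<sigma> y * tl y \<partial>lborel)
         - (1/2) * (\<integral>y. normal_density (loc x) \<sigma> y * tr y \<partial>lborel)"
      using integrable_normal_quadratic_growth[OF sigma_pos q1, of "loc x"]
        integrable_normal_quadratic_growth[OF sigma_pos q2, of "loc x"]
      by simp
    finally show ?thesis
      using 1 2 by linarith
  qed
  have qg: "quadratic_growth (\<lambda>y. ln (g y))"
    unfolding lng by (intro quadratic_growth_add quadratic_growth_cmult qc q1 q2)
  have "entropy_density f \<le> ln (1 + \<delta>) + h0"
  proof (rule entropy_gmix_le_cross[of g])
    show "integrable lborel g" "integral\<^sup>L lborel g \<le> 1"
      using integral_flat_gauss[of \<sigma> B] assms d by (auto simp: g_def[abs_def] \<delta>_def)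
    have "(\<integral>x. - (\<integral>y. normal_density (loc x) \<sigma> y * ln (g y) \<partial>lborel) \<partial>P) \<le> (\<integral>x. ln (1 + \<delta>) + h0 \<partial>P)"
      using inner integrable_gmix_inner[OF qg] by (intro integral_mono) auto
    then show "(\<integral>x. - (\<integral>y. normal_density (loc x) \<sigma> y * ln (g y) \<partial>lborel) \<partial>P) \<le> ln (1 + \<delta>) + h0"
      by (simp add: prob_space)
  qed (use gpos qg in auto)
  then show ?thesis
    by (simp add: h0_def \<delta>_def)
qed

end

section \<open>Data processing for additive noise\<close>

lemma lborel_shift_integral:
  fixes g :: "real \<Rightarrow> real"
  shows "(\<integral>y. g (y - s) \<partial>lborel) = integral\<^sup>L lborel g"
    and "integrable lborel (\<lambda>y. g (y - s)) \<longleftrightarrow> integrable lborel g"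
  using lborel_integral_real_affine[of 1 g "-s"] lborel_integrable_real_affine_iff[of 1 g "-s"] by auto

text \<open>For fixed \<open>s\<close>, a shift of \<open>y\<close> changes no Lebesgue integral;
  the factors are swapped so that Fubini can integrate over \<open>y\<close> first.\<close>

lemma product_shift_integral:
  fixes g :: "real \<Rightarrow> real" and \<kappa> :: "real measure"
  assumes "prob_space \<kappa>" and sets[measurable_cong]: "sets \<kappa> = sets borel" and g: "integrable lborel g"
  shows "integrable (lborel \<Otimes>\<^sub>M \<kappa>) (\<lambda>(y, s). g (y - s))"
    and "(\<integral>z. (case z of (y, s) \<Rightarrow> g (y - s)) \<partial>(lborel \<Otimes>\<^sub>M \<kappa>)) = integral\<^sup>L lborel g"
proof -
  interpret \<kappa>: prob_space \<kappa> by fact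
  interpret A: pair_sigma_finite \<kappa> lborel
    by unfold_locales
  interpret B: pair_sigma_finite lborel \<kappa>
    by unfold_locales
  have [measurable]: "g \<in> borel_measurable borel"
    using g by auto
  have 1: "integrable (\<kappa> \<Otimes>\<^sub>M lborel) (\<lambda>(s, y). g (y - s))"
    by (rule A.Fubini_integrable)
       (use g lborel_shift_integral(1)[of "\<lambda>y. \<bar>g y\<bar>"] in \<open>auto simp: lborel_shift_integral(2)\<close>)
  then show "integrable (lborel \<Otimes>\<^sub>M \<kappa>) (\<lambda>(y, s). g (y - s))"
    using A.integrable_product_swap_iff[of "\<lambda>(s, y). g (y - s)"] by (simp add: case_prod_beta)
  have "(\<integral>z. (case z of (y, s) \<Rightarrow> g (y - s)) \<partial>(lborel \<Otimes>\<^sub>M \<kappa>)) = (\<integral>z. (case z of (s, y) \<Rightarrow> g (y - s)) \<partial>(\<kappa> \<Otimes>\<^sub>M lborel))"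
    using A.integral_product_swap[of "\<lambda>(s, y). g (y - s)"] 1 by simp
  also have "\<dots> = (\<integral>s. (\<integral>y. g (y - s) \<partial>lborel) \<partial>\<kappa>)"
    using A.integral_fst'[OF 1] by simp
  also have "\<dots> = integral\<^sup>L lborel g"
    by (simp add: lborel_shift_integral(1) \<kappa>.prob_space)
  finally show "(\<integral>z. (case z of (y, s) \<Rightarrow> g (y - s)) \<partial>(lborel \<Otimes>\<^sub>M \<kappa>)) = integral\<^sup>L lborel g" .
qed

text \<open>Here \<open>s\<close> is integrated first: \<psi> depends on \<open>y\<close> alone, and
  the inner integral of \<open>p (y - s)\<close> is the smeared density \<open>q\<close>.\<close>

lemma product_smear_integral:
  fixes p q \<psi> :: "real \<Rightarrow> real" and \<kappa> :: "real measure"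
  assumes "prob_space \<kappa>" and sets[measurable_cong]: "sets \<kappa> = sets borel"
    and [measurable]: "p \<in> borel_measurable borel" "\<psi> \<in> borel_measurable borel"
    and p: "\<And>y. 0 \<le> p y" "\<And>y. integrable \<kappa> (\<lambda>s. p (y - s))"
    and q: "\<And>y. q y = (\<integral>s. p (y - s) \<partial>\<kappa>)" "integrable lborel (\<lambda>y. q y * \<psi> y)"
  shows "integrable (lborel \<Otimes>\<^sub>M \<kappa>) (\<lambda>(y, s). p (y - s) * \<psi> y)"
    and "(\<integral>z. (case z of (y, s) \<Rightarrow> p (y - s) * \<psi> y) \<partial>(lborel \<Otimes>\<^sub>M \<kappa>)) = (\<integral>y. q y * \<psi> y \<partial>lborel)"
proof -
  interpret \<kappa>: prob_space \<kappa> by fact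
  interpret B: pair_sigma_finite lborel \<kappa>
    by unfold_locales
  have q0: "0 \<le> q y" for y
    unfolding q using p by (intro integral_nonneg_AE) auto
  show 1: "integrable (lborel \<Otimes>\<^sub>M \<kappa>) (\<lambda>(y, s). p (y - s) * \<psi> y)"
  proof (rule B.Fubini_integrable)
    have "(\<integral>s. norm (case (y, s) of (y, s) \<Rightarrow> p (y - s) * \<psi> y) \<partial>\<kappa>) = \<bar>q y * \<psi> y\<bar>" for y
      using p q0 by (simp add: abs_mult q)
    then show "integrable lborel (\<lambda>y. \<integral>s. norm (case (y, s) of (y, s) \<Rightarrow> p (y - s) * \<psi> y) \<partial>\<kappa>)"
      using q(2) by simp
  qed (use p in auto)
  show "(\<integral>z. (case z of (y, s) \<Rightarrow> p (y - s) * \<psi> y) \<partial>(lborel \<Otimes>\<^sub>M \<kappa>)) = (\<integral>y. q y * \<psi> y \<partial>lborel)"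
    using B.integral_fst'[OF 1] p by (simp add: q)
qed

text \<open>Gibbs' inequality on \<open>(output, extra noise)\<close> compares the joint density \<open>p\<^sub>i(y - s)\<close> with
  \<open>f(y - s) q\<^sub>i(y) / F(y)\<close>; summed over the messages both have the same mass.\<close>

lemma data_processing:
  fixes p q :: "nat \<Rightarrow> real \<Rightarrow> real" and f F :: "real \<Rightarrow> real" and \<kappa> :: "real measure" and K :: nat
  assumes "prob_space \<kappa>" and sets[measurable_cong]: "sets \<kappa> = sets borel" and K: "0 < K"
    and p: "\<And>i y. 0 < p i y" "\<And>i. integrable lborel (p i)" "\<And>i. integral\<^sup>L lborel (p i) = 1"
      "\<And>i y. integrable \<kappa> (\<lambda>s. p i (y - s))"
    and q: "\<And>i y. 0 < q i y" "\<And>i. integrable lborel (q i)" "\<And>i y. q i y = (\<integral>s. p i (y - s) \<partial>\<kappa>)"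
    and f: "\<And>y. f y = (\<Sum>i<K. p i y) / real K" and F: "\<And>y. F y = (\<Sum>i<K. q i y) / real K"
    and ip: "\<And>i. integrable lborel (\<lambda>y. p i y * ln (f y / p i y))"
    and iq: "\<And>i. integrable lborel (\<lambda>y. q i y * ln (q i y / F y))"
  shows "(\<Sum>i<K. \<integral>y. q i y * ln (q i y / F y) \<partial>lborel) \<le> (\<Sum>i<K. \<integral>y. p i y * ln (p i y / f y) \<partial>lborel)"
proof -
  interpret \<kappa>: prob_space \<kappa> by fact
  interpret B: pair_sigma_finite lborel \<kappa>
    by unfold_locales
  let ?M = "lborel \<Otimes>\<^sub>M \<kappa>"
  have [measurable]: "p i \<in> borel_measurable borel" "q i \<in> borel_measurable borel" for i
    using p(2)[of i] q(2)[of i] by auto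
  have f_eq: "f = (\<lambda>y. (\<Sum>i<K. p i y) / real K)" and F_eq: "F = (\<lambda>y. (\<Sum>i<K. q i y) / real K)"
    using f F by auto
  have [measurable]: "f \<in> borel_measurable borel" "F \<in> borel_measurable borel"
    unfolding f_eq F_eq by measurable
  have fpos: "0 < f y" and Fpos: "0 < F y" for y
    unfolding f F using K p(1) q(1) by (auto intro!: divide_pos_pos sum_pos)
  have fint: "integrable lborel f" "integral\<^sup>L lborel f = 1"
    unfolding f_eq using p K by auto
  define a where "a i = (\<lambda>(y, s). p i (y - s))" for i
  define b where "b i = (\<lambda>(y, s). f (y - s) * (q i y / F y))" for i
  have a: "integrable ?M (a i)" "integral\<^sup>L ?M (a i) = 1" for i
    unfolding a_def using product_shift_integral[OF assms(1,2) p(2)[of i]] p(3) by auto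
  have fM: "integrable ?M (\<lambda>(y, s). f (y - s))" "(\<integral>z. (case z of (y, s) \<Rightarrow> f (y - s)) \<partial>?M) = 1"
    using product_shift_integral[OF assms(1,2) fint(1)] fint(2) by auto
  have bpos: "0 < b i z" for i z
    unfolding b_def using fpos Fpos q(1) by (auto split: prod.split)
  have apos: "0 < a i z" for i z
    unfolding a_def using p(1) by (auto split: prod.split)
  have qF: "(\<Sum>i<K. q i y / F y) = real K" for y
    unfolding sum_divide_distrib[symmetric] F using K Fpos[of y, unfolded F] by (auto simp: zero_less_divide_iff)
  have qF_le: "q i y / F y \<le> real K" if "i < K" for i y
    unfolding qF[of y, symmetric] using that q(1) Fpos
    by (intro member_le_sum) (auto intro!: divide_nonneg_nonneg less_imp_le)
  have b: "integrable ?M (b i)" if "i < K" for i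
  proof (rule Bochner_Integration.integrable_bound[of _ "\<lambda>z. real K * (case z of (y, s) \<Rightarrow> f (y - s))"])
    show "integrable ?M (\<lambda>z. real K * (case z of (y, s) \<Rightarrow> f (y - s)))"
      using fM(1) by auto
    show "b i \<in> borel_measurable ?M"
      unfolding b_def by measurable
    show "AE z in ?M. norm (b i z) \<le> norm (real K * (case z of (y, s) \<Rightarrow> f (y - s)))"
    proof (intro AE_I2)
      fix z :: "real \<times> real"
      obtain y s where z: "z = (y, s)" by (cases z)
      have "f (y - s) * (q i y / F y) \<le> f (y - s) * real K"
        using fpos qF_le[OF that] by (intro mult_left_mono) (auto intro: less_imp_le)
      then show "norm (b i z) \<le> norm (real K * (case z of (y, s) \<Rightarrow> f (y - s)))"
        using bpos[of i z] fpos[of "y - s"] by (simp add: z b_def mult.commute)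
    qed
  qed
  \<comment> \<open>The posteriors \<open>q i y / F y\<close> add up to \<open>K\<close> at every
    \<open>y\<close>, so after summation over the messages only \<open>K * f (y - s)\<close> remains
    to be integrated.\<close>
  have sum_b: "(\<Sum>i<K. integral\<^sup>L ?M (b i)) = real K"
  proof -
    have "(\<Sum>i<K. integral\<^sup>L ?M (b i)) = (\<integral>z. (\<Sum>i<K. b i z) \<partial>?M)"
      using b by (subst Bochner_Integration.integral_sum) auto
    also have "\<dots> = (\<integral>z. real K * (case z of (y, s) \<Rightarrow> f (y - s)) \<partial>?M)"
    proof (intro Bochner_Integration.integral_cong refl)
      fix z :: "real \<times> real"
      obtain y s where z: "z = (y, s)" by (cases z)
      have "(\<Sum>i<K. b i z) = f (y - s) * (\<Sum>i<K. q i y / F y)"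
        unfolding z b_def sum_distrib_left by simp
      then show "(\<Sum>i<K. b i z) = real K * (case z of (y, s) \<Rightarrow> f (y - s))"
        unfolding qF by (simp add: z)
    qed
    finally show ?thesis
      using fM by simp
  qed
  have 1: "integrable ?M (\<lambda>(y, s). p i (y - s) * ln (f (y - s) / p i (y - s)))"
    "(\<integral>z. (case z of (y, s) \<Rightarrow> p i (y - s) * ln (f (y - s) / p i (y - s))) \<partial>?M) = (\<integral>y. p i y * ln (f y / p i y) \<partial>lborel)" for i
    using product_shift_integral[OF assms(1,2) ip[of i]] by auto
  have 2: "integrable ?M (\<lambda>(y, s). p i (y - s) * ln (q i y / F y))"
    "(\<integral>z. (case z of (y, s) \<Rightarrow> p i (y - s) * ln (q i y / F y)) \<partial>?M) = (\<integral>y. q i y * ln (q i y / F y) \<partial>lborel)" for i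
    using product_smear_integral[OF assms(1,2) _ _ _ p(4)[of i] q(3)[of i] iq[of i]] p(1)
    by (auto simp: less_imp_le)
  \<comment> \<open>The log-ratio splits into a term in \<open>y - s\<close>, evaluated by the shift
    lemma, and a term in \<open>y\<close>, evaluated by the smearing lemma.\<close>
  have ab: "a i z * ln (b i z / a i z) = (case z of (y, s) \<Rightarrow> p i (y - s) * ln (f (y - s) / p i (y - s)))
      + (case z of (y, s) \<Rightarrow> p i (y - s) * ln (q i y / F y))" for i z
  proof -
    obtain y s where z: "z = (y, s)" by (cases z)
    have "ln (b i z / a i z) = ln ((f (y - s) / p i (y - s)) * (q i y / F y))"
      by (simp add: z a_def b_def mult.commute)
    also have "\<dots> = ln (f (y - s) / p i (y - s)) + ln (q i y / F y)"
      using fpos Fpos p(1) q(1) by (intro ln_mult_pos) auto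
    finally show ?thesis
      by (simp add: z a_def distrib_left)
  qed
  have "(\<integral>y. p i y * ln (f y / p i y) \<partial>lborel) + (\<integral>y. q i y * ln (q i y / F y) \<partial>lborel)
      \<le> integral\<^sup>L ?M (b i) - 1" if "i < K" for i
  proof -
    have "(\<integral>z. a i z * ln (b i z / a i z) \<partial>?M) \<le> (\<integral>z. b i z - a i z \<partial>?M)"
      using a b[OF that] 1 2 bpos apos by (intro integral_mono gibbs_pointwise(1)) (auto simp: ab)
    then show ?thesis
      using a b[OF that] 1 2 by (simp add: ab)
  qed
  then have "(\<Sum>i<K. (\<integral>y. p i y * ln (f y / p i y) \<partial>lborel) + (\<integral>y. q i y * ln (q i y / F y) \<partial>lborel))
      \<le> (\<Sum>i<K. integral\<^sup>L ?M (b i) - 1)"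
    by (intro sum_mono) auto
  moreover have "(\<integral>y. p i y * ln (f y / p i y) \<partial>lborel) = - (\<integral>y. p i y * ln (p i y / f y) \<partial>lborel)" for i
  proof -
    have "p i y * ln (f y / p i y) = - (p i y * ln (p i y / f y))" for y
      using fpos[of y] p(1)[of i y] by (simp add: ln_div less_imp_neq[symmetric] algebra_simps)
    then show ?thesis by simp
  qed
  ultimately show ?thesis
    using sum_b by (simp add: sum.distrib sum_subtractf sum_negf)
qed

section \<open>Entropy power inequality for uniform plus Gaussian\<close>

text \<open>Substitution on \<open>[-n, n]\<close> followed by monotone convergence on both sides.
  The range of \<open>g\<close> is left as a union of intervals, because the two applications need
  different facts about it: equality with \<open>[0, B]\<close> up to a null set, and the trivial
  bound of its indicator by 1.\<close>

lemma nn_integral_substitution_UNIV: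
  fixes f :: "real \<Rightarrow> ennreal" and g g' :: "real \<Rightarrow> real"
  assumes [measurable]: "f \<in> borel_measurable borel"
    and deriv: "\<And>x. (g has_real_derivative g' x) (at x)"
    and cont: "continuous_on UNIV g'" and nonneg: "\<And>x. 0 \<le> g' x"
  shows "(\<integral>\<^sup>+x. f (g x) * ennreal (g' x) \<partial>lborel)
    = (\<integral>\<^sup>+y. f y * indicator (\<Union>n::nat. {g (- real (Suc n))..g (real (Suc n))}) y \<partial>lborel)"
proof -
  have [measurable]: "g' \<in> borel_measurable borel" "g \<in> borel_measurable borel"
    using cont DERIV_continuous_on[of UNIV g g'] deriv
    by (auto intro!: borel_measurable_continuous_onI)
  have mono: "g x \<le> g y" if "x \<le> y" for x y
    using DERIV_nonneg_imp_nondecreasing[OF that] deriv nonneg by blast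
  let ?L = "density lborel (\<lambda>x. f (g x) * ennreal (g' x))"
  let ?A = "\<lambda>n::nat. {- real (Suc n)..real (Suc n)}"
  let ?B = "\<lambda>n::nat. {g (- real (Suc n))..g (real (Suc n))}"
  have "(\<Union>n. ?A n) = UNIV"
  proof (intro set_eqI iffI UNIV_I)
    fix x :: real
    obtain n :: nat where "\<bar>x\<bar> \<le> real n"
      using real_arch_simple by blast
    then have "x \<in> ?A n" by auto
    then show "x \<in> (\<Union>n. ?A n)" by blast
  qed
  then have "(\<integral>\<^sup>+x. f (g x) * ennreal (g' x) \<partial>lborel) = emeasure ?L (\<Union>n. ?A n)"
    by (simp add: emeasure_density)
  also have "\<dots> = (SUP n. emeasure ?L (?A n))"
    by (intro SUP_emeasure_incseq[symmetric]) (auto simp: incseq_def)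
  also have "\<dots> = (SUP n. emeasure (density lborel f) (?B n))"
  proof (intro SUP_cong refl)
    fix n :: nat
    have "(\<integral>\<^sup>+x. f x * indicator (?B n) x \<partial>lborel) = (\<integral>\<^sup>+x. f (g x) * g' x * indicator (?A n) x \<partial>lborel)"
      using deriv nonneg cont by (intro nn_integral_substitution_aux) (auto intro: continuous_on_subset)
    then show "emeasure ?L (?A n) = emeasure (density lborel f) (?B n)"
      by (simp add: emeasure_density)
  qed
  also have "\<dots> = emeasure (density lborel f) (\<Union>n. ?B n)"
  proof (intro SUP_emeasure_incseq)
    show "incseq ?B"
    proof (rule incseq_SucI)
      fix n
      have "g (- real (Suc (Suc n))) \<le> g (- real (Suc n))" "g (real (Suc n)) \<le> g (real (Suc (Suc n)))"
        by (auto intro: mono)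
      then show "?B n \<le> ?B (Suc n)" by auto
    qed
  qed auto
  finally show ?thesis
    by (simp add: emeasure_density)
qed

section \<open>The standard normal distribution function and the uniform law\<close>

abbreviation (input) gauss_cdf :: "real \<Rightarrow> real" where
  "gauss_cdf \<equiv> cdf (density lborel std_normal_density)"

lemma real_distribution_std_normal: "real_distribution (density lborel std_normal_density)"
  using prob_space_normal_density[of 1 0] by (simp add: real_distribution_def real_distribution_axioms_def)

lemma gauss_cdf_has_derivative: "(gauss_cdf has_real_derivative std_normal_density t) (at t)"
proof -
  interpret N: real_distribution "density lborel std_normal_density"
    by (rule real_distribution_std_normal)
  have cont: "continuous_on S std_normal_density" for S
    unfolding normal_density_def by (intro continuous_intros) auto
  \<comment> \<open>The base point \<open>t - 1\<close> serves only to make \<open>t\<close>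
    interior to the interval on which the fundamental theorem of calculus is applied.\<close>
  have eq: "gauss_cdf (t - 1) + integral {t - 1..s} std_normal_density = gauss_cdf s" if "t - 1 \<le> s" for s
  proof (cases "s = t - 1")
    case False
    then have "gauss_cdf s - gauss_cdf (t - 1) = measure (density lborel std_normal_density) {t - 1<..s}"
      using that by (intro N.cdf_diff_eq) auto
    also have "\<dots> = measure (density lborel std_normal_density) {t - 1..s}"
    proof -
      have "emeasure (density lborel std_normal_density) {t - 1<..s} = emeasure (density lborel std_normal_density) {t - 1..s}"
        by (simp add: emeasure_density)
           (intro nn_integral_cong_AE AE_I[where N="{t-1}"], auto simp: indicator_def)
      then show ?thesis
        by (simp add: measure_def)
    qed
    also have "\<dots> = set_lebesgue_integral lborel {t - 1..s} std_normal_density"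
      unfolding set_lebesgue_integral_def
      by (simp add: measure_def emeasure_density nn_integral_set_ennreal integral_eq_nn_integral mult.commute)
    also have "\<dots> = integral {t - 1..s} std_normal_density"
      by (intro set_borel_integral_eq_integral borel_integrable_atLeastAtMost')
         (rule cont)
    finally show ?thesis by simp
  qed simp
  have "((\<lambda>s. integral {t - 1..s} std_normal_density) has_real_derivative std_normal_density t) (at t within {t - 1..t + 1})"
    by (rule integral_has_real_derivative[OF cont]) auto
  then have "((\<lambda>s. gauss_cdf (t - 1) + integral {t - 1..s} std_normal_density) has_real_derivative 0 + std_normal_density t) (at t within {t - 1..t + 1})"
    by (intro DERIV_add DERIV_const)
  then have "(gauss_cdf has_real_derivative 0 + std_normal_density t) (at t within {t - 1..t + 1})"
    by (rule has_field_derivative_transform_within[where d = 1]) (auto simp: eq)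
  then show ?thesis
    by (simp add: at_within_Icc_at)
qed

text \<open>Probability integral transform, obtained from the substitution v = B \<Phi>(s), for
  which dv / B is the standard normal law.\<close>

lemma distr_gauss_cdf:
  assumes B: "0 < B"
  shows "distr (density lborel std_normal_density) borel (\<lambda>s. B * gauss_cdf s) = uniform_measure lborel {0..B}"
proof (rule measure_eqI)
  interpret N: real_distribution "density lborel std_normal_density"
    by (rule real_distribution_std_normal)
  have deriv: "((\<lambda>s. B * gauss_cdf s) has_real_derivative B * std_normal_density x) (at x)" for x
    by (intro DERIV_cmult gauss_cdf_has_derivative)
  have cont: "continuous_on UNIV (\<lambda>x. B * std_normal_density x)"
    unfolding normal_density_def by (intro continuous_intros) auto
  have [measurable]: "(\<lambda>s. B * gauss_cdf s) \<in> borel_measurable borel"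
    by (intro borel_measurable_continuous_onI DERIV_continuous_on[OF deriv])
  show "sets (distr (density lborel std_normal_density) borel (\<lambda>s. B * gauss_cdf s)) = sets (uniform_measure lborel {0..B})"
    by simp
  fix X assume "X \<in> sets (distr (density lborel std_normal_density) borel (\<lambda>s. B * gauss_cdf s))"
  then have [measurable]: "X \<in> sets borel" by simp
  \<comment> \<open>\<open>?U\<close> lies between the open and the closed interval from
    \<open>0\<close> to \<open>B\<close>, so it is \<open>[0, B]\<close> up to two points.\<close>
  let ?U = "\<Union>n::nat. {B * gauss_cdf (- real (Suc n))..B * gauss_cdf (real (Suc n))}"
  have U: "{0<..<B} \<subseteq> ?U"
  proof
    fix v assume v: "v \<in> {0<..<B}"
    have "eventually (\<lambda>x. v / B < gauss_cdf x) at_top"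
      using v B by (intro order_tendstoD(1)[OF N.cdf_lim_at_top_prob]) (auto simp: field_simps)
    then obtain x1 where x1: "\<And>x. x1 \<le> x \<Longrightarrow> v / B < gauss_cdf x"
      by (auto simp: eventually_at_top_linorder)
    have "eventually (\<lambda>x. gauss_cdf x < v / B) at_bot"
      using v B by (intro order_tendstoD(2)[OF N.cdf_lim_at_bot]) (auto simp: field_simps)
    then obtain x2 where x2: "\<And>x. x \<le> x2 \<Longrightarrow> gauss_cdf x < v / B"
      by (auto simp: eventually_at_bot_linorder)
    obtain n :: nat where n: "max \<bar>x1\<bar> \<bar>x2\<bar> \<le> real n"
      using real_arch_simple by blast
    have "v / B < gauss_cdf (real (Suc n))" "gauss_cdf (- real (Suc n)) < v / B"
      using n by (auto intro!: x1 x2)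
    then have "v \<in> {B * gauss_cdf (- real (Suc n))..B * gauss_cdf (real (Suc n))}"
      using B by (auto simp: field_simps)
    then show "v \<in> ?U" by blast
  qed
  have U2: "?U \<subseteq> {0..B}"
  proof
    fix y assume "y \<in> ?U"
    then obtain n :: nat where n: "B * gauss_cdf (- real (Suc n)) \<le> y" "y \<le> B * gauss_cdf (real (Suc n))"
      by auto
    have "0 \<le> B * gauss_cdf (- real (Suc n))"
      using B by (intro mult_nonneg_nonneg N.cdf_nonneg) simp
    moreover have "B * gauss_cdf (real (Suc n)) \<le> B * 1"
      using B by (intro mult_left_mono N.cdf_bounded_prob) simp
    ultimately show "y \<in> {0..B}"
      using n by simp
  qed
  have "emeasure (distr (density lborel std_normal_density) borel (\<lambda>s. B * gauss_cdf s)) X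
      = (\<integral>\<^sup>+s. ennreal (std_normal_density s) * indicator X (B * gauss_cdf s) \<partial>lborel)"
    by (subst nn_integral_indicator[symmetric], simp, subst nn_integral_distr) (simp_all add: nn_integral_density)
  also have "\<dots> = (\<integral>\<^sup>+s. (ennreal (1 / B) * indicator X (B * gauss_cdf s)) * ennreal (B * std_normal_density s) \<partial>lborel)"
  proof (intro nn_integral_cong)
    fix s
    have "ennreal (std_normal_density s) = ennreal (1 / B) * ennreal (B * std_normal_density s)"
      using B by (subst ennreal_mult[symmetric]) auto
    then show "ennreal (std_normal_density s) * indicator X (B * gauss_cdf s)
        = (ennreal (1 / B) * indicator X (B * gauss_cdf s)) * ennreal (B * std_normal_density s)"
      by (simp only: mult_ac)
  qed
  also have "\<dots> = (\<integral>\<^sup>+y. (ennreal (1 / B) * indicator X y) * indicator ?U y \<partial>lborel)"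
    using B by (intro nn_integral_substitution_UNIV deriv cont) auto
  also have "\<dots> = (\<integral>\<^sup>+y. ennreal (1 / B) * indicator ({0..B} \<inter> X) y \<partial>lborel)"
  proof (intro nn_integral_cong_AE)
    have "AE y in lborel. y \<noteq> 0 \<and> y \<noteq> B"
      using AE_lborel_singleton[of 0] AE_lborel_singleton[of B] by eventually_elim auto
    then show "AE y in lborel. ennreal (1 / B) * indicator X y * indicator ?U y = ennreal (1 / B) * indicator ({0..B} \<inter> X) y"
    proof eventually_elim
      case (elim y)
      have "y \<in> ?U \<longleftrightarrow> y \<in> {0..B}"
      proof
        assume "y \<in> {0..B}"
        with elim have "y \<in> {0<..<B}" by simp
        then show "y \<in> ?U" by (rule subsetD[OF U])
      qed (rule subsetD[OF U2])
      then have "indicator ?U y = (indicator {0..B} y :: ennreal)"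
        by (simp only: indicator_def)
      then show ?case
        by (simp only: indicator_inter_arith mult_ac)
    qed
  qed
  also have "\<dots> = emeasure (uniform_measure lborel {0..B}) X"
    using B by (simp add: nn_integral_cmult emeasure_uniform_measure divide_ennreal_def inverse_ennreal mult.commute inverse_eq_divide)
  finally show "emeasure (distr (density lborel std_normal_density) borel (\<lambda>s. B * gauss_cdf s)) X = emeasure (uniform_measure lborel {0..B}) X" .
qed

lemma lborel_pair_product:
  fixes u v :: "real \<Rightarrow> real"
  assumes "integrable lborel u" "integrable lborel v"
  shows "integrable (lborel \<Otimes>\<^sub>M lborel) (\<lambda>(s, g). u s * v g)"
    and "(\<integral>z. (case z of (s, g) \<Rightarrow> u s * v g) \<partial>(lborel \<Otimes>\<^sub>M lborel)) = integral\<^sup>L lborel u * integral\<^sup>L lborel v"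
proof -
  have [measurable]: "u \<in> borel_measurable borel" "v \<in> borel_measurable borel"
    using assms by auto
  show 1: "integrable (lborel \<Otimes>\<^sub>M lborel) (\<lambda>(s, g). u s * v g)"
    by (rule lborel_pair.Fubini_integrable) (use assms in \<open>auto simp: abs_mult\<close>)
  show "(\<integral>z. (case z of (s, g) \<Rightarrow> u s * v g) \<partial>(lborel \<Otimes>\<^sub>M lborel)) = integral\<^sup>L lborel u * integral\<^sup>L lborel v"
    using lborel_pair.integral_fst'[OF 1] by simp
qed

text \<open>The clamping has no effect on the support \<open>[0,B]\<close>; it makes the location bounded on the whole space
  \<open>UNIV\<close> of the uniform measure.\<close>

definition uniform_gauss :: "real \<Rightarrow> real \<Rightarrow> real \<Rightarrow> real" where
  "uniform_gauss B \<sigma> = gmix (uniform_measure lborel {0..B}) (\<lambda>x. max 0 (min B x)) \<sigma>"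

lemma gauss_mixture_uniform:
  assumes "0 < B" "0 < \<sigma>"
  shows "gauss_mixture (uniform_measure lborel {0..B}) (\<lambda>x. max 0 (min B x)) B \<sigma>"
proof -
  interpret prob_space "uniform_measure lborel {0..B}"
    using assms by (intro prob_space_uniform_measure) auto
  show ?thesis
    using assms by unfold_locales auto
qed

text \<open>Concavity of \<open>ln\<close> from the tangent at the weighted mean \<open>m\<close>,
  whose linear parts cancel. The equality case is what later makes the entropy power inequality
  strict.\<close>

lemma ln_weighted_mean:
  fixes x y \<theta> :: real
  assumes "0 < \<theta>" "\<theta> < 1" "0 < x" "0 < y"
  shows "\<theta> * ln x + (1 - \<theta>) * ln y \<le> ln (\<theta> * x + (1 - \<theta>) * y)"
    and "\<theta> * ln x + (1 - \<theta>) * ln y = ln (\<theta> * x + (1 - \<theta>) * y) \<Longrightarrow> x = y"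
proof -
  define m where "m = \<theta> * x + (1 - \<theta>) * y"
  have m: "0 < m"
    unfolding m_def using assms by (intro add_pos_pos mult_pos_pos) auto
  have 1: "ln (x / m) \<le> x / m - 1" "ln (y / m) \<le> y / m - 1"
    using assms m by (auto intro!: ln_le_minus_one)
  have 0: "\<theta> * (x / m - 1) + (1 - \<theta>) * (y / m - 1) = 0"
  proof -
    have "\<theta> * (x / m - 1) + (1 - \<theta>) * (y / m - 1) = (\<theta> * x + (1 - \<theta>) * y) / m - 1"
      by (simp add: algebra_simps add_divide_distrib diff_divide_distrib)
    then show ?thesis
      using m by (simp add: m_def)
  qed
  have eq: "\<theta> * ln (x / m) + (1 - \<theta>) * ln (y / m) = \<theta> * ln x + (1 - \<theta>) * ln y - ln m"
    using assms m by (simp add: ln_div algebra_simps)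
  have a: "\<theta> * ln (x / m) \<le> \<theta> * (x / m - 1)" "(1 - \<theta>) * ln (y / m) \<le> (1 - \<theta>) * (y / m - 1)"
    using 1 assms by (auto intro!: mult_left_mono)
  show "\<theta> * ln x + (1 - \<theta>) * ln y \<le> ln (\<theta> * x + (1 - \<theta>) * y)"
    using a 0 eq by (simp add: m_def)
  assume "\<theta> * ln x + (1 - \<theta>) * ln y = ln (\<theta> * x + (1 - \<theta>) * y)"
  then have "\<theta> * ln (x / m) = \<theta> * (x / m - 1)"
    using a 0 eq unfolding m_def[symmetric] by linarith
  then have "ln (x / m) = x / m - 1"
    using assms by simp
  then have "x / m = 1"
    using assms m by (intro ln_eq_minus_one) auto
  then have "x = m"
    using m by simp
  then have "(1 - \<theta>) * x = (1 - \<theta>) * y"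
    unfolding m_def by (simp add: algebra_simps)
  then show "x = y"
    using assms by simp
qed

lemma ln_std_normal_density: "ln (std_normal_density s) = - (1/2) * ln (2 * pi) - s\<^sup>2 / 2"
  using ln_normal_density[of 1 0 s] by simp

text \<open>A level set of the density has at most the two points \<open>q\<close> and
  \<open>- q\<close>, which are null, while the whole line is not.\<close>

lemma std_normal_density_not_AE_const: "\<not> (AE s in lborel. std_normal_density s = k)"
proof
  assume ae: "AE s in lborel. std_normal_density s = k"
  define q where "q = sqrt (- 2 * ln k - ln (2 * pi))"
  have *: "s = q \<or> s = - q" if "std_normal_density s = k" for s
  proof -
    have "ln k = - (1/2) * ln (2 * pi) - s\<^sup>2 / 2"
      using ln_std_normal_density[of s] that by simp
    then have "s\<^sup>2 = - 2 * ln k - ln (2 * pi)"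
      by simp
    then have "q = \<bar>s\<bar>"
      unfolding q_def by (metis real_sqrt_abs)
    then show ?thesis by linarith
  qed
  have "AE s in lborel. s \<notin> (UNIV :: real set)"
    using ae AE_lborel_singleton[of q] AE_lborel_singleton[of "- q"]
    by eventually_elim (use * in auto)
  then have "(UNIV :: real set) \<in> null_sets lborel"
    by (subst AE_iff_null_sets) auto
  then show False
    by (simp add: null_sets_def)
qed

text \<open>The entropy power inequality for a uniform plus a Gaussian variable, by Rioul's transport argument:
  write the sum as \<open>T(S) + \<sigma>G\<close> with \<open>S, G\<close> independent standard normal and \<open>T = B\<Phi>\<close>.  In the rotated
  coordinates \<open>rS + cG\<close> and \<open>t = rG - cS\<close>, the sum is for each fixed \<open>t\<close> an increasing function of the first
  coordinate with derivative \<open>rT'(S) + c\<sigma>\<close>.\<close>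

lemma entropy_uniform_gauss_gt:
  assumes B: "0 < B" and \<sigma>: "0 < \<sigma>"
  shows "1/2 * ln (B\<^sup>2 + 2 * pi * exp 1 * \<sigma>\<^sup>2) < entropy_density (uniform_gauss B \<sigma>)"
proof -
  interpret gauss_mixture "uniform_measure lborel {0..B}" "\<lambda>x. max 0 (min B x)" B \<sigma>
    using assms by (rule gauss_mixture_uniform)
  interpret N: real_distribution "density lborel std_normal_density"
    by (rule real_distribution_std_normal)
  let ?\<phi> = "std_normal_density"
  let ?M = "lborel \<Otimes>\<^sub>M (lborel :: real measure) :: (real \<times> real) measure"
  define T where "T s = B * gauss_cdf s" for s
  have Tderiv: "(T has_real_derivative B * ?\<phi> s) (at s)" for s
    unfolding T_def by (intro DERIV_cmult gauss_cdf_has_derivative)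
  have [measurable]: "T \<in> borel_measurable borel"
    by (intro borel_measurable_continuous_onI DERIV_continuous_on[OF Tderiv])
  have Tb: "0 \<le> T s" "T s \<le> B" for s
    unfolding T_def using B mult_left_mono[OF N.cdf_bounded_prob[of s], of B] by (auto intro!: mult_nonneg_nonneg N.cdf_nonneg)
  \<comment> \<open>\<open>A\<close> is the variance of the Gaussian with the same entropy
    \<open>ln B\<close> as the uniform law on \<open>[0, B]\<close>, and \<theta> is its share of A
    + \<sigma>^2. This rotation angle is chosen so that both logarithms \<open>lnBr\<close> and
    \<open>lnY\<close> at the end become half of ln (A + \<sigma>^2).\<close>
  define A where "A = B\<^sup>2 / (2 * pi * exp 1)"
  have A: "0 < A"
    using B by (simp add: A_def)
  have AS: "0 < A + \<sigma>\<^sup>2"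
    using A by (simp add: add_pos_nonneg)
  define \<theta> where "\<theta> = A / (A + \<sigma>\<^sup>2)"
  have \<theta>: "0 < \<theta>" "\<theta> < 1"
    using A \<sigma> AS by (auto simp: \<theta>_def)
  have \<theta>1: "1 - \<theta> = \<sigma>\<^sup>2 / (A + \<sigma>\<^sup>2)"
    using AS by (simp add: \<theta>_def field_simps)
  define r where "r = sqrt \<theta>"
  define c where "c = sqrt (1 - \<theta>)"
  have r: "0 < r" "r\<^sup>2 = \<theta>" and c: "0 < c" "c\<^sup>2 = 1 - \<theta>"
    using \<theta> by (auto simp: r_def c_def)
  have rc: "r * r + c * c = 1"
    using r c by (simp add: power2_eq_square)
  define D where "D s = r * (B * ?\<phi> s) + c * \<sigma>" for s
  have [measurable]: "D \<in> borel_measurable borel"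
    unfolding D_def by measurable
  have Dpos: "0 < D s" for s
    unfolding D_def using r c B \<sigma> by (intro add_nonneg_pos) auto
  define a where "a = (\<lambda>(s, g). ?\<phi> s * ?\<phi> g)"
  \<comment> \<open>\<open>b\<close> is the density of \<open>(S, G)\<close> for which the output
    has density \<open>f\<close> and \<open>t = r * g - c * s\<close> is an independent standard
    normal variable; \<open>D\<close> is the Jacobian determinant of \<open>(s, g)\<close> going to
    (output, \<open>t\<close>).\<close>
  define b where "b = (\<lambda>(s, g). f (T s + \<sigma> * g) * D s * ?\<phi> (r * g - c * s))"
  have [measurable]: "b \<in> borel_measurable ?M"
    unfolding b_def by measurable
  have a: "integrable ?M a" "integral\<^sup>L ?M a = 1"
    using lborel_pair_product[of ?\<phi> ?\<phi>] by (auto simp: a_def)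
  have apos: "0 < a z" and bpos: "0 < b z" for z
    unfolding a_def b_def using Dpos by (auto simp: normal_density_pos split: prod.split)
  \<comment> \<open>Two one-dimensional substitutions replace the planar one: \<open>g\<close> by
    \<open>t\<close> for fixed \<open>s\<close>, at the cost of a factor \<open>1 / r\<close>, and
    then, for fixed \<open>t\<close>, \<open>s\<close> by the output \<tau>(s), whose derivative is
    \<open>D s / r\<close>. Bounding the indicator of the range by 1 avoids identifying the
    range.\<close>
  have nn_b: "(\<integral>\<^sup>+z. ennreal (b z) \<partial>?M) \<le> 1"
  proof -
    define H where "H s t = ?\<phi> t * (f (T s + \<sigma> * (c * s / r + 1 / r * t)) * (D s / r))" for s t
    have [measurable]: "(\<lambda>(s, t). ennreal (H s t)) \<in> borel_measurable ?M"
      unfolding H_def by measurable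
    have "(\<integral>\<^sup>+z. ennreal (b z) \<partial>?M) = (\<integral>\<^sup>+s. (\<integral>\<^sup>+g. ennreal (b (s, g)) \<partial>lborel) \<partial>lborel)"
      by (subst lborel.nn_integral_fst[symmetric]) auto
    also have "\<dots> = (\<integral>\<^sup>+s. (\<integral>\<^sup>+t. ennreal (H s t) \<partial>lborel) \<partial>lborel)"
    proof (rule nn_integral_cong)
      fix s :: real
      have "(\<integral>\<^sup>+g. ennreal (b (s, g)) \<partial>lborel) = ennreal \<bar>1 / r\<bar> * (\<integral>\<^sup>+t. ennreal (b (s, c * s / r + 1 / r * t)) \<partial>lborel)"
        using r by (intro nn_integral_real_affine) auto
      also have "\<dots> = (\<integral>\<^sup>+t. ennreal \<bar>1 / r\<bar> * ennreal (b (s, c * s / r + 1 / r * t)) \<partial>lborel)"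
        by (intro nn_integral_cmult[symmetric]) simp
      also have "\<dots> = (\<integral>\<^sup>+t. ennreal (H s t) \<partial>lborel)"
      proof (intro nn_integral_cong)
        fix t
        have "r * (c * s / r + 1 / r * t) - c * s = t"
          using r by (simp add: field_simps)
        then show "ennreal \<bar>1 / r\<bar> * ennreal (b (s, c * s / r + 1 / r * t)) = ennreal (H s t)"
          using r bpos[of "(s, c * s / r + 1 / r * t)"]
          by (subst ennreal_mult[symmetric]) (auto simp: b_def H_def mult.commute[of _ "?\<phi> t"])
      qed
      finally show "(\<integral>\<^sup>+g. ennreal (b (s, g)) \<partial>lborel) = (\<integral>\<^sup>+t. ennreal (H s t) \<partial>lborel)" .
    qed
    also have "\<dots> = (\<integral>\<^sup>+t. (\<integral>\<^sup>+s. ennreal (H s t) \<partial>lborel) \<partial>lborel)"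
      using lborel_pair.Fubini'[of "\<lambda>s t. ennreal (H s t)"] by simp
    also have "\<dots> \<le> (\<integral>\<^sup>+t. ennreal (?\<phi> t) * 1 \<partial>lborel)"
    proof (intro nn_integral_mono)
      fix t :: real
      define \<tau> where "\<tau> s = T s + \<sigma> * (c * s / r + 1 / r * t)" for s
      have \<tau>': "(\<tau> has_real_derivative D s / r) (at s)" for s
        unfolding \<tau>_def
        using r by (auto intro!: derivative_eq_intros Tderiv simp: D_def field_simps)
      have cont: "continuous_on UNIV (\<lambda>s. D s / r)"
        unfolding D_def normal_density_def using r by (intro continuous_intros) auto
      have [measurable]: "\<tau> \<in> borel_measurable borel"
        unfolding \<tau>_def by measurable
      have "(\<integral>\<^sup>+s. ennreal (H s t) \<partial>lborel) = (\<integral>\<^sup>+s. ennreal (?\<phi> t) * (ennreal (f (\<tau> s)) * ennreal (D s / r)) \<partial>lborel)"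
        using r Dpos by (intro nn_integral_cong)
          (simp add: H_def \<tau>_def ennreal_mult[symmetric] less_imp_le)
      also have "\<dots> = ennreal (?\<phi> t) * (\<integral>\<^sup>+s. ennreal (f (\<tau> s)) * ennreal (D s / r) \<partial>lborel)"
        by (intro nn_integral_cmult) simp
      also have "(\<integral>\<^sup>+s. ennreal (f (\<tau> s)) * ennreal (D s / r) \<partial>lborel)
          = (\<integral>\<^sup>+y. ennreal (f y) * indicator (\<Union>n::nat. {\<tau> (- real (Suc n))..\<tau> (real (Suc n))}) y \<partial>lborel)"
        using Dpos r by (intro nn_integral_substitution_UNIV \<tau>' cont) (auto simp: less_imp_le)
      also have "\<dots> \<le> (\<integral>\<^sup>+y. ennreal (f y) \<partial>lborel)"
        by (intro nn_integral_mono) (simp add: indicator_def)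
      also have "\<dots> = 1"
        using integrable_gmix_density integral_gmix_density
        by (subst nn_integral_eq_integral) (auto simp: less_imp_le)
      finally show "(\<integral>\<^sup>+s. ennreal (H s t) \<partial>lborel) \<le> ennreal (?\<phi> t) * 1"
        by (simp add: mult_left_mono)
    qed
    also have "\<dots> = 1"
      by (simp add: nn_integral_eq_integral)
    finally show ?thesis .
  qed
  have b: "integrable ?M b"
    using nn_b bpos by (intro integrableI_nonneg) (auto simp: less_imp_le intro: le_less_trans)
  have b1: "integral\<^sup>L ?M b \<le> 1"
  proof -
    have "ennreal (integral\<^sup>L ?M b) \<le> 1"
      using nn_b bpos by (subst nn_integral_eq_integral[OF b, symmetric]) (auto simp: less_imp_le)
    then show ?thesis by simp
  qed

  \<comment> \<open>The integrand \<open>a * ln (b / a)\<close> splits into \<open>t1\<close>, whose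
    integral is minus the output entropy, \<open>t2\<close>, the logarithm of the Jacobian, and
    \<open>t3\<close>, whose integral is the standard normal entropy of the rotated coordinate
    \<open>r * s + c * g\<close>.\<close>
  define t1 where "t1 = (\<lambda>(s, g). ?\<phi> s * ?\<phi> g * ln (f (T s + \<sigma> * g)))"
  have t1: "integrable ?M t1" "integral\<^sup>L ?M t1 = - entropy_density f"
  proof -
    obtain C where C: "\<And>y. \<bar>ln (f y)\<bar> \<le> C * (1 + y\<^sup>2)"
      using quadratic_growth_ln_gmix unfolding quadratic_growth_def by blast
    have C0: "0 \<le> C" using C[of 0] by simp
    have bound: "\<bar>ln (f (T s + \<sigma> * g))\<bar> \<le> C * (1 + 2 * B\<^sup>2) + 2 * C * \<sigma>\<^sup>2 * g\<^sup>2" for s g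
    proof -
      have "(T s + \<sigma> * g)\<^sup>2 \<le> 2 * (T s)\<^sup>2 + 2 * (\<sigma> * g)\<^sup>2"
        using zero_le_power2[of "T s - \<sigma> * g"] by (simp add: power2_eq_square algebra_simps)
      also have "(T s)\<^sup>2 \<le> B\<^sup>2"
        using Tb[of s] by (intro power_mono) auto
      finally have "C * (1 + (T s + \<sigma> * g)\<^sup>2) \<le> C * (1 + (2 * B\<^sup>2 + 2 * (\<sigma> * g)\<^sup>2))"
        using C0 by (intro mult_left_mono) auto
      then show ?thesis
        using C[of "T s + \<sigma> * g"] by (simp add: algebra_simps power_mult_distrib)
    qed
    have "integrable ?M (\<lambda>(s, g). ?\<phi> s * (C * (1 + 2 * B\<^sup>2) * ?\<phi> g + 2 * C * \<sigma>\<^sup>2 * (?\<phi> g * (g - 0)\<^sup>2)))"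
      using integrable_normal_square[of 1 0 0] by (intro lborel_pair_product) auto
    then show i: "integrable ?M t1"
    proof (rule Bochner_Integration.integrable_bound)
      show "t1 \<in> borel_measurable ?M"
        unfolding t1_def by measurable
      show "AE z in ?M. norm (t1 z) \<le> norm (case z of (s, g) \<Rightarrow> ?\<phi> s * (C * (1 + 2 * B\<^sup>2) * ?\<phi> g + 2 * C * \<sigma>\<^sup>2 * (?\<phi> g * (g - 0)\<^sup>2)))"
      proof (intro AE_I2)
        fix z :: "real \<times> real"
        obtain s g where z: "z = (s, g)" by (cases z)
        have "?\<phi> s * ?\<phi> g * \<bar>ln (f (T s + \<sigma> * g))\<bar> \<le> ?\<phi> s * ?\<phi> g * (C * (1 + 2 * B\<^sup>2) + 2 * C * \<sigma>\<^sup>2 * g\<^sup>2)"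
          by (intro mult_left_mono bound) simp
        also have "\<dots> = ?\<phi> s * (C * (1 + 2 * B\<^sup>2) * ?\<phi> g + 2 * C * \<sigma>\<^sup>2 * (?\<phi> g * (g - 0)\<^sup>2))"
          by (simp add: algebra_simps)
        finally show "norm (t1 z) \<le> norm (case z of (s, g) \<Rightarrow> ?\<phi> s * (C * (1 + 2 * B\<^sup>2) * ?\<phi> g + 2 * C * \<sigma>\<^sup>2 * (?\<phi> g * (g - 0)\<^sup>2)))"
          using abs_ge_self[of "?\<phi> s * (C * (1 + 2 * B\<^sup>2) * ?\<phi> g + 2 * C * \<sigma>\<^sup>2 * (?\<phi> g * (g - 0)\<^sup>2))"]
          by (simp only: z t1_def prod.case real_norm_def abs_mult[of _ "ln _"]) simp
      qed
    \<comment> \<open>The integral of \<open>t1\<close> is evaluated next: for fixed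
      \<open>s\<close> the inner one depends on \<open>s\<close> only through \<open>T s\<close>,
      and \<open>T s\<close> is uniform on \<open>[0, B]\<close>.\<close>
    qed
    define \<Psi> where "\<Psi> x = (\<integral>y. normal_density (max 0 (min B x)) \<sigma> y * ln (f y) \<partial>lborel)" for x
    have [measurable]: "\<Psi> \<in> borel_measurable borel"
      unfolding \<Psi>_def by measurable
    have inner: "(\<integral>g. ?\<phi> g * ln (f (T s + \<sigma> * g)) \<partial>lborel) = \<Psi> (T s)" for s
    proof -
      have nd: "\<sigma> * normal_density (T s) \<sigma> (T s + \<sigma> * g) = ?\<phi> g" for g
        by (simp add: normal_density_def real_sqrt_mult power_mult_distrib abs_of_pos[OF \<sigma>])
      have "\<Psi> (T s) = (\<integral>y. normal_density (T s) \<sigma> y * ln (f y) \<partial>lborel)"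
        using Tb[of s] by (simp add: \<Psi>_def)
      also have "\<dots> = \<bar>\<sigma>\<bar> *\<^sub>R (\<integral>g. normal_density (T s) \<sigma> (T s + \<sigma> * g) * ln (f (T s + \<sigma> * g)) \<partial>lborel)"
        using \<sigma> by (intro lborel_integral_real_affine) auto
      also have "\<dots> = (\<integral>g. ?\<phi> g * ln (f (T s + \<sigma> * g)) \<partial>lborel)"
        by (simp add: nd[symmetric] mult.assoc abs_of_pos[OF \<sigma>] flip: integral_mult_right_zero)
      finally show ?thesis by simp
    qed
    have "integral\<^sup>L ?M t1 = (\<integral>s. (\<integral>g. t1 (s, g) \<partial>lborel) \<partial>lborel)"
      using lborel_pair.integral_fst'[OF i] by simp
    also have "\<dots> = (\<integral>s. ?\<phi> s * \<Psi> (T s) \<partial>lborel)"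
      by (simp add: t1_def mult.assoc inner)
    also have "\<dots> = (\<integral>s. \<Psi> (T s) \<partial>density lborel ?\<phi>)"
      by (subst integral_density) auto
    also have "\<dots> = (\<integral>x. \<Psi> x \<partial>distr (density lborel ?\<phi>) borel T)"
      by (subst integral_distr) auto
    also have "distr (density lborel ?\<phi>) borel T = uniform_measure lborel {0..B}"
      using distr_gauss_cdf[OF B] by (simp add: T_def[abs_def])
    also have "(\<integral>x. \<Psi> x \<partial>uniform_measure lborel {0..B}) = (\<integral>y. f y * ln (f y) \<partial>lborel)"
      unfolding \<Psi>_def integral_gmix[OF quadratic_growth_ln_gmix] ..
    finally show "integral\<^sup>L ?M t1 = - entropy_density f"
      by (simp add: entropy_density_def)
  qed

  have lnD: "integrable lborel (\<lambda>s. ?\<phi> s * ln (D s))"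
  proof (rule Bochner_Integration.integrable_bound[of _ "\<lambda>s. (\<bar>ln (c * \<sigma>)\<bar> + \<bar>ln (r * (B * (1 / sqrt (2 * pi))) + c * \<sigma>)\<bar>) * ?\<phi> s"])
    show "AE s in lborel. norm (?\<phi> s * ln (D s)) \<le> norm ((\<bar>ln (c * \<sigma>)\<bar> + \<bar>ln (r * (B * (1 / sqrt (2 * pi))) + c * \<sigma>)\<bar>) * ?\<phi> s)"
    proof (intro AE_I2)
      fix s
      have "c * \<sigma> \<le> D s"
        unfolding D_def using r B by simp
      moreover have "D s \<le> r * (B * (1 / sqrt (2 * pi))) + c * \<sigma>"
        unfolding D_def using r B normal_density_le_peak[of 1 0 s]
        by (intro add_right_mono mult_left_mono) auto
      moreover have "0 < c * \<sigma>"
        using c \<sigma> by simp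
      ultimately have "ln (c * \<sigma>) \<le> ln (D s)" "ln (D s) \<le> ln (r * (B * (1 / sqrt (2 * pi))) + c * \<sigma>)"
        using Dpos[of s] by (auto intro!: ln_mono)
      then have "\<bar>ln (D s)\<bar> \<le> \<bar>ln (c * \<sigma>)\<bar> + \<bar>ln (r * (B * (1 / sqrt (2 * pi))) + c * \<sigma>)\<bar>"
        by linarith
      then have "?\<phi> s * \<bar>ln (D s)\<bar> \<le> ?\<phi> s * (\<bar>ln (c * \<sigma>)\<bar> + \<bar>ln (r * (B * (1 / sqrt (2 * pi))) + c * \<sigma>)\<bar>)"
        by (intro mult_left_mono) auto
      then show "norm (?\<phi> s * ln (D s)) \<le> norm ((\<bar>ln (c * \<sigma>)\<bar> + \<bar>ln (r * (B * (1 / sqrt (2 * pi))) + c * \<sigma>)\<bar>) * ?\<phi> s)"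
        by (simp add: abs_mult mult.commute)
    qed
  qed auto
  define t2 where "t2 = (\<lambda>(s, g). (?\<phi> s * ln (D s)) * ?\<phi> g)"
  have t2: "integrable ?M t2" "integral\<^sup>L ?M t2 = (\<integral>s. ?\<phi> s * ln (D s) \<partial>lborel)"
    using lborel_pair_product[OF lnD, of ?\<phi>] by (auto simp: t2_def)
  define t3 where "t3 = (\<lambda>(s, g). ?\<phi> s * ?\<phi> g * (1/2 * ln (2 * pi) + (r * s + c * g)\<^sup>2 / 2))"
  have t3: "integrable ?M t3" "integral\<^sup>L ?M t3 = 1/2 * ln (2 * pi) + 1/2"
  proof -
    have eq: "t3 z = 1/2 * ln (2 * pi) * (case z of (s, g) \<Rightarrow> ?\<phi> s * ?\<phi> g)
        + r\<^sup>2 / 2 * (case z of (s, g) \<Rightarrow> (?\<phi> s * (s - 0)\<^sup>2) * ?\<phi> g)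
        + c\<^sup>2 / 2 * (case z of (s, g) \<Rightarrow> ?\<phi> s * (?\<phi> g * (g - 0)\<^sup>2))
        + r * c * (case z of (s, g) \<Rightarrow> (?\<phi> s * s) * (?\<phi> g * g))" for z
      by (cases z) (simp add: t3_def power2_eq_square algebra_simps add_divide_distrib)
    have i2: "integrable lborel (\<lambda>s. ?\<phi> s * (s - 0)\<^sup>2)" "(\<integral>s. ?\<phi> s * (s - 0)\<^sup>2 \<partial>lborel) = 1"
      using integrable_normal_square[of 1 0 0] integral_normal_square[of 1 0 0] by auto
    have i1: "integrable lborel (\<lambda>s. ?\<phi> s * s)" "(\<integral>s. ?\<phi> s * s \<partial>lborel) = 0"
      using integrable_normal_moment_nz_1[of 1 0] integral_normal_moment_nz_1[of 1 0] by auto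
    have i0: "integrable lborel ?\<phi>" "integral\<^sup>L lborel ?\<phi> = 1"
      by auto
    note p = lborel_pair_product[OF i0(1) i0(1)] lborel_pair_product[OF i2(1) i0(1)]
      lborel_pair_product[OF i0(1) i2(1)] lborel_pair_product[OF i1(1) i1(1)]
    have hb: "has_bochner_integral ?M t3 (1/2 * ln (2 * pi) * (1 * 1) + r\<^sup>2 / 2 * (1 * 1) + c\<^sup>2 / 2 * (1 * 1) + r * c * (0 * 0))"
      unfolding eq[abs_def]
      by (intro has_bochner_integral_add has_bochner_integral_mult_right)
         (use p i0 i1 i2 in \<open>simp_all add: has_bochner_integral_iff\<close>)
    then show "integrable ?M t3" "integral\<^sup>L ?M t3 = 1/2 * ln (2 * pi) + 1/2"
      using r c by (auto simp: has_bochner_integral_iff add_divide_distrib[symmetric])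
  qed

  have ab: "a z * ln (b z / a z) = t1 z + t2 z + t3 z" for z
  proof -
    obtain s g where z: "z = (s, g)" by (cases z)
    have "ln (b z / a z) = ln (f (T s + \<sigma> * g)) + ln (D s) + ln (?\<phi> (r * g - c * s)) - (ln (?\<phi> s) + ln (?\<phi> g))"
      using Dpos[of s] by (simp add: z a_def b_def ln_div ln_mult normal_density_pos less_imp_neq[symmetric])
    moreover have "ln (?\<phi> (r * g - c * s)) - (ln (?\<phi> s) + ln (?\<phi> g)) = 1/2 * ln (2 * pi) + (r * s + c * g)\<^sup>2 / 2"
    proof -
      have "(r * g - c * s)\<^sup>2 + (r * s + c * g)\<^sup>2 = (r * r + c * c) * (s\<^sup>2 + g\<^sup>2)"
        by (simp add: power2_eq_square algebra_simps)
      then have "(r * g - c * s)\<^sup>2 + (r * s + c * g)\<^sup>2 = s\<^sup>2 + g\<^sup>2"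
        by (simp add: rc)
      then show ?thesis
        unfolding ln_std_normal_density by (simp add: field_simps)
    qed
    ultimately have "ln (b z / a z) = ln (f (T s + \<sigma> * g)) + ln (D s) + (1/2 * ln (2 * pi) + (r * s + c * g)\<^sup>2 / 2)"
      by linarith
    then show ?thesis
      by (simp add: z a_def t1_def t2_def t3_def distrib_left mult.assoc mult.left_commute mult.commute)
  qed
  have "(\<integral>z. a z * ln (b z / a z) \<partial>?M) \<le> integral\<^sup>L ?M b - integral\<^sup>L ?M a"
    using a b apos bpos t1 t2 t3 by (intro gibbs_integral_le) (auto simp: ab)
  then have main: "1/2 * ln (2 * pi) + 1/2 + (\<integral>s. ?\<phi> s * ln (D s) \<partial>lborel) \<le> entropy_density f"
    using t1 t2 t3 a b1 by (simp add: ab)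

  \<comment> \<open>Dividing the two summands of the Jacobian by \<open>r\<close> and
    \<open>c\<close> exhibits it as a convex combination with weights \<theta> = r^2 and 1 -
    \<theta> = c^2.\<close>
  define X where "X s = B * ?\<phi> s / r" for s
  define Y where "Y = \<sigma> / c"
  have Xpos: "0 < X s" and Ypos: "0 < Y" for s
    using B r \<sigma> c by (auto simp: X_def Y_def normal_density_pos)
  have DXY: "D s = \<theta> * X s + (1 - \<theta>) * Y" for s
  proof -
    have "\<theta> * X s = r * (B * ?\<phi> s)"
      unfolding r(2)[symmetric] X_def using r(1) by (simp add: power2_eq_square)
    moreover have "(1 - \<theta>) * Y = c * \<sigma>"
      unfolding c(2)[symmetric] Y_def using c(1) by (simp add: power2_eq_square)
    ultimately show ?thesis
      by (simp add: D_def)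
  qed
  define lb where "lb s = ?\<phi> s * (\<theta> * ln (X s) + (1 - \<theta>) * ln Y)" for s
  have lb_eq: "lb s = (\<theta> * (ln (B / r) - 1/2 * ln (2 * pi)) + (1 - \<theta>) * ln Y) * ?\<phi> s - \<theta> / 2 * (?\<phi> s * (s - 0)\<^sup>2)" for s
  proof -
    have "ln (X s) = ln ((B / r) * ?\<phi> s)"
      by (simp add: X_def)
    also have "\<dots> = ln (B / r) + ln (?\<phi> s)"
      using B r by (intro ln_mult_pos) (auto simp: normal_density_pos)
    finally have lnX: "ln (X s) = ln (B / r) + (- (1/2) * ln (2 * pi) - s\<^sup>2 / 2)"
      unfolding ln_std_normal_density .
    show ?thesis
      unfolding lb_def lnX by (simp add: algebra_simps)
  qed
  have lb: "integrable lborel lb"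
      "integral\<^sup>L lborel lb = \<theta> * (ln (B / r) - 1/2 * ln (2 * pi)) + (1 - \<theta>) * ln Y - \<theta> / 2"
    unfolding lb_eq[abs_def]
    using integrable_normal_square[of 1 0 0] integral_normal_square[of 1 0 0] by auto
  have le: "lb s \<le> ?\<phi> s * ln (D s)" for s
    unfolding lb_def DXY using \<theta> Xpos Ypos by (intro mult_left_mono ln_weighted_mean) auto
  \<comment> \<open>The strictness of the inequality comes from here: equality would force
    \<open>X s = Y\<close> for almost all \<open>s\<close>, hence a constant Gaussian
    density.\<close>
  have "integral\<^sup>L lborel lb < (\<integral>s. ?\<phi> s * ln (D s) \<partial>lborel)"
  proof (rule ccontr)
    assume "\<not> ?thesis"
    moreover have "0 \<le> (\<integral>s. ?\<phi> s * ln (D s) - lb s \<partial>lborel)"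
      using le by (intro integral_nonneg_AE) auto
    ultimately have "(\<integral>s. ?\<phi> s * ln (D s) - lb s \<partial>lborel) = 0"
      using lb lnD by simp
    then have "AE s in lborel. ?\<phi> s * ln (D s) - lb s = 0"
      using le lb lnD by (subst (asm) integral_nonneg_eq_0_iff_AE) auto
    then have "AE s in lborel. ?\<phi> s = Y * r / B"
    proof eventually_elim
      case (elim s)
      then have "?\<phi> s * ln (\<theta> * X s + (1 - \<theta>) * Y) = ?\<phi> s * (\<theta> * ln (X s) + (1 - \<theta>) * ln Y)"
        by (simp add: lb_def DXY)
      then have "\<theta> * ln (X s) + (1 - \<theta>) * ln Y = ln (\<theta> * X s + (1 - \<theta>) * Y)"
        using normal_density_pos[of 1 0 s] by simp
      then have "X s = Y"
        by (rule ln_weighted_mean(2)[OF \<theta> Xpos Ypos])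
      then show ?case
        using B r by (simp add: X_def field_simps)
    qed
    then show False
      using std_normal_density_not_AE_const by blast
  qed
  with main lb have gt: "1/2 * ln (2 * pi) + 1/2 + (\<theta> * (ln (B / r) - 1/2 * ln (2 * pi)) + (1 - \<theta>) * ln Y - \<theta> / 2) < entropy_density f"
    by linarith
  have lnBr: "ln (B / r) - 1/2 * ln (2 * pi) - 1/2 = 1/2 * ln (A + \<sigma>\<^sup>2)"
  proof -
    have "(B / r)\<^sup>2 = (A + \<sigma>\<^sup>2) * (2 * pi * exp 1)"
      using A AS B by (simp add: power_divide r \<theta>_def A_def)
    then have "2 * ln (B / r) = ln ((A + \<sigma>\<^sup>2) * (2 * pi * exp 1))"
      using B r by (metis divide_pos_pos ln_realpow of_nat_numeral)
    also have "\<dots> = ln (A + \<sigma>\<^sup>2) + (ln (2 * pi) + 1)"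
      using AS by (subst ln_mult_pos) (auto simp: ln_mult)
    finally show ?thesis by simp
  qed
  have lnY: "ln Y = 1/2 * ln (A + \<sigma>\<^sup>2)"
  proof -
    have "Y\<^sup>2 = A + \<sigma>\<^sup>2"
      using \<sigma> AS by (simp add: Y_def power_divide c \<theta>1)
    then have "2 * ln Y = ln (A + \<sigma>\<^sup>2)"
      using Ypos by (metis ln_realpow of_nat_numeral)
    then show ?thesis by simp
  qed
  have lnsum: "1/2 * ln (B\<^sup>2 + 2 * pi * exp 1 * \<sigma>\<^sup>2) = 1/2 * ln (2 * pi) + 1/2 + 1/2 * ln (A + \<sigma>\<^sup>2)"
  proof -
    have "B\<^sup>2 + 2 * pi * exp 1 * \<sigma>\<^sup>2 = (2 * pi * exp 1) * (A + \<sigma>\<^sup>2)"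
      by (simp add: A_def distrib_left)
    also have "ln \<dots> = ln (2 * pi) + 1 + ln (A + \<sigma>\<^sup>2)"
      using AS by (subst ln_mult_pos) (auto simp: ln_mult)
    finally show ?thesis by simp
  qed
  have "\<theta> * (ln (B / r) - 1/2 * ln (2 * pi)) + (1 - \<theta>) * ln Y - \<theta> / 2
      = \<theta> * (ln (B / r) - 1/2 * ln (2 * pi) - 1/2) + (1 - \<theta>) * ln Y"
    by (simp add: algebra_simps)
  also have "\<dots> = 1/2 * ln (A + \<sigma>\<^sup>2)"
    unfolding lnBr lnY by (simp only: distrib_right[symmetric]) simp
  finally show ?thesis
    using gt lnsum unfolding uniform_gauss_def by linarith
qed

section \<open>Pulse amplitude modulation and the function G\<close>

text \<open>Parametrised by the spacing \<open>L\<close> instead of the peak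
  \<open>(K - 1) * L\<close>, since clouds and the full constellation share the spacing. With the
  offset \<open>c\<close>, the output density given a cloud letter has the same form as the
  unconditional one.\<close>

definition pam :: "nat \<Rightarrow> real \<Rightarrow> real \<Rightarrow> real \<Rightarrow> real \<Rightarrow> real" where
  "pam K L \<sigma> c y = (\<Sum>i<K. normal_density (c + real i * L) \<sigma> y) / real K"

definition pam_entropy :: "nat \<Rightarrow> real \<Rightarrow> real \<Rightarrow> real" where
  "pam_entropy K L \<sigma> = entropy_density (pam K L \<sigma> 0)"

lemma pam_measurable[measurable]: "pam K L \<sigma> c \<in> borel_measurable borel"
  unfolding pam_def by measurable

lemma pam_pos: "0 < K \<Longrightarrow> 0 < \<sigma> \<Longrightarrow> 0 < pam K L \<sigma> c y"
  unfolding pam_def by (auto intro!: divide_pos_pos sum_pos normal_density_pos)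

lemma pam_shift: "pam K L \<sigma> c y = pam K L \<sigma> 0 (y - c)"
  unfolding pam_def by (simp add: normal_density_shift add.commute)

lemma gmix_uniform_count:
  "0 < K \<Longrightarrow> gmix (uniform_count_measure {..<K}) (\<lambda>i. real i * L) \<sigma> = pam K L \<sigma> 0"
  unfolding gmix_def pam_def by (intro ext) (simp add: integral_uniform_count_measure)

lemma gauss_mixture_pam:
  assumes "0 < K" "0 \<le> L" "0 < \<sigma>"
  shows "gauss_mixture (uniform_count_measure {..<K}) (\<lambda>i. real i * L) ((real K - 1) * L) \<sigma>"
proof -
  interpret prob_space "uniform_count_measure {..<K}"
    using assms by (intro prob_space_uniform_count_measure) auto
  show ?thesis
  proof
    show "(\<lambda>i. real i * L) \<in> borel_measurable (uniform_count_measure {..<K})"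
      by (simp add: measurable_def uniform_count_measure_def space_point_measure sets_point_measure)
    fix i assume "i \<in> space (uniform_count_measure {..<K})"
    then have "real i \<le> real K - 1"
      by (auto simp: space_uniform_count_measure)
    then show "0 \<le> real i * L \<and> real i * L \<le> (real K - 1) * L"
      using assms by (auto intro!: mult_right_mono)
  qed fact
qed

lemma quadratic_growth_ln_pam:
  assumes "0 < K" "0 \<le> L" "0 < \<sigma>"
  shows "quadratic_growth (\<lambda>y. ln (pam K L \<sigma> c y))"
proof -
  interpret gauss_mixture "uniform_count_measure {..<K}" "\<lambda>i. real i * L" "(real K - 1) * L" \<sigma>
    using assms by (rule gauss_mixture_pam)
  show ?thesis
    using quadratic_growth_shift[OF quadratic_growth_ln_gmix, of c] assms
    by (simp add: gmix_uniform_count pam_shift[of K L \<sigma> c])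
qed

lemma
  assumes "0 < K" "0 < \<sigma>" "quadratic_growth \<psi>"
  shows integrable_pam_quadratic_growth: "integrable lborel (\<lambda>y. pam K L \<sigma> c y * \<psi> y)"
    and integral_pam: "(\<integral>y. pam K L \<sigma> c y * \<psi> y \<partial>lborel)
      = (\<Sum>i<K. \<integral>y. normal_density (c + real i * L) \<sigma> y * \<psi> y \<partial>lborel) / real K"
proof -
  have eq: "pam K L \<sigma> c y * \<psi> y = (\<Sum>i<K. normal_density (c + real i * L) \<sigma> y * \<psi> y) / real K" for y
    unfolding pam_def by (simp add: sum_distrib_right)
  note i = integrable_normal_quadratic_growth[OF assms(2,3)]
  show "integrable lborel (\<lambda>y. pam K L \<sigma> c y * \<psi> y)"
    unfolding eq using i by (auto intro!: Bochner_Integration.integrable_sum integrable_divide)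
  show "(\<integral>y. pam K L \<sigma> c y * \<psi> y \<partial>lborel)
      = (\<Sum>i<K. \<integral>y. normal_density (c + real i * L) \<sigma> y * \<psi> y \<partial>lborel) / real K"
    unfolding eq using i by (simp add: Bochner_Integration.integral_sum)
qed

lemma
  assumes "0 < K" "0 < \<sigma>"
  shows integrable_pam: "integrable lborel (pam K L \<sigma> c)" and integral_pam_1: "integral\<^sup>L lborel (pam K L \<sigma> c) = 1"
  using integrable_pam_quadratic_growth[OF assms quadratic_growth_const[of 1], of L c]
    integral_pam[OF assms quadratic_growth_const[of 1], of L c] assms
  by auto

lemma entropy_pam:
  assumes "0 < K" "0 < \<sigma>"
  shows "(\<integral>y. pam K L \<sigma> c y * ln (pam K L \<sigma> c y) \<partial>lborel) = - pam_entropy K L \<sigma>"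
  unfolding pam_entropy_def entropy_density_def pam_shift[of K L \<sigma> c]
  using lborel_integral_real_affine[of 1 "\<lambda>y. pam K L \<sigma> 0 y * ln (pam K L \<sigma> 0 y)" "- c"] by simp

lemma entropy_normal:
  assumes "0 < \<sigma>"
  shows "(\<integral>y. normal_density x \<sigma> y * ln (normal_density x \<sigma> y) \<partial>lborel) = - (1/2 * ln (2 * pi * exp 1 * \<sigma>\<^sup>2))"
proof -
  have "(\<integral>y. normal_density x \<sigma> y * ln (normal_density x \<sigma> y) \<partial>lborel)
      = (\<integral>y. (- (1/2) * ln (2 * pi * \<sigma>\<^sup>2)) * normal_density x \<sigma> y - (normal_density x \<sigma> y * (y - x)\<^sup>2) / (2 * \<sigma>\<^sup>2) \<partial>lborel)"
    unfolding ln_normal_density[OF assms] by (simp add: algebra_simps)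
  also have "\<dots> = - (1/2) * ln (2 * pi * \<sigma>\<^sup>2) - 1/2"
    using assms integrable_normal_square[of \<sigma> x x] integral_normal_square[of \<sigma> x x] by simp
  also have "\<dots> = - (1/2 * (ln (2 * pi * \<sigma>\<^sup>2) + ln (exp 1)))"
    by (simp add: add_divide_distrib)
  also have "ln (2 * pi * \<sigma>\<^sup>2) + ln (exp 1) = ln ((2 * pi * \<sigma>\<^sup>2) * exp 1)"
    using assms by (intro ln_mult_pos[symmetric]) auto
  finally show ?thesis
    by (simp add: mult_ac)
qed

definition normal_entropy :: "real \<Rightarrow> real" where
  "normal_entropy \<sigma> = 1/2 * ln (2 * pi * exp 1 * \<sigma>\<^sup>2)"

text \<open>Each index below \<open>K1 * K2\<close> is \<open>u * K1 + s\<close> in exactly one way,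
  so the full constellation is the uniform mixture of \<open>K2\<close> translated clouds. This lets
  clouds and satellites be superposed without changing the marginal output law.\<close>

lemma pam_group:
  assumes "0 < K1" "0 < K2"
  shows "pam (K1 * K2) L \<sigma> 0 y = (\<Sum>u<K2. pam K1 L \<sigma> (real (u * K1) * L) y) / real K2"
proof -
  have "(\<Sum>i<K1 * K2. normal_density (real i * L) \<sigma> y)
      = (\<Sum>u<K2. \<Sum>i = u * K1..<u * K1 + K1. normal_density (real i * L) \<sigma> y)"
    using sum.nat_group[of "\<lambda>i. normal_density (real i * L) \<sigma> y" K1 K2] by (simp add: mult.commute)
  also have "\<dots> = (\<Sum>u<K2. \<Sum>s<K1. normal_density (real (u * K1) * L + real s * L) \<sigma> y)"
  proof (rule sum.cong[OF refl])
    fix u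
    have "(\<Sum>i = u * K1..<u * K1 + K1. normal_density (real i * L) \<sigma> y)
        = (\<Sum>s = 0..<K1. normal_density (real (s + u * K1) * L) \<sigma> y)"
      using sum.shift_bounds_nat_ivl[of "\<lambda>i. normal_density (real i * L) \<sigma> y" 0 "u * K1" K1] by (simp add: add.commute)
    then show "(\<Sum>i = u * K1..<u * K1 + K1. normal_density (real i * L) \<sigma> y)
        = (\<Sum>s<K1. normal_density (real (u * K1) * L + real s * L) \<sigma> y)"
      by (simp add: atLeast0LessThan algebra_simps)
  qed
  finally show ?thesis
    unfolding pam_def by (simp add: sum_divide_distrib)
qed

lemma pam_entropy_le_peak:
  assumes "0 < K" "0 \<le> L" "0 < \<sigma>"
  shows "pam_entropy K L \<sigma> \<le> normal_entropy \<sigma> + ln (1 + (real K - 1) * L / sqrt (2 * pi * exp 1 * \<sigma>\<^sup>2))"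
proof -
  interpret gauss_mixture "uniform_count_measure {..<K}" "\<lambda>i. real i * L" "(real K - 1) * L" \<sigma>
    using assms by (rule gauss_mixture_pam)
  have "0 \<le> (real K - 1) * L"
    using assms by (intro mult_nonneg_nonneg) auto
  then show ?thesis
    using entropy_gmix_le_peak assms by (simp add: gmix_uniform_count pam_entropy_def normal_entropy_def)
qed

text \<open>\<open>K\<close> times the variance (K^2 - 1)/12 of a uniform variable on
  \<open>K\<close> consecutive integers.\<close>

lemma sum_centered_squares:
  fixes K :: nat
  shows "(\<Sum>i<K. (real i - (real K - 1) / 2)\<^sup>2) = real K * ((real K)\<^sup>2 - 1) / 12"
proof -
  have s1: "(\<Sum>i<K. real i) = real K * (real K - 1) / 2"
    by (induction K) (auto simp: field_simps)
  have s2: "(\<Sum>i<K. (real i)\<^sup>2) = real K * (real K - 1) * (2 * real K - 1) / 6"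
    by (induction K) (auto simp: field_simps power2_eq_square)
  define m where "m = (real K - 1) / 2"
  have "(\<Sum>i<K. (real i - m)\<^sup>2) = (\<Sum>i<K. (real i)\<^sup>2 - 2 * m * real i + m\<^sup>2)"
    by (intro sum.cong refl) (simp add: power2_eq_square algebra_simps)
  also have "\<dots> = (\<Sum>i<K. (real i)\<^sup>2) - 2 * m * (\<Sum>i<K. real i) + real K * m\<^sup>2"
    by (simp add: sum.distrib sum_subtractf sum_distrib_left)
  also have "\<dots> = real K * ((real K)\<^sup>2 - 1) / 12"
    unfolding s1 s2 m_def by (simp add: power2_eq_square field_simps)
  finally show ?thesis
    by (simp add: m_def)
qed

lemma pam_entropy_le_gaussian:
  assumes "0 < K" "0 \<le> L" "0 < \<sigma>"
  shows "pam_entropy K L \<sigma> \<le> normal_entropy \<sigma> + 1/2 * ln (1 + L\<^sup>2 * ((real K)\<^sup>2 - 1) / 12 / \<sigma>\<^sup>2)"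
proof -
  interpret gauss_mixture "uniform_count_measure {..<K}" "\<lambda>i. real i * L" "(real K - 1) * L" \<sigma>
    using assms by (rule gauss_mixture_pam)
  have "(\<integral>i. (real i * L - (real K - 1) / 2 * L)\<^sup>2 \<partial>uniform_count_measure {..<K})
      = (\<Sum>i<K. L\<^sup>2 * (real i - (real K - 1) / 2)\<^sup>2) / real K"
    by (simp add: integral_uniform_count_measure power2_eq_square algebra_simps)
  also have "\<dots> = L\<^sup>2 * ((real K)\<^sup>2 - 1) / 12"
    unfolding sum_distrib_left[symmetric] sum_centered_squares using assms by simp
  finally have "entropy_density f \<le> 1/2 * ln (2 * pi * exp 1 * \<sigma>\<^sup>2) + 1/2 * ln (1 + L\<^sup>2 * ((real K)\<^sup>2 - 1) / 12 / \<sigma>\<^sup>2)"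
    by (rule entropy_gmix_le_gaussian) (use assms in auto)
  then show ?thesis
    using assms by (simp add: gmix_uniform_count pam_entropy_def normal_entropy_def)
qed

text \<open>Each component is at most \<open>K\<close> times the mixture, so \<open>ln\<close> of
  the mixture is at least \<open>ln\<close> of the component minus \<open>ln K\<close>; averaging
  this over the components gives the bound.\<close>

lemma pam_entropy_le_ln_card:
  assumes "0 < K" "0 \<le> L" "0 < \<sigma>"
  shows "pam_entropy K L \<sigma> \<le> normal_entropy \<sigma> + ln (real K)"
proof -
  let ?f = "pam K L \<sigma> 0"
  have q: "quadratic_growth (\<lambda>y. ln (?f y))"
    using assms by (rule quadratic_growth_ln_pam)
  have "- (normal_entropy \<sigma> + ln (real K)) \<le> (\<integral>y. normal_density (0 + real i * L) \<sigma> y * ln (?f y) \<partial>lborel)" if i: "i < K" for i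
  proof -
    let ?p = "normal_density (0 + real i * L) \<sigma>"
    have "- (normal_entropy \<sigma> + ln (real K)) = (\<integral>y. ?p y * ln (?p y) - ln (real K) * ?p y \<partial>lborel)"
      using assms integrable_normal_quadratic_growth[OF _ quadratic_growth_ln_normal_density, of \<sigma> \<sigma> "0 + real i * L" "0 + real i * L"]
      by (simp add: entropy_normal normal_entropy_def)
    also have "\<dots> \<le> (\<integral>y. ?p y * ln (?f y) \<partial>lborel)"
    proof (rule integral_mono)
      show "integrable lborel (\<lambda>y. ?p y * ln (?p y) - ln (real K) * ?p y)"
        using assms by (intro Bochner_Integration.integrable_diff integrable_mult_right
            integrable_normal_quadratic_growth quadratic_growth_ln_normal_density) auto
      show "integrable lborel (\<lambda>y. ?p y * ln (?f y))"
        using assms q by (intro integrable_normal_quadratic_growth)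
      fix y
      have "?p y \<le> (\<Sum>i<K. normal_density (0 + real i * L) \<sigma> y)"
        using i by (intro member_le_sum[of i _ "\<lambda>i. normal_density (0 + real i * L) \<sigma> y"]) auto
      then have "?p y / real K \<le> ?f y"
        unfolding pam_def using assms by (intro divide_right_mono) auto
      then have "ln (?p y / real K) \<le> ln (?f y)"
        using assms by (intro ln_mono) (auto intro!: divide_pos_pos normal_density_pos)
      moreover have "ln (?p y / real K) = ln (?p y) - ln (real K)"
        using assms normal_density_pos[of \<sigma> "0 + real i * L" y] by (intro ln_divide_pos) auto
      ultimately have "?p y * (ln (?p y) - ln (real K)) \<le> ?p y * ln (?f y)"
        by (intro mult_left_mono) auto
      then show "?p y * ln (?p y) - ln (real K) * ?p y \<le> ?p y * ln (?f y)"
        by (simp add: algebra_simps)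
    qed
    finally show ?thesis .
  qed
  then have "(\<Sum>i<K. - (normal_entropy \<sigma> + ln (real K))) \<le> (\<Sum>i<K. \<integral>y. normal_density (0 + real i * L) \<sigma> y * ln (?f y) \<partial>lborel)"
    by (intro sum_mono) auto
  then have "- (normal_entropy \<sigma> + ln (real K)) \<le> (\<integral>y. ?f y * ln (?f y) \<partial>lborel)"
    unfolding integral_pam[OF assms(1,3) q] using assms by (simp add: field_simps)
  then show ?thesis
    using assms by (simp add: entropy_pam)
qed

text \<open>A uniform variable of width \<open>L\<close> has variance L^2/12 and the smaller entropy
  power L^2/(2 pi e); the latter is what the third term of G subtracts.\<close>

lemma twelve_less_two_pi_e: "(12 :: real) < 2 * pi * exp 1"
proof -
  have "(2 :: real) \<le> exp 1"
    using exp_ge_add_one_self[of 1] by simp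
  then have "3 * 2 < pi * exp 1"
    using pi_gt3 by (intro mult_less_le_imp_less) auto
  then show ?thesis by simp
qed

text \<open>For the third term it is enough that exp (2 I) + x is at most 2^(2 E), where
  \<open>I\<close> is the information and \<open>x\<close> the subtracted quantity; this is checked
  for each of the three expressions that may attain the minimum \<open>E\<close>.\<close>

lemma pam_information_le_G:
  assumes K: "2 \<le> K" and "0 < L" "0 < \<sigma>"
  shows "pam_entropy K L \<sigma> - normal_entropy \<sigma> \<le> ln 2 * Gfun ((real K - 1) * L) K \<sigma>"
proof -
  define I where "I = pam_entropy K L \<sigma> - normal_entropy \<sigma>"
  define k where "k = sqrt (2 * pi * exp 1)"
  have k: "0 < k" "k\<^sup>2 = 2 * pi * exp 1"
    by (auto simp: k_def)
  have K1: "0 < real K - 1"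
    using K by simp
  have sq: "sqrt (2 * pi * exp 1 * \<sigma>\<^sup>2) = k * \<sigma>"
    using \<open>0 < \<sigma>\<close> by (simp add: k_def real_sqrt_mult)
  have I1: "I \<le> ln (real K)"
    using pam_entropy_le_ln_card[of K L \<sigma>] assms by (simp add: I_def)
  have I2: "I \<le> 1/2 * ln (1 + L\<^sup>2 * ((real K)\<^sup>2 - 1) / 12 / \<sigma>\<^sup>2)"
    using pam_entropy_le_gaussian[of K L \<sigma>] assms by (simp add: I_def)
  have I3: "I \<le> ln (1 + (real K - 1) * L / (k * \<sigma>))"
    using pam_entropy_le_peak[of K L \<sigma>] assms by (simp add: I_def sq)
  \<comment> \<open>Since \<open>K\<close> is at least 2, K + 1 is at most 3 (K - 1): the variance
    of the constellation is at most a quarter of its squared width.\<close>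
  have v: "L\<^sup>2 * ((real K)\<^sup>2 - 1) / 12 / \<sigma>\<^sup>2 \<le> ((real K - 1) * L)\<^sup>2 / (4 * \<sigma>\<^sup>2)"
  proof -
    have "((real K)\<^sup>2 - 1) \<le> 3 * (real K - 1)\<^sup>2"
      using mult_left_mono[of "real K + 1" "3 * (real K - 1)" "real K - 1"] K
      by (simp add: power2_eq_square algebra_simps)
    then have "L\<^sup>2 * ((real K)\<^sup>2 - 1) \<le> L\<^sup>2 * (3 * (real K - 1)\<^sup>2)"
      by (rule mult_left_mono) simp
    then have "L\<^sup>2 * ((real K)\<^sup>2 - 1) / 12 / \<sigma>\<^sup>2 \<le> L\<^sup>2 * (3 * (real K - 1)\<^sup>2) / 12 / \<sigma>\<^sup>2"
      by (intro divide_right_mono) auto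
    also have "l * (3 * q) / 12 / t = q * l / (4 * t)" for l q t :: real
      by simp
    finally show ?thesis
      by (simp only: power_mult_distrib)
  qed
  have v0: "0 \<le> L\<^sup>2 * ((real K)\<^sup>2 - 1) / 12 / \<sigma>\<^sup>2"
    using K power_mono[of 1 "real K" 2] by (intro divide_nonneg_nonneg mult_nonneg_nonneg) auto
  have "I \<le> 1/2 * ln (1 + ((real K - 1) * L)\<^sup>2 / (4 * \<sigma>\<^sup>2))"
  proof -
    have "ln (1 + L\<^sup>2 * ((real K)\<^sup>2 - 1) / 12 / \<sigma>\<^sup>2) \<le> ln (1 + ((real K - 1) * L)\<^sup>2 / (4 * \<sigma>\<^sup>2))"
      using v v0 by (intro ln_mono) auto
    then show ?thesis using I2 by linarith
  qed
  from divide_right_mono[OF this, of "ln 2"] divide_right_mono[OF I3, of "ln 2"]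
  have C: "I / ln 2 \<le> Cbar ((real K - 1) * L) \<sigma>"
    unfolding Cbar_def k_def[symmetric] by (simp add: log_def)
  define x where "x = L\<^sup>2 / (2 * pi * exp 1 * \<sigma>\<^sup>2)"
  have x0: "0 < x"
    using assms by (simp add: x_def)
  have KL: "real K * ((real K - 1) * L) / (real K - 1) = real K * L"
    using K1 by simp
  have xx: "((real K - 1) * L)\<^sup>2 / (2 * pi * exp 1 * (real K - 1)\<^sup>2 * \<sigma>\<^sup>2) = x"
    using K1 by (simp add: x_def power_mult_distrib)
  \<comment> \<open>After \<open>x\<close> is enlarged to L^2/(12 \<sigma>^2), the sum (K^2 - 1)/12
    + 1/12 = K^2/12 is exact.\<close>
  have g: "exp (2 * I) + x \<le> 1 + (real K * L)\<^sup>2 / (12 * \<sigma>\<^sup>2)"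
  proof -
    have "exp (2 * I) \<le> exp (ln (1 + L\<^sup>2 * ((real K)\<^sup>2 - 1) / 12 / \<sigma>\<^sup>2))"
      using I2 by simp
    also have "\<dots> = 1 + L\<^sup>2 * ((real K)\<^sup>2 - 1) / 12 / \<sigma>\<^sup>2"
      using v0 by (intro exp_ln) auto
    finally have 1: "exp (2 * I) \<le> 1 + L\<^sup>2 * ((real K)\<^sup>2 - 1) / 12 / \<sigma>\<^sup>2" .
    have "x \<le> L\<^sup>2 / (12 * \<sigma>\<^sup>2)"
      unfolding x_def using twelve_less_two_pi_e \<open>0 < \<sigma>\<close> by (intro divide_left_mono mult_right_mono mult_pos_pos) auto
    moreover have "1 + L\<^sup>2 * ((real K)\<^sup>2 - 1) / 12 / \<sigma>\<^sup>2 + L\<^sup>2 / (12 * \<sigma>\<^sup>2) = 1 + (real K * L)\<^sup>2 / (12 * \<sigma>\<^sup>2)"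
      using \<open>0 < \<sigma>\<close> by (simp add: field_simps power_mult_distrib)
    ultimately show ?thesis using 1 by linarith
  qed
  have g4: "exp (2 * I) + x \<le> 1 + (real K * L)\<^sup>2 / (4 * \<sigma>\<^sup>2)"
  proof -
    have "(real K * L)\<^sup>2 / (12 * \<sigma>\<^sup>2) \<le> (real K * L)\<^sup>2 / (4 * \<sigma>\<^sup>2)"
      using \<open>0 < \<sigma>\<close> by (intro divide_left_mono) auto
    then show ?thesis using g by linarith
  qed
  \<comment> \<open>In the unit \<open>d\<close>, the peak bound reads exp I \<le> 1 + (K - 1) d and
    \<open>x\<close> equals d^2; this is where (K - 1)^2 + 1 \<le> K^2 is used.\<close>
  have p: "exp (2 * I) + x \<le> (1 + real K * L / (k * \<sigma>))\<^sup>2"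
  proof -
    define d where "d = L / (k * \<sigma>)"
    have d: "0 < d" "x = d\<^sup>2"
      using assms k by (auto simp: d_def x_def power_divide power_mult_distrib)
    have "exp I \<le> exp (ln (1 + (real K - 1) * L / (k * \<sigma>)))"
      using I3 by simp
    also have "\<dots> = 1 + (real K - 1) * d"
      using K1 d assms k by (subst exp_ln) (auto simp: d_def intro!: add_pos_nonneg divide_nonneg_nonneg)
    finally have "(exp I)\<^sup>2 \<le> (1 + (real K - 1) * d)\<^sup>2"
      by (intro power_mono) auto
    then have "exp (2 * I) + x \<le> (1 + (real K - 1) * d)\<^sup>2 + d\<^sup>2"
      by (simp add: d exp_double)
    also have "\<dots> \<le> (1 + real K * d)\<^sup>2"
    proof -
      have "(1 + real K * d)\<^sup>2 - ((1 + (real K - 1) * d)\<^sup>2 + d\<^sup>2) = 2 * d + 2 * (real K - 1) * d\<^sup>2"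
        by (simp add: power2_eq_square algebra_simps)
      moreover have "0 \<le> 2 * d + 2 * (real K - 1) * d\<^sup>2"
        using d K1 by simp
      ultimately show ?thesis by linarith
    qed
    finally show ?thesis
      by (simp add: d_def)
  qed
  have E: "exp (2 * I) + x \<le> 2 powr (2 * Efun (real K * L) \<sigma>)"
  proof -
    have half: "2 powr (2 * (1/2 * log 2 z)) = z" if "0 < z" for z :: real
      using that by simp
    have sqr: "2 powr (2 * log 2 z) = z\<^sup>2" if "0 < z" for z :: real
      unfolding mult_2 powr_add using that by (simp add: power2_eq_square)
    consider "Efun (real K * L) \<sigma> = 1/2 * log 2 (1 + (real K * L)\<^sup>2 / (4 * \<sigma>\<^sup>2))"
      | "Efun (real K * L) \<sigma> = log 2 (1 + real K * L / (k * \<sigma>))"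
      | "Efun (real K * L) \<sigma> = 1/2 * log 2 (1 + (real K * L)\<^sup>2 / (12 * \<sigma>\<^sup>2))"
      unfolding Efun_def Cbar_def k_def min_def by metis
    then show ?thesis
    proof cases
      case 1
      have "0 < 1 + (real K * L)\<^sup>2 / (4 * \<sigma>\<^sup>2)"
        by (intro add_pos_nonneg) auto
      from half[OF this] show ?thesis
        unfolding 1 using g4 by simp
    next
      case 2
      have "0 < 1 + real K * L / (k * \<sigma>)"
        using assms k by (intro add_pos_nonneg) auto
      from sqr[OF this] show ?thesis
        unfolding 2 using p by simp
    next
      case 3
      have "0 < 1 + (real K * L)\<^sup>2 / (12 * \<sigma>\<^sup>2)"
        by (intro add_pos_nonneg) auto
      from half[OF this] show ?thesis
        unfolding 3 using g by simp
    qed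
  qed
  have "I / ln 2 \<le> 1/2 * log 2 (2 powr (2 * Efun (real K * L) \<sigma>) - x)"
  proof -
    have "exp (2 * I) \<le> 2 powr (2 * Efun (real K * L) \<sigma>) - x"
      using E by linarith
    then have "ln (exp (2 * I)) \<le> ln (2 powr (2 * Efun (real K * L) \<sigma>) - x)"
      by (intro ln_mono) (auto intro: less_le_trans[OF exp_gt_zero])
    then have "I \<le> 1/2 * ln (2 powr (2 * Efun (real K * L) \<sigma>) - x)"
      by simp
    from divide_right_mono[OF this, of "ln 2"] show ?thesis
      by (simp add: log_def)
  qed
  moreover have "I / ln 2 \<le> log 2 (real K)"
    using I1 by (simp add: log_def divide_right_mono)
  ultimately have "I / ln 2 \<le> Gfun ((real K - 1) * L) K \<sigma>"
    using C unfolding Gfun_def KL xx by simp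
  then show ?thesis
    by (simp add: I_def field_simps)
qed

section \<open>The lower bound F\<close>

text \<open>Both sides are \<open>K\<close> times the mutual information. Relative entropies suit
  data processing and coding, the difference of entropies suits the analytic bounds.\<close>

lemma pam_information_eq:
  assumes "0 < K" "0 \<le> L" "0 < \<sigma>"
  shows "(\<Sum>i<K. \<integral>y. normal_density (real i * L) \<sigma> y * ln (normal_density (real i * L) \<sigma> y / pam K L \<sigma> 0 y) \<partial>lborel)
    = real K * (pam_entropy K L \<sigma> - normal_entropy \<sigma>)"
proof -
  let ?p = "\<lambda>i. normal_density (real i * L) \<sigma>" and ?f = "pam K L \<sigma> 0"
  have q: "quadratic_growth (\<lambda>y. ln (?f y))"
    using assms by (rule quadratic_growth_ln_pam)
  have "(\<integral>y. ?p i y * ln (?p i y / ?f y) \<partial>lborel) = - normal_entropy \<sigma> - (\<integral>y. ?p i y * ln (?f y) \<partial>lborel)" for i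
  proof -
    have "?p i y * ln (?p i y / ?f y) = ?p i y * ln (?p i y) - ?p i y * ln (?f y)" for y
      using assms by (subst ln_divide_pos) (auto intro!: normal_density_pos pam_pos simp: right_diff_distrib)
    then show ?thesis
      using assms integrable_normal_quadratic_growth[OF assms(3) q]
        integrable_normal_quadratic_growth[OF assms(3) quadratic_growth_ln_normal_density[OF assms(3)]]
      by (simp add: entropy_normal normal_entropy_def)
  qed
  then have "(\<Sum>i<K. \<integral>y. ?p i y * ln (?p i y / ?f y) \<partial>lborel)
      = - real K * normal_entropy \<sigma> - (\<Sum>i<K. \<integral>y. ?p i y * ln (?f y) \<partial>lborel)"
    by (simp add: sum_subtractf)
  moreover have "(\<Sum>i<K. \<integral>y. ?p i y * ln (?f y) \<partial>lborel) = real K * (\<integral>y. ?f y * ln (?f y) \<partial>lborel)"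
    unfolding integral_pam[OF assms(1,3) q] using assms by simp
  ultimately show ?thesis
    using assms by (simp add: entropy_pam algebra_simps)
qed

text \<open>Completing the square: the product is a Gaussian at the midpoint with variance
  \<sigma>^2/2, times the density of variance 2 \<sigma>^2 evaluated at the distance of the centres.
  These constants are the summands of F3.\<close>

lemma
  assumes "0 < \<sigma>"
  shows integrable_normal_product: "integrable lborel (\<lambda>y. normal_density x \<sigma> y * normal_density x' \<sigma> y)"
    and integral_normal_product: "(\<integral>y. normal_density x \<sigma> y * normal_density x' \<sigma> y \<partial>lborel)
      = exp (- ((x - x')\<^sup>2) / (4 * \<sigma>\<^sup>2)) / sqrt (4 * pi * \<sigma>\<^sup>2)"
proof -
  define s where "s = \<sigma> / sqrt 2"
  have s: "0 < s" "s\<^sup>2 = \<sigma>\<^sup>2 / 2"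
    using assms by (auto simp: s_def power_divide)
  have eq: "normal_density x \<sigma> y * normal_density x' \<sigma> y
      = exp (- ((x - x')\<^sup>2) / (4 * \<sigma>\<^sup>2)) / sqrt (4 * pi * \<sigma>\<^sup>2) * normal_density ((x + x') / 2) s y" for y
  proof -
    have e: "- (y - x)\<^sup>2 / (2 * \<sigma>\<^sup>2) + - (y - x')\<^sup>2 / (2 * \<sigma>\<^sup>2)
        = - ((x - x')\<^sup>2) / (4 * \<sigma>\<^sup>2) + - (y - (x + x') / 2)\<^sup>2 / (2 * s\<^sup>2)"
      unfolding s(2) using assms by (simp add: field_simps power2_eq_square)
    have "sqrt (2 * pi * \<sigma>\<^sup>2) * sqrt (2 * pi * \<sigma>\<^sup>2) = sqrt (4 * pi * \<sigma>\<^sup>2) * sqrt (2 * pi * s\<^sup>2)"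
      unfolding s(2) real_sqrt_mult[symmetric] by (simp add: mult_ac)
    then have c: "1 / sqrt (2 * pi * \<sigma>\<^sup>2) * (1 / sqrt (2 * pi * \<sigma>\<^sup>2)) = 1 / sqrt (4 * pi * \<sigma>\<^sup>2) * (1 / sqrt (2 * pi * s\<^sup>2))"
      by simp
    have "normal_density x \<sigma> y * normal_density x' \<sigma> y = (1 / sqrt (2 * pi * \<sigma>\<^sup>2) * (1 / sqrt (2 * pi * \<sigma>\<^sup>2))) *
        exp (- (y - x)\<^sup>2 / (2 * \<sigma>\<^sup>2) + - (y - x')\<^sup>2 / (2 * \<sigma>\<^sup>2))"
      unfolding normal_density_def exp_add by (simp only: mult_ac)
    also have "\<dots> = exp (- ((x - x')\<^sup>2) / (4 * \<sigma>\<^sup>2)) * (1 / sqrt (4 * pi * \<sigma>\<^sup>2)) * normal_density ((x + x') / 2) s y"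
      unfolding normal_density_def c e exp_add by (simp only: mult_ac)
    finally show ?thesis by simp
  qed
  show "integrable lborel (\<lambda>y. normal_density x \<sigma> y * normal_density x' \<sigma> y)"
    unfolding eq using s by auto
  show "(\<integral>y. normal_density x \<sigma> y * normal_density x' \<sigma> y \<partial>lborel)
      = exp (- ((x - x')\<^sup>2) / (4 * \<sigma>\<^sup>2)) / sqrt (4 * pi * \<sigma>\<^sup>2)"
    unfolding eq using s by simp
qed

text \<open>Shannon entropy exceeds Renyi entropy of order two. Gibbs' inequality is applied with
  the normalised square \<open>f\<^sup>2 / m\<close> as reference, where \<open>m\<close> is the
  integral of \<open>f\<^sup>2\<close>.\<close>

lemma F3_less_pam_information:
  assumes K: "2 \<le> K" and L: "0 < L" and \<sigma>: "0 < \<sigma>"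
  shows "ln 2 * F3 ((real K - 1) * L) K \<sigma> < pam_entropy K L \<sigma> - normal_entropy \<sigma>"
proof -
  let ?f = "pam K L \<sigma> 0"
  let ?e = "\<lambda>i j. exp (- ((real i * L - real j * L)\<^sup>2) / (4 * \<sigma>\<^sup>2)) / sqrt (4 * pi * \<sigma>\<^sup>2)"
  have K0: "0 < K" using K by simp
  define m where "m = (\<Sum>i<K. \<Sum>j<K. ?e i j) / (real K)\<^sup>2"
  have f2: "?f y * ?f y = (\<Sum>i<K. \<Sum>j<K. normal_density (real i * L) \<sigma> y * normal_density (real j * L) \<sigma> y) / (real K)\<^sup>2" for y
    unfolding pam_def by (simp add: sum_product power2_eq_square)
  have if2: "integrable lborel (\<lambda>y. ?f y * ?f y)" and m: "(\<integral>y. ?f y * ?f y \<partial>lborel) = m"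
    unfolding f2 m_def using integrable_normal_product[OF \<sigma>] integral_normal_product[OF \<sigma>] by simp_all
  have mpos: "0 < m"
    unfolding m_def using K0 \<sigma> by (intro divide_pos_pos sum_pos) auto
  have fpos: "0 < ?f y" for y
    using K0 \<sigma> by (rule pam_pos)
  have q: "quadratic_growth (\<lambda>y. ln (?f y))"
    using K0 L \<sigma> by (intro quadratic_growth_ln_pam) auto
  have eq: "?f y * ln ((?f y * ?f y / m) / ?f y) = ?f y * ln (?f y) - ln m * ?f y" for y
    using fpos[of y] mpos by (simp add: ln_divide_pos algebra_simps)
  let ?A = "{y. ?f y \<noteq> m}"
  \<comment> \<open>Otherwise the output density would equal the positive constant \<open>m\<close>
    almost everywhere, and such a constant is not integrable over the line.\<close>
  have "emeasure lborel ?A \<noteq> 0"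
  proof
    assume "emeasure lborel ?A = 0"
    then have "AE y in lborel. ?f y = m"
      by (subst AE_iff_measurable[of ?A]) auto
    then have "integrable lborel ?f \<longleftrightarrow> integrable lborel (\<lambda>_::real. m)"
      by (intro integrable_cong_AE) auto
    then show False
      using integrable_pam[OF K0 \<sigma>, of L 0] mpos 
      by (auto simp: integrable_iff_bounded ennreal_mult_eq_top_iff)
  qed
  then have "(\<integral>y. ?f y * ln ((?f y * ?f y / m) / ?f y) \<partial>lborel) < (\<integral>y. ?f y * ?f y / m \<partial>lborel) - integral\<^sup>L lborel ?f"
  proof (intro gibbs_integral_less[where A = ?A])
    show "integrable lborel (\<lambda>y. ?f y * ln ((?f y * ?f y / m) / ?f y))"
      unfolding eq using integrable_pam[OF K0 \<sigma>, of L 0] integrable_pam_quadratic_growth[OF K0 \<sigma> q, of L 0]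
      by simp
    show "AE y in lborel. y \<in> ?A \<longrightarrow> ?f y \<noteq> ?f y * ?f y / m"
      using fpos mpos by (intro AE_I2) (simp add: field_simps less_imp_neq[symmetric])
  qed (use if2 fpos mpos integrable_pam[OF K0 \<sigma>, of L 0] in auto)
  also have "\<dots> = 0"
    using mpos m integral_pam_1[OF K0 \<sigma>, of L 0] by simp
  finally have "- pam_entropy K L \<sigma> - ln m < 0"
    unfolding eq using integrable_pam[OF K0 \<sigma>, of L 0] integrable_pam_quadratic_growth[OF K0 \<sigma> q, of L 0]
    by (simp add: integral_pam_1[OF K0 \<sigma>] entropy_pam[OF K0 \<sigma>])
  moreover have "ln 2 * F3 ((real K - 1) * L) K \<sigma> = - ln m - normal_entropy \<sigma>"
  proof -
    have K1: "real K - 1 \<noteq> 0" using K by simp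
    have "(\<Sum>i\<in>{1..K}. \<Sum>j\<in>{1..K}. sqrt (exp 1 / 2) / (real K)\<^sup>2 *
        exp (- ((real i - real j)\<^sup>2 * ((real K - 1) * L)\<^sup>2) / (4 * (real K - 1)\<^sup>2 * \<sigma>\<^sup>2)))
      = (\<Sum>i<K. \<Sum>j<K. sqrt (2 * pi * exp 1 * \<sigma>\<^sup>2) * (?e i j / (real K)\<^sup>2))"
      unfolding One_nat_def sum.atLeast1_atMost_eq
    proof (intro sum.cong refl)
      fix i j
      have "sqrt (exp 1 / 2) * sqrt (4 * pi * \<sigma>\<^sup>2) = sqrt (2 * pi * exp 1 * \<sigma>\<^sup>2)"
        unfolding real_sqrt_mult[symmetric] by (simp add: mult_ac)
      moreover have "sqrt (4 * pi * \<sigma>\<^sup>2) \<noteq> 0" using \<sigma> by simp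
      ultimately have 1: "sqrt (exp 1 / 2) = sqrt (2 * pi * exp 1 * \<sigma>\<^sup>2) / sqrt (4 * pi * \<sigma>\<^sup>2)"
        by (simp only: eq_divide_eq simp_thms if_True not_False_eq_True)
      have "- ((real (Suc i) - real (Suc j))\<^sup>2 * ((real K - 1) * L)\<^sup>2) / (4 * (real K - 1)\<^sup>2 * \<sigma>\<^sup>2)
          = - ((real i * L - real j * L)\<^sup>2) / (4 * \<sigma>\<^sup>2)"
        using K1 by (simp add: power_mult_distrib flip: left_diff_distrib)
      then show "sqrt (exp 1 / 2) / (real K)\<^sup>2 * exp (- ((real (Suc i) - real (Suc j))\<^sup>2 * ((real K - 1) * L)\<^sup>2) / (4 * (real K - 1)\<^sup>2 * \<sigma>\<^sup>2))
          = sqrt (2 * pi * exp 1 * \<sigma>\<^sup>2) * (?e i j / (real K)\<^sup>2)"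
        unfolding 1 by simp
    qed
    also have "\<dots> = sqrt (2 * pi * exp 1 * \<sigma>\<^sup>2) * m"
      unfolding m_def by (simp add: sum_distrib_left sum_divide_distrib)
    finally have "ln 2 * F3 ((real K - 1) * L) K \<sigma> = - ln (sqrt (2 * pi * exp 1 * \<sigma>\<^sup>2) * m)"
      unfolding F3_def by (simp add: log_def)
    also have "\<dots> = - (ln (sqrt (2 * pi * exp 1 * \<sigma>\<^sup>2)) + ln m)"
      using mpos \<sigma> by (subst ln_mult_pos) auto
    finally show ?thesis
      using \<sigma> by (simp add: normal_entropy_def ln_sqrt)
  qed
  ultimately show ?thesis by linarith
qed

section \<open>Smearing the constellation to a uniform law\<close>

lemma uniform_gauss_eq:
  assumes "0 < B"
  shows "uniform_gauss B \<sigma> y = (\<integral>s. indicator {0..B} s * normal_density s \<sigma> y \<partial>lborel) / B"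
proof -
  have "uniform_gauss B \<sigma> y = (\<integral>s. normal_density (max 0 (min B s)) \<sigma> y \<partial>density lborel (\<lambda>s. ennreal (indicator {0..B} s / B)))"
    unfolding uniform_gauss_def gmix_def uniform_measure_def using assms
    by (intro arg_cong[where f = "\<lambda>M. integral\<^sup>L M _"] density_cong)
       (auto simp: divide_ennreal[symmetric] ennreal_indicator)
  also have "\<dots> = (\<integral>s. indicator {0..B} s / B * normal_density (max 0 (min B s)) \<sigma> y \<partial>lborel)"
    using assms by (subst integral_density) auto
  also have "\<dots> = (\<integral>s. (indicator {0..B} s * normal_density s \<sigma> y) / B \<partial>lborel)"
    by (intro Bochner_Integration.integral_cong) (auto simp: indicator_def)
  finally show ?thesis by simp
qed

lemma integrable_interval_normal: "0 < \<sigma> \<Longrightarrow> integrable lborel (\<lambda>s. indicator {a..b} s * normal_density s \<sigma> y)"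
  using integrable_mult_indicator[of "{a..b}" lborel "\<lambda>s. normal_density s \<sigma> y"]
  by (simp add: normal_density_commute[of _ \<sigma> y])

text \<open>The intervals from \<open>i * L\<close> to \<open>(i + 1) * L\<close> tile
  \<open>[0, K * L]\<close> and overlap only in endpoints; the induction on \<open>K\<close> adds
  one tile at a time.\<close>

lemma uniform_gauss_split:
  assumes L: "0 < L" and \<sigma>: "0 < \<sigma>" and K: "0 < K"
  shows "uniform_gauss (real K * L) \<sigma> y = (\<Sum>i<K. uniform_gauss L \<sigma> (y - real i * L)) / real K"
proof -
  have *: "(\<integral>s. indicator {0..real K * L} s * normal_density s \<sigma> y \<partial>lborel)
      = (\<Sum>i<K. \<integral>s. indicator {0..L} s * normal_density s \<sigma> (y - real i * L) \<partial>lborel)" for K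
  proof (induction K)
    case 0
    have "(\<integral>s. indicator {0..0} s * normal_density s \<sigma> y \<partial>lborel) = (\<integral>s. 0 \<partial>(lborel :: real measure))"
      by (rule integral_cong_AE) (use AE_lborel_singleton[of 0] in \<open>auto elim!: eventually_mono\<close>)
    then show ?case by simp
  next
    case (Suc K)
    have "(\<integral>s. indicator {0..real (Suc K) * L} s * normal_density s \<sigma> y \<partial>lborel)
        = (\<integral>s. indicator {0..real K * L} s * normal_density s \<sigma> y
            + indicator {real K * L..real (Suc K) * L} s * normal_density s \<sigma> y \<partial>lborel)"
    proof (intro integral_cong_AE)
      have KL: "0 \<le> real K * L" "real K * L \<le> real (Suc K) * L"
        using L by auto
      show "AE s in lborel. indicator {0..real (Suc K) * L} s * normal_density s \<sigma> y
          = indicator {0..real K * L} s * normal_density s \<sigma> y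
            + indicator {real K * L..real (Suc K) * L} s * normal_density s \<sigma> y"
        using AE_lborel_singleton[of "real K * L"]
      proof eventually_elim
        case (elim s)
        have "indicator {0..real (Suc K) * L} s = (indicator {0..real K * L} s + indicator {real K * L..real (Suc K) * L} s :: real)"
          using KL elim unfolding indicator_def atLeastAtMost_iff by auto
        then show ?case
          by (simp only: distrib_right)
      qed
    qed auto
    also have "\<dots> = (\<integral>s. indicator {0..real K * L} s * normal_density s \<sigma> y \<partial>lborel)
        + (\<integral>s. indicator {real K * L..real (Suc K) * L} s * normal_density s \<sigma> y \<partial>lborel)"
      by (intro Bochner_Integration.integral_add integrable_interval_normal \<sigma>)
    also have "(\<integral>s. indicator {real K * L..real (Suc K) * L} s * normal_density s \<sigma> y \<partial>lborel)
        = (\<integral>s. indicator {0..L} s * normal_density s \<sigma> (y - real K * L) \<partial>lborel)"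
      using lborel_integral_real_affine[of 1 "\<lambda>s. indicator {real K * L..real (Suc K) * L} s * normal_density s \<sigma> y" "real K * L"]
      by (simp add: indicator_def normal_density_shift algebra_simps)
    finally show ?case
      using Suc by simp
  qed
  have "0 < real K * L"
    using L K by simp
  from uniform_gauss_eq[OF this, of \<sigma> y] show ?thesis
    unfolding uniform_gauss_eq[OF L] * sum_divide_distrib[symmetric]
    by (simp only: divide_divide_eq_left mult.commute[of L "real K"])
qed

lemma variance_uniform:
  fixes B :: real
  assumes "0 < B"
  shows "(\<integral>x. (max 0 (min B x) - B / 2)\<^sup>2 \<partial>uniform_measure lborel {0..B}) = B\<^sup>2 / 12"
proof -
  have "(\<integral>x. (max 0 (min B x) - B / 2)\<^sup>2 \<partial>uniform_measure lborel {0..B})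
      = (\<integral>x. (max 0 (min B x) - B / 2)\<^sup>2 \<partial>density lborel (\<lambda>s. ennreal (indicator {0..B} s / B)))"
    unfolding uniform_measure_def using assms
    by (intro arg_cong[where f = "\<lambda>M. integral\<^sup>L M _"] density_cong)
       (auto simp: divide_ennreal[symmetric] ennreal_indicator)
  also have "\<dots> = (\<integral>s. indicator {0..B} s / B * (max 0 (min B s) - B / 2)\<^sup>2 \<partial>lborel)"
    using assms by (subst integral_density) auto
  also have "\<dots> = (\<integral>s. ((s - B / 2)\<^sup>2 * indicator {0..B} s) / B \<partial>lborel)"
    by (intro Bochner_Integration.integral_cong) (auto simp: indicator_def)
  also have "\<dots> = (\<integral>s. (s - B / 2)\<^sup>2 * indicator {0..B} s \<partial>lborel) / B"
    by simp
  also have "(\<integral>s. (s - B / 2)\<^sup>2 * indicator {0..B} s \<partial>lborel) = (B - B / 2) ^ 3 / 3 - (0 - B / 2) ^ 3 / 3"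
    using assms
    by (intro integral_FTC_Icc_real) (auto intro!: derivative_eq_intros continuous_intros simp: power2_eq_square)
  also have "\<dots> / B = B\<^sup>2 / 12"
    using assms by (simp add: power2_eq_square power3_eq_cube field_simps)
  finally show ?thesis .
qed

text \<open>The true variance L^2/12 and the peak \<open>L\<close> give two of the three bounds
  directly; the one with the denominator 4 \<sigma>^2 is weaker than the variance bound.\<close>

lemma entropy_uniform_gauss_le_E:
  assumes L: "0 < L" and \<sigma>: "0 < \<sigma>"
  shows "entropy_density (uniform_gauss L \<sigma>) - normal_entropy \<sigma> \<le> ln 2 * Efun L \<sigma>"
proof -
  interpret gauss_mixture "uniform_measure lborel {0..L}" "\<lambda>x. max 0 (min L x)" L \<sigma>
    using assms by (rule gauss_mixture_uniform)
  define D where "D = entropy_density (uniform_gauss L \<sigma>) - normal_entropy \<sigma>"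
  have sq: "sqrt (2 * pi * exp 1 * \<sigma>\<^sup>2) = sqrt (2 * pi * exp 1) * \<sigma>"
    unfolding real_sqrt_mult[of _ "\<sigma>\<^sup>2"] by (simp add: abs_of_pos[OF \<sigma>])
  have 1: "D \<le> 1/2 * ln (1 + L\<^sup>2 / (12 * \<sigma>\<^sup>2))"
    using entropy_gmix_le_gaussian[OF variance_uniform[OF L]]
    by (simp add: D_def uniform_gauss_def normal_entropy_def)
  have 2: "D \<le> ln (1 + L / (sqrt (2 * pi * exp 1) * \<sigma>))"
    using entropy_gmix_le_peak L unfolding sq by (simp add: D_def uniform_gauss_def normal_entropy_def)
  have "L\<^sup>2 / (12 * \<sigma>\<^sup>2) \<le> L\<^sup>2 / (4 * \<sigma>\<^sup>2)"
    by (intro divide_left_mono) auto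
  then have "ln (1 + L\<^sup>2 / (12 * \<sigma>\<^sup>2)) \<le> ln (1 + L\<^sup>2 / (4 * \<sigma>\<^sup>2))"
    by (intro ln_mono add_pos_nonneg) auto
  with 1 have 3: "D \<le> 1/2 * ln (1 + L\<^sup>2 / (4 * \<sigma>\<^sup>2))"
    by linarith
  have "D / ln 2 \<le> Efun L \<sigma>"
    using divide_right_mono[OF 1, of "ln 2"] divide_right_mono[OF 2, of "ln 2"] divide_right_mono[OF 3, of "ln 2"]
    unfolding Efun_def Cbar_def by (simp add: log_def)
  then show ?thesis
    by (simp add: D_def field_simps)
qed

text \<open>Adding the uniform smear at the output cannot increase the information, which becomes
  the entropy of uniform-plus-Gaussian of width \<open>K * L\<close> minus that of width
  \<open>L\<close>. The first is bounded below by the entropy power inequality, the second above by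
  \<open>E\<close>.\<close>

lemma F2_less_pam_information:
  assumes K: "2 \<le> K" and L: "0 < L" and \<sigma>: "0 < \<sigma>"
  shows "ln 2 * F2 ((real K - 1) * L) K \<sigma> < pam_entropy K L \<sigma> - normal_entropy \<sigma>"
proof -
  have K0: "0 < K" using K by simp
  have KL: "0 < real K * L" using K0 L by simp
  interpret U: gauss_mixture "uniform_measure lborel {0..L}" "\<lambda>x. max 0 (min L x)" L \<sigma>
    rewrites "gmix (uniform_measure lborel {0..L}) (\<lambda>x. max 0 (min L x)) \<sigma> = uniform_gauss L \<sigma>"
    using gauss_mixture_uniform[OF L \<sigma>] by (auto simp: uniform_gauss_def)
  interpret V: gauss_mixture "uniform_measure lborel {0..real K * L}" "\<lambda>x. max 0 (min (real K * L) x)" "real K * L" \<sigma>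
    rewrites "gmix (uniform_measure lborel {0..real K * L}) (\<lambda>x. max 0 (min (real K * L) x)) \<sigma> = uniform_gauss (real K * L) \<sigma>"
    using gauss_mixture_uniform[OF KL \<sigma>] by (auto simp: uniform_gauss_def)
  let ?\<kappa> = "uniform_measure lborel {0..L}"
  let ?p = "\<lambda>i. normal_density (real i * L) \<sigma>"
  let ?q = "\<lambda>i y. uniform_gauss L \<sigma> (y - real i * L)"
  let ?f = "pam K L \<sigma> 0"
  let ?F = "uniform_gauss (real K * L) \<sigma>"
  have shift: "integrable lborel (\<lambda>y. g (y - c)) \<longleftrightarrow> integrable lborel g" "(\<integral>y. g (y - c) \<partial>lborel) = integral\<^sup>L lborel g"
    for g :: "real \<Rightarrow> real" and c
    by (rule lborel_shift_integral)+
  have qF: "integrable lborel (\<lambda>y. ?q i y * ln (?F y))" for i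
  proof -
    have "quadratic_growth (\<lambda>y. ln (?F (y - (- (real i * L)))))"
      by (rule quadratic_growth_shift[OF V.quadratic_growth_ln_gmix])
    from U.integrable_gmix[OF this] show ?thesis
      using shift(1)[of "\<lambda>y. uniform_gauss L \<sigma> y * ln (?F (y + real i * L))" "real i * L"] by simp
  qed
  have qq: "integrable lborel (\<lambda>y. ?q i y * ln (?q i y))"
    "(\<integral>y. ?q i y * ln (?q i y) \<partial>lborel) = - entropy_density (uniform_gauss L \<sigma>)" for i
    using shift[of "\<lambda>y. uniform_gauss L \<sigma> y * ln (uniform_gauss L \<sigma> y)" "real i * L"]
      U.integrable_gmix[OF U.quadratic_growth_ln_gmix] by (simp_all add: entropy_density_def)
  have lnqF: "?q i y * ln (?q i y / ?F y) = ?q i y * ln (?q i y) - ?q i y * ln (?F y)" for i y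
    by (subst ln_divide_pos) (auto simp: right_diff_distrib)
  have F: "?F y = (\<Sum>i<K. ?q i y) / real K" for y
    using L \<sigma> K0 by (rule uniform_gauss_split)
  have "(\<Sum>i<K. \<integral>y. ?q i y * ln (?q i y / ?F y) \<partial>lborel) \<le> (\<Sum>i<K. \<integral>y. ?p i y * ln (?p i y / ?f y) \<partial>lborel)"
  proof (rule data_processing[of ?\<kappa> K ?p ?q])
    show "prob_space ?\<kappa>" by (rule U.prob_space_axioms)
    show "0 < ?p i y" for i y using \<sigma> by (rule normal_density_pos)
    show "integrable ?\<kappa> (\<lambda>s. ?p i (y - s))" for i y
      by (rule U.integrable_const_bound[where B = "1 / sqrt (2 * pi * \<sigma>\<^sup>2)"])
         (auto intro!: normal_density_le_peak \<sigma>)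
    show "integrable lborel (?q i)" for i
      using shift(1)[of "uniform_gauss L \<sigma>" "real i * L"] U.integrable_gmix_density by simp
    show "?q i y = (\<integral>s. ?p i (y - s) \<partial>?\<kappa>)" for i y
      unfolding uniform_gauss_def gmix_def
    proof (intro integral_cong_AE)
      show "AE s in ?\<kappa>. normal_density (max 0 (min L s)) \<sigma> (y - real i * L) = ?p i (y - s)"
        using L by (intro AE_uniform_measureI) (auto simp: normal_density_shift add.commute)
    qed auto
    show "?f y = (\<Sum>i<K. ?p i y) / real K" for y
      by (simp add: pam_def)
    show "?F y = (\<Sum>i<K. ?q i y) / real K" for y
      by (rule F)
    show "integrable lborel (\<lambda>y. ?p i y * ln (?f y / ?p i y))" for i
    proof -
      have "ln (?f y / ?p i y) = ln (?f y) - ln (?p i y)" for y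
        using K0 \<sigma> by (intro ln_divide_pos pam_pos normal_density_pos)
      moreover have "integrable lborel (\<lambda>y. ?p i y * (ln (?f y) - ln (?p i y)))"
        using K0 L \<sigma> by (intro integrable_normal_quadratic_growth quadratic_growth_diff
            quadratic_growth_ln_pam quadratic_growth_ln_normal_density) auto
      ultimately show ?thesis by simp
    qed
    show "integrable lborel (\<lambda>y. ?q i y * ln (?q i y / ?F y))" for i
      unfolding lnqF by (intro Bochner_Integration.integrable_diff qq qF)
  qed (use K0 \<sigma> in auto)
  also have "\<dots> = real K * (pam_entropy K L \<sigma> - normal_entropy \<sigma>)"
    using K0 L \<sigma> by (intro pam_information_eq) auto
  finally have le: "(\<Sum>i<K. \<integral>y. ?q i y * ln (?q i y / ?F y) \<partial>lborel) \<le> real K * (pam_entropy K L \<sigma> - normal_entropy \<sigma>)" .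
  have "(\<Sum>i<K. \<integral>y. ?q i y * ln (?q i y / ?F y) \<partial>lborel)
      = - real K * entropy_density (uniform_gauss L \<sigma>) - (\<Sum>i<K. \<integral>y. ?q i y * ln (?F y) \<partial>lborel)"
    unfolding lnqF using qq qF by (simp add: sum_subtractf)
  also have "(\<Sum>i<K. \<integral>y. ?q i y * ln (?F y) \<partial>lborel) = (\<integral>y. real K * (?F y * ln (?F y)) \<partial>lborel)"
  proof -
    have "real K * (?F y * ln (?F y)) = (\<Sum>i<K. ?q i y * ln (?F y))" for y
      using K0 F[of y] by (simp add: sum_distrib_right[symmetric])
    then show ?thesis
      using qF by (simp add: Bochner_Integration.integral_sum)
  qed
  also have "\<dots> = - real K * entropy_density ?F"
    by (simp add: entropy_density_def)
  finally have "real K * (entropy_density ?F - entropy_density (uniform_gauss L \<sigma>)) \<le> real K * (pam_entropy K L \<sigma> - normal_entropy \<sigma>)"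
    using le by (simp add: algebra_simps)
  then have "entropy_density ?F - entropy_density (uniform_gauss L \<sigma>) \<le> pam_entropy K L \<sigma> - normal_entropy \<sigma>"
    using K0 by simp
  moreover have "1/2 * ln ((real K * L)\<^sup>2 + 2 * pi * exp 1 * \<sigma>\<^sup>2) < entropy_density ?F"
    using KL \<sigma> by (rule entropy_uniform_gauss_gt)
  \<comment> \<open>\<open>Clow\<close> at \<open>K * L\<close> is exactly the entropy power bound
    minus the noise entropy.\<close>
  moreover have "ln 2 * Clow (real K * L) \<sigma> = 1/2 * ln ((real K * L)\<^sup>2 + 2 * pi * exp 1 * \<sigma>\<^sup>2) - normal_entropy \<sigma>"
  proof -
    have "1 + (real K * L)\<^sup>2 / (2 * pi * exp 1 * \<sigma>\<^sup>2) = ((real K * L)\<^sup>2 + 2 * pi * exp 1 * \<sigma>\<^sup>2) / (2 * pi * exp 1 * \<sigma>\<^sup>2)"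
      using \<sigma> by (simp add: field_simps)
    moreover have "ln \<dots> = ln ((real K * L)\<^sup>2 + 2 * pi * exp 1 * \<sigma>\<^sup>2) - ln (2 * pi * exp 1 * \<sigma>\<^sup>2)"
      using \<sigma> by (intro ln_divide_pos add_nonneg_pos) auto
    moreover have "ln 2 * Clow (real K * L) \<sigma> = 1/2 * ln (1 + (real K * L)\<^sup>2 / (2 * pi * exp 1 * \<sigma>\<^sup>2))"
      unfolding Clow_def by (simp add: log_def)
    ultimately show ?thesis
      unfolding normal_entropy_def by (simp only:) (simp add: field_simps)
  qed
  moreover note entropy_uniform_gauss_le_E[OF L \<sigma>]
  moreover have "real K * ((real K - 1) * L) / (real K - 1) = real K * L" "(real K - 1) * L / (real K - 1) = L"
    using K by auto
  ultimately show ?thesis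
    unfolding F2_def by (simp add: right_diff_distrib)
qed

section \<open>Gaussian tails and the nearest-point decision\<close>

lemma Qfun_eq_integral: "Qfun x = (\<integral>t. std_normal_density t * indicator {x<..} t \<partial>lborel)"
proof -
  have "Qfun x = (\<integral>t. indicator {x<..} t \<partial>density lborel std_normal_density)"
    unfolding Qfun_def by simp
  also have "\<dots> = (\<integral>t. std_normal_density t * indicator {x<..} t \<partial>lborel)"
    by (subst integral_density) auto
  finally show ?thesis .
qed

text \<open>The right tail is closed, and the left one below open, to match the rounding of ties in
  the decision rule used for F1; the difference to the open tail of \<open>Qfun\<close> is a null
  set.\<close>

lemma normal_right_tail:
  assumes \<sigma>: "0 < \<sigma>"
  shows "(\<integral>y. normal_density m \<sigma> y * indicator {m + d..} y \<partial>lborel) = Qfun (d / \<sigma>)"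
proof -
  have nd: "\<sigma> * normal_density m \<sigma> (m + \<sigma> * t) = std_normal_density t" for t
    using \<sigma> by (simp add: normal_density_def real_sqrt_mult power_mult_distrib)
  have "(\<integral>y. normal_density m \<sigma> y * indicator {m + d..} y \<partial>lborel)
      = \<bar>\<sigma>\<bar> *\<^sub>R (\<integral>t. normal_density m \<sigma> (m + \<sigma> * t) * indicator {m + d..} (m + \<sigma> * t) \<partial>lborel)"
    using \<sigma> by (intro lborel_integral_real_affine) auto
  also have "\<dots> = (\<integral>t. std_normal_density t * indicator {m + d..} (m + \<sigma> * t) \<partial>lborel)"
    using \<sigma> by (simp add: nd[symmetric] mult.assoc flip: integral_mult_right_zero)
  also have "\<dots> = (\<integral>t. std_normal_density t * indicator {d / \<sigma><..} t \<partial>lborel)"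
  proof (rule integral_cong_AE)
    show "AE t in lborel. std_normal_density t * indicator {m + d..} (m + \<sigma> * t)
        = std_normal_density t * indicator {d / \<sigma><..} t"
      using AE_lborel_singleton[of "d / \<sigma>"]
    proof eventually_elim
      case (elim t)
      then have "d \<le> \<sigma> * t \<longleftrightarrow> d / \<sigma> < t"
        using \<sigma> by (auto simp: field_simps order_less_le)
      then show ?case
        by (simp add: indicator_def)
    qed
  qed auto
  finally show ?thesis
    by (simp add: Qfun_eq_integral)
qed

lemma normal_left_tail:
  assumes \<sigma>: "0 < \<sigma>"
  shows "(\<integral>y. normal_density m \<sigma> y * indicator {..<m - d} y \<partial>lborel) = Qfun (d / \<sigma>)"
proof -
  have "(\<integral>y. normal_density m \<sigma> y * indicator {..<m - d} y \<partial>lborel)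
      = (\<integral>y. normal_density m \<sigma> (2 * m - y) * indicator {..<m - d} (2 * m - y) \<partial>lborel)"
    by (rule integral_reflect_lborel(1)[symmetric])
  also have "\<dots> = (\<integral>y. normal_density m \<sigma> y * indicator {m + d..} y \<partial>lborel)"
  proof (rule integral_cong_AE)
    show "AE y in lborel. normal_density m \<sigma> (2 * m - y) * indicator {..<m - d} (2 * m - y)
        = normal_density m \<sigma> y * indicator {m + d..} y"
      using AE_lborel_singleton[of "m + d"]
      by eventually_elim (auto simp: normal_density_reflect indicator_def)
  qed auto
  finally show ?thesis
    by (simp add: normal_right_tail[OF \<sigma>])
qed

text \<open>Together with \<open>Qfun_le_half\<close> this puts the error probability of F1 strictly
  between 0 and 1, so the logarithms there have positive arguments.\<close>

lemma Qfun_pos: "0 < Qfun x"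
proof -
  have i: "integrable lborel (\<lambda>t. std_normal_density t * indicator {x<..} t)"
    by (intro integrable_real_mult_indicator) auto
  have nn: "0 \<le> Qfun x"
    unfolding Qfun_def by simp
  moreover have "Qfun x \<noteq> 0"
  proof
    assume "Qfun x = 0"
    then have "AE t in lborel. std_normal_density t * indicator {x<..} t = 0"
      unfolding Qfun_eq_integral using i by (subst (asm) integral_nonneg_eq_0_iff_AE) auto
    then have "AE t in lborel. t \<notin> {x<..}"
    proof eventually_elim
      case (elim t)
      then show ?case
        using normal_density_pos[of 1 0 t] by (auto simp: indicator_def split: if_splits)
    qed
    then have "{x<..} \<in> null_sets lborel"
      by (subst AE_iff_null_sets) auto
    then have "emeasure lborel {x<..} = 0"
      by auto
    moreover have "emeasure lborel {x<..<x + 1} \<le> emeasure lborel {x<..}"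
      by (intro emeasure_mono) auto
    ultimately show False
      by simp
  qed
  ultimately show ?thesis by simp
qed

lemma Qfun_le_half: "0 \<le> x \<Longrightarrow> 2 * Qfun x \<le> 1"
proof -
  assume x: "0 \<le> x"
  have i: "integrable lborel (\<lambda>t. std_normal_density t * indicator {..<0 - x} t)"
    "integrable lborel (\<lambda>t. std_normal_density t * indicator {0 + x..} t)"
    by (auto intro!: integrable_real_mult_indicator)
  have "2 * Qfun x = (\<integral>t. std_normal_density t * indicator {..<0 - x} t + std_normal_density t * indicator {0 + x..} t \<partial>lborel)"
    using normal_left_tail[of 1 0 x] normal_right_tail[of 1 0 x] i by simp
  also have "\<dots> \<le> (\<integral>t. std_normal_density t \<partial>lborel)"
    using i x by (intro integral_mono) (auto simp: indicator_def)
  finally show ?thesis by simp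
qed

text \<open>The reference conditional law is that of the hard nearest-point decision, with the decision errors
  spread uniformly over the other inputs.\<close>

lemma F1_less_pam_information:
  assumes K: "2 \<le> K" and L: "0 < L" and \<sigma>: "0 < \<sigma>"
  shows "ln 2 * F1 ((real K - 1) * L) K \<sigma> < pam_entropy K L \<sigma> - normal_entropy \<sigma>"
proof -
  have K0: "0 < K" and K1: "0 < real K - 1" using K by auto
  define Qv where "Qv = Qfun (L / 2 / \<sigma>)"
  define \<xi> where "\<xi> = 2 * (real K - 1) / real K * Qv"
  have Qv: "0 < Qv" "2 * Qv \<le> 1"
    using Qfun_pos Qfun_le_half[of "L / 2 / \<sigma>"] L \<sigma> by (auto simp: Qv_def)
  have \<xi>0: "0 < \<xi>"
    unfolding \<xi>_def using K0 K1 Qv by (intro mult_pos_pos divide_pos_pos) auto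
  have \<xi>1: "\<xi> < 1"
  proof -
    have "\<xi> = (real K - 1) / real K * (2 * Qv)"
      by (simp add: \<xi>_def)
    also have "\<dots> \<le> (real K - 1) / real K * 1"
      using K0 K1 Qv by (intro mult_left_mono) auto
    also have "\<dots> < 1"
      using K0 by simp
    finally show ?thesis .
  qed
  let ?p = "\<lambda>i. normal_density (real i * L) \<sigma>"
  let ?f = "pam K L \<sigma> 0"
  \<comment> \<open>Rounding to the nearest constellation point: \<open>nat\<close> sends negative
    floors to 0 and \<open>min\<close> cuts off at the last point, so the two outer decision regions
    are unbounded.\<close>
  define dec where "dec y = min (K - 1) (nat \<lfloor>y / L + 1 / 2\<rfloor>)" for y
  have dec_ge: "j \<le> dec y \<longleftrightarrow> j \<le> K - 1 \<and> (j = 0 \<or> (real j - 1 / 2) * L \<le> y)" for j y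
  proof (cases "j = 0")
    case False
    have "j \<le> nat \<lfloor>y / L + 1 / 2\<rfloor> \<longleftrightarrow> int j \<le> \<lfloor>y / L + 1 / 2\<rfloor>"
      using False by linarith
    also have "\<dots> \<longleftrightarrow> real j \<le> y / L + 1 / 2"
      by (simp add: le_floor_iff)
    also have "\<dots> \<longleftrightarrow> (real j - 1 / 2) * L \<le> y"
      using L by (simp add: field_simps)
    finally show ?thesis
      using False by (simp add: dec_def)
  qed simp
  have dec_lt: "dec y < K" for y
    using K0 by (simp add: dec_def)
  have [measurable]: "dec \<in> measurable borel (count_space UNIV)"
    unfolding dec_def by measurable
  have dec_ne: "(if dec y \<noteq> i then 1 else 0) = (if 0 < i then indicator {..<real i * L - L / 2} y else 0)
      + (if i < K - 1 then indicator {real i * L + L / 2..} y else (0::real))" if i: "i < K" for i y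
  proof -
    have "dec y \<noteq> i \<longleftrightarrow> \<not> i \<le> dec y \<or> Suc i \<le> dec y" by auto
    also have "\<dots> \<longleftrightarrow> (0 < i \<and> y < real i * L - L / 2) \<or> (i < K - 1 \<and> real i * L + L / 2 \<le> y)"
      unfolding dec_ge using i by (auto simp: algebra_simps)
    finally show ?thesis
      using L by (auto simp: indicator_def)
  qed
  define e where "e i = (\<integral>y. ?p i y * (if dec y \<noteq> i then 1 else 0) \<partial>lborel)" for i
  have e_eq: "e i = (if 0 < i then Qv else 0) + (if i < K - 1 then Qv else 0)" if i: "i < K" for i
  proof -
    have il: "integrable lborel (\<lambda>y. ?p i y * indicator {..<real i * L - L / 2} y)"
      "integrable lborel (\<lambda>y. ?p i y * indicator {real i * L + L / 2..} y)"
      using \<sigma> by (auto intro!: integrable_real_mult_indicator)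
    have "e i = (\<integral>y. (if 0 < i then 1 else 0) * (?p i y * indicator {..<real i * L - L / 2} y)
        + (if i < K - 1 then 1 else 0) * (?p i y * indicator {real i * L + L / 2..} y) \<partial>lborel)"
      unfolding e_def by (intro Bochner_Integration.integral_cong refl)
        (subst dec_ne[OF i], simp add: distrib_left)
    also have "\<dots> = (if 0 < i then 1 else 0) * Qv + (if i < K - 1 then 1 else 0) * Qv"
      using il normal_left_tail[OF \<sigma>, of "real i * L" "L / 2"] normal_right_tail[OF \<sigma>, of "real i * L" "L / 2"]
      by (simp add: Qv_def)
    finally show ?thesis by auto
  qed
  \<comment> \<open>Inner points can err on two sides and the two end points on one, which makes
    \<open>2 * (K - 1)\<close> tails in all; this explains the prefactor of \<xi>.\<close>
  have sum_e: "(\<Sum>i<K. e i) = real K * \<xi>"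
  proof -
    have "(\<Sum>i<K. e i) = (\<Sum>i<K. if 0 < i then Qv else 0) + (\<Sum>i<K. if i < K - 1 then Qv else 0)"
      by (simp add: e_eq sum.distrib)
    also have "(\<Sum>i<K. if 0 < i then Qv else 0) = (real K - 1) * Qv"
    proof -
      have "(\<Sum>i<K. if 0 < i then Qv else 0) = (\<Sum>i\<in>{..<K} - {0}. Qv)"
        by (intro sum.mono_neutral_cong_right) auto
      then show ?thesis
        using K0 by (simp add: of_nat_diff)
    qed
    also have "(\<Sum>i<K. if i < K - 1 then Qv else 0) = (real K - 1) * Qv"
    proof -
      have "(\<Sum>i<K. if i < K - 1 then Qv else 0) = (\<Sum>i\<in>{..<K - 1}. Qv)"
        by (intro sum.mono_neutral_cong_right) auto
      then show ?thesis
        using K0 by (simp add: of_nat_diff)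
    qed
    finally show ?thesis
      using K0 by (simp add: \<xi>_def)
  qed
  define w where "w i y = (if dec y = i then 1 - \<xi> else \<xi> / (real K - 1))" for i y
  have [measurable]: "w i \<in> borel_measurable borel" for i
    unfolding w_def by measurable
  have wpos: "0 < w i y" for i y
    using \<xi>0 \<xi>1 K1 by (simp add: w_def)
  have wle: "w i y \<le> max (1 - \<xi>) (\<xi> / (real K - 1))" for i y
    by (simp add: w_def)
  have sum_w: "(\<Sum>i<K. w i y) = 1" for y
  proof -
    have "(\<Sum>i<K. w i y) = w (dec y) y + (\<Sum>i\<in>{..<K} - {dec y}. w i y)"
      using dec_lt by (intro sum.remove) auto
    also have "(\<Sum>i\<in>{..<K} - {dec y}. w i y) = (\<Sum>i\<in>{..<K} - {dec y}. \<xi> / (real K - 1))"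
      by (intro sum.cong) (auto simp: w_def)
    also have "\<dots> = \<xi>"
      using dec_lt[of y] K0 K1 by (simp add: of_nat_diff)
    finally show ?thesis
      by (simp add: w_def)
  qed
  define lw where "lw = ln (\<xi> / (real K - 1)) - ln (1 - \<xi>)"
  have lnw: "ln (w i y) = ln (1 - \<xi>) + lw * (if dec y \<noteq> i then 1 else 0)" for i y
    by (simp add: w_def lw_def)
  \<comment> \<open>Keeping the true output density inside \<open>b\<close> turns Gibbs' inequality
    into a bound on the mutual information: besides \<open>?p i / ?f\<close> only the posterior
    \<open>w\<close> and the factor \<open>K\<close> remain.\<close>
  define b where "b i y = real K * ?f y * w i y" for i y
  have fpos: "0 < ?f y" for y
    using K0 \<sigma> by (rule pam_pos)
  have ppos: "0 < ?p i y" for i y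
    using \<sigma> by (rule normal_density_pos)
  have bpos: "0 < b i y" for i y
    unfolding b_def using K0 fpos wpos by simp
  have f1: "integrable lborel ?f" "integral\<^sup>L lborel ?f = 1"
    using integrable_pam[OF K0 \<sigma>] integral_pam_1[OF K0 \<sigma>] by auto
  have bint: "integrable lborel (b i)" for i
  proof (rule Bochner_Integration.integrable_bound[of _ "\<lambda>y. real K * max (1 - \<xi>) (\<xi> / (real K - 1)) * ?f y"])
    show "AE y in lborel. norm (b i y) \<le> norm (real K * max (1 - \<xi>) (\<xi> / (real K - 1)) * ?f y)"
    proof (intro AE_I2)
      fix y
      have "real K * ?f y * w i y \<le> real K * ?f y * max (1 - \<xi>) (\<xi> / (real K - 1))"
        using K0 fpos[of y] wle by (intro mult_left_mono) auto
      then show "norm (b i y) \<le> norm (real K * max (1 - \<xi>) (\<xi> / (real K - 1)) * ?f y)"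
        using bpos[of i y] by (simp add: b_def mult_ac)
    qed
    show "b i \<in> borel_measurable lborel"
      unfolding b_def by measurable
  qed (use f1 in simp)
  have sum_b: "(\<Sum>i<K. integral\<^sup>L lborel (b i)) = real K"
  proof -
    have "(\<Sum>i<K. integral\<^sup>L lborel (b i)) = (\<integral>y. (\<Sum>i<K. b i y) \<partial>lborel)"
      using bint by (simp add: Bochner_Integration.integral_sum)
    also have "\<dots> = (\<integral>y. real K * ?f y \<partial>lborel)"
      unfolding b_def by (simp add: sum_distrib_left[symmetric] sum_w)
    finally show ?thesis
      using f1 by simp
  qed
  have q: "quadratic_growth (\<lambda>y. ln (?f y))"
    using K0 L \<sigma> by (intro quadratic_growth_ln_pam) auto
  have ln_pf: "ln (?p i y / ?f y) = ln (?p i y) - ln (?f y)" for i y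
    using ppos fpos by (intro ln_divide_pos)
  have ipf: "integrable lborel (\<lambda>y. ?p i y * ln (?p i y / ?f y))" for i
    unfolding ln_pf using \<sigma> q
    by (intro integrable_normal_quadratic_growth quadratic_growth_diff quadratic_growth_ln_normal_density)
  have ie: "integrable lborel (\<lambda>y. ?p i y * (if dec y \<noteq> i then 1 else 0))" for i
  proof -
    have "(\<lambda>y. ?p i y * (if dec y \<noteq> i then 1 else 0)) = (\<lambda>y. ?p i y * indicator {y. dec y \<noteq> i} y)"
      by (auto simp: indicator_def)
    then show ?thesis
      using \<sigma> by (simp only:) (intro integrable_real_mult_indicator, auto)
  qed
  have ab: "?p i y * ln (b i y / ?p i y) = (ln (real K) + ln (1 - \<xi>)) * ?p i y
      + lw * (?p i y * (if dec y \<noteq> i then 1 else 0)) - ?p i y * ln (?p i y / ?f y)" for i y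
  proof -
    have "ln (b i y / ?p i y) = ln (real K * ?f y * w i y) - ln (?p i y)"
      unfolding b_def using K0 fpos wpos ppos by (intro ln_divide_pos) auto
    also have "ln (real K * ?f y * w i y) = ln (real K) + ln (?f y) + ln (w i y)"
      using K0 fpos[of y] wpos[of i y] by (simp add: ln_mult_pos)
    finally have "ln (b i y / ?p i y) = ln (real K) + (ln (1 - \<xi>) + lw * (if dec y \<noteq> i then 1 else 0)) - ln (?p i y / ?f y)"
      unfolding ln_pf lnw by simp
    then show ?thesis
      by (simp only:) (simp add: algebra_simps)
  qed
  have abint: "integrable lborel (\<lambda>y. ?p i y * ln (b i y / ?p i y))" for i
    unfolding ab using \<sigma> ipf ie by (intro Bochner_Integration.integrable_diff Bochner_Integration.integrable_add integrable_mult_right) auto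
  have abval: "(\<integral>y. ?p i y * ln (b i y / ?p i y) \<partial>lborel)
      = ln (real K) + ln (1 - \<xi>) + lw * e i - (\<integral>y. ?p i y * ln (?p i y / ?f y) \<partial>lborel)" for i
  proof -
    have "has_bochner_integral lborel (\<lambda>y. ?p i y * ln (b i y / ?p i y))
      ((ln (real K) + ln (1 - \<xi>)) * 1 + lw * e i - (\<integral>y. ?p i y * ln (?p i y / ?f y) \<partial>lborel))"
      unfolding ab using \<sigma> ipf ie
      by (intro has_bochner_integral_diff has_bochner_integral_add has_bochner_integral_mult_right)
         (auto simp: has_bochner_integral_iff e_def)
    then show ?thesis
      by (simp add: has_bochner_integral_iff)
  qed
  have le: "(\<integral>y. ?p i y * ln (b i y / ?p i y) \<partial>lborel) \<le> integral\<^sup>L lborel (b i) - 1" for i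
    using gibbs_integral_le[of lborel "?p i" "b i"] bint bpos ppos abint \<sigma> by simp
  have less: "(\<integral>y. ?p 0 y * ln (b 0 y / ?p 0 y) \<partial>lborel) < integral\<^sup>L lborel (b 0) - 1"
  proof -
    \<comment> \<open>Strictness is shown for input 0 on the region y < L/2, where the decision is
      0. There b / p equals g(y) (1 - \<xi>), and \<open>g\<close>, a sum of likelihood ratios, is
      strictly increasing, so the value 1 is taken at most once.\<close>
    define g where "g y = (\<Sum>j<K. exp (real j * L * y / \<sigma>\<^sup>2 - (real j * L)\<^sup>2 / (2 * \<sigma>\<^sup>2)))" for y
    have pg: "?p j y = ?p 0 y * exp (real j * L * y / \<sigma>\<^sup>2 - (real j * L)\<^sup>2 / (2 * \<sigma>\<^sup>2))" for j y
    proof -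
      have "- (y - real j * L)\<^sup>2 / (2 * \<sigma>\<^sup>2) = - (y - real 0 * L)\<^sup>2 / (2 * \<sigma>\<^sup>2) + (real j * L * y / \<sigma>\<^sup>2 - (real j * L)\<^sup>2 / (2 * \<sigma>\<^sup>2))"
        using \<sigma> by (simp add: field_simps power2_eq_square)
      then show ?thesis
        unfolding normal_density_def by (simp only: exp_add mult.assoc)
    qed
    have fg: "real K * ?f y = ?p 0 y * g y" for y
    proof -
      have "real K * ?f y = (\<Sum>j<K. ?p j y)"
        using K0 by (simp add: pam_def)
      also have "\<dots> = (\<Sum>j<K. ?p 0 y * exp (real j * L * y / \<sigma>\<^sup>2 - (real j * L)\<^sup>2 / (2 * \<sigma>\<^sup>2)))"
        by (intro sum.cong refl pg)
      finally show ?thesis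
        by (simp add: g_def sum_distrib_left)
    qed
    have gmono: "g y < g y'" if "y < y'" for y y'
      unfolding g_def
    proof (rule sum_strict_mono_ex1)
      have *: "real j * L * y / \<sigma>\<^sup>2 \<le> real j * L * y' / \<sigma>\<^sup>2" for j
        using that L by (intro divide_right_mono mult_left_mono) auto
      show "\<forall>j\<in>{..<K}. exp (real j * L * y / \<sigma>\<^sup>2 - (real j * L)\<^sup>2 / (2 * \<sigma>\<^sup>2)) \<le> exp (real j * L * y' / \<sigma>\<^sup>2 - (real j * L)\<^sup>2 / (2 * \<sigma>\<^sup>2))"
        using * by simp
      have "real 1 * L * y / \<sigma>\<^sup>2 < real 1 * L * y' / \<sigma>\<^sup>2"
        using that L \<sigma> by (intro divide_strict_right_mono mult_strict_left_mono) auto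
      then show "\<exists>j\<in>{..<K}. exp (real j * L * y / \<sigma>\<^sup>2 - (real j * L)\<^sup>2 / (2 * \<sigma>\<^sup>2)) < exp (real j * L * y' / \<sigma>\<^sup>2 - (real j * L)\<^sup>2 / (2 * \<sigma>\<^sup>2))"
        using K by (intro bexI[of _ 1]) auto
    qed simp
    obtain y0 where y0: "\<And>y. y \<noteq> y0 \<Longrightarrow> g y * (1 - \<xi>) \<noteq> 1"
    proof (cases "\<exists>y0. g y0 * (1 - \<xi>) = 1")
      case True
      then obtain y0 where 0: "g y0 * (1 - \<xi>) = 1" by blast
      have "g y * (1 - \<xi>) \<noteq> 1" if "y \<noteq> y0" for y
      proof
        assume "g y * (1 - \<xi>) = 1"
        with 0 have "g y * (1 - \<xi>) = g y0 * (1 - \<xi>)" by simp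
        then have "g y = g y0"
          using \<xi>1 by simp
        then show False
          using gmono[of y y0] gmono[of y0 y] that by linarith
      qed
      then show thesis by (rule that)
    qed (use that in blast)
    have ae: "AE y in lborel. y \<in> {..<L / 2} \<longrightarrow> ?p 0 y \<noteq> b 0 y"
      using AE_lborel_singleton[of y0]
    proof eventually_elim
      case (elim y)
      show ?case
      proof
        assume "y \<in> {..<L / 2}"
        then have "\<not> 1 \<le> dec y"
          unfolding dec_ge using L by simp
        then have "b 0 y = ?p 0 y * (g y * (1 - \<xi>))"
          unfolding b_def fg by (simp add: w_def)
        then show "?p 0 y \<noteq> b 0 y"
          using y0[OF elim] ppos[of 0 y] by simp
      qed
    qed
    have em: "emeasure lborel {..<L / 2} \<noteq> 0"
    proof
      assume *: "emeasure lborel {..<L / 2} = 0"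
      have "emeasure lborel {0..<L / 2} \<le> emeasure lborel {..<L / 2}"
        by (intro emeasure_mono) auto
      then show False
        using * L by simp
    qed
    have "(\<integral>y. ?p 0 y * ln (b 0 y / ?p 0 y) \<partial>lborel) < integral\<^sup>L lborel (b 0) - integral\<^sup>L lborel (?p 0)"
      by (rule gibbs_integral_less[OF _ bint ppos bpos abint _ em ae]) (use \<sigma> in auto)
    then show ?thesis
      using \<sigma> by simp
  qed
  have "(\<Sum>i<K. \<integral>y. ?p i y * ln (b i y / ?p i y) \<partial>lborel) < (\<Sum>i<K. integral\<^sup>L lborel (b i) - 1)"
  proof (rule sum_strict_mono_ex1)
    show "\<exists>i\<in>{..<K}. (\<integral>y. ?p i y * ln (b i y / ?p i y) \<partial>lborel) < integral\<^sup>L lborel (b i) - 1"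
      using less K0 by (intro bexI[of _ 0]) simp_all
  qed (use le in auto)
  then have "real K * (ln (real K) + ln (1 - \<xi>)) + lw * (real K * \<xi>) - real K * (pam_entropy K L \<sigma> - normal_entropy \<sigma>) < 0"
    unfolding abval using sum_b sum_e pam_information_eq[OF K0 _ \<sigma>, of L] L
    by (simp add: sum.distrib sum_subtractf sum_distrib_left[symmetric])
  then have "real K * (ln (real K) + ln (1 - \<xi>) + lw * \<xi> - (pam_entropy K L \<sigma> - normal_entropy \<sigma>)) < 0"
    by (simp add: algebra_simps)
  then have "ln (real K) + ln (1 - \<xi>) + lw * \<xi> < pam_entropy K L \<sigma> - normal_entropy \<sigma>"
    using K0 by (simp add: mult_less_0_iff)
  moreover have "ln 2 * F1 ((real K - 1) * L) K \<sigma> = ln (real K) + ln (1 - \<xi>) + lw * \<xi>"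
  proof -
    have "x * L / (2 * x * \<sigma>) = L / 2 / \<sigma>" if "0 < x" for x
      using that by simp
    from this[OF K1] have "F1 ((real K - 1) * L) K \<sigma> = log 2 (real K) - Hb \<xi> - \<xi> * log 2 (real K - 1)"
      by (simp add: F1_def Let_def \<xi>_def Qv_def)
    also have "\<dots> = (ln (real K) + (\<xi> * ln \<xi> + (1 - \<xi>) * ln (1 - \<xi>)) - \<xi> * ln (real K - 1)) / ln 2"
      using \<xi>0 \<xi>1 by (simp add: Hb_def log_def add_divide_distrib diff_divide_distrib)
    finally have F1: "ln 2 * F1 ((real K - 1) * L) K \<sigma> = ln (real K) + (\<xi> * ln \<xi> + (1 - \<xi>) * ln (1 - \<xi>)) - \<xi> * ln (real K - 1)"
      by simp
    have lw: "lw = ln \<xi> - ln (real K - 1) - ln (1 - \<xi>)"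
      using \<xi>0 K1 by (simp add: lw_def ln_divide_pos)
    show ?thesis
      unfolding F1 lw by (simp add: algebra_simps)
  qed
  ultimately show ?thesis by simp
qed

lemma Ffun_less_pam_information:
  assumes "2 \<le> K" "0 < L" "0 < \<sigma>"
  shows "ln 2 * Ffun ((real K - 1) * L) K \<sigma> < pam_entropy K L \<sigma> - normal_entropy \<sigma>"
  using F1_less_pam_information[OF assms] F2_less_pam_information[OF assms] F3_less_pam_information[OF assms]
  unfolding Ffun_def max_def by simp

text \<open>Both sides are \<open>K2\<close> times the information carried by the cloud letter: all
  clouds are translates of one another, so each conditional entropy is
  \<open>pam_entropy K1 L \<sigma>\<close>.\<close>

lemma superposition_information_eq:
  assumes "0 < K1" "0 < K2" "0 \<le> L" "0 < \<sigma>"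
  shows "(\<Sum>u<K2. \<integral>y. pam K1 L \<sigma> (real (u * K1) * L) y * ln (pam K1 L \<sigma> (real (u * K1) * L) y / pam (K1 * K2) L \<sigma> 0 y) \<partial>lborel)
    = real K2 * (pam_entropy (K1 * K2) L \<sigma> - pam_entropy K1 L \<sigma>)"
proof -
  let ?p = "\<lambda>u. pam K1 L \<sigma> (real (u * K1) * L)" and ?f = "pam (K1 * K2) L \<sigma> 0"
  have KK: "0 < K1 * K2" using assms by simp
  have q: "quadratic_growth (\<lambda>y. ln (?f y))"
    using KK assms(3,4) by (rule quadratic_growth_ln_pam)
  have eq: "?p u y * ln (?p u y / ?f y) = ?p u y * ln (?p u y) - ?p u y * ln (?f y)" for u y
    using pam_pos[OF assms(1,4)] pam_pos[OF KK assms(4)] by (subst ln_divide_pos) (auto simp: right_diff_distrib)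
  note i = integrable_pam_quadratic_growth[OF assms(1,4) q]
    integrable_pam_quadratic_growth[OF assms(1,4) quadratic_growth_ln_pam[OF assms(1,3,4)]]
  have "(\<Sum>u<K2. \<integral>y. ?p u y * ln (?p u y / ?f y) \<partial>lborel)
      = - real K2 * pam_entropy K1 L \<sigma> - (\<Sum>u<K2. \<integral>y. ?p u y * ln (?f y) \<partial>lborel)"
    unfolding eq using i by (simp add: sum_subtractf entropy_pam[OF assms(1,4)])
  also have "(\<Sum>u<K2. \<integral>y. ?p u y * ln (?f y) \<partial>lborel) = (\<integral>y. real K2 * (?f y * ln (?f y)) \<partial>lborel)"
  proof -
    have "real K2 * (?f y * ln (?f y)) = (\<Sum>u<K2. ?p u y * ln (?f y))" for y
      using assms pam_group[OF assms(1,2), of L \<sigma> y] by (simp add: sum_distrib_right[symmetric])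
    then show ?thesis
      using i by (simp add: Bochner_Integration.integral_sum)
  qed
  also have "\<dots> = - real K2 * pam_entropy (K1 * K2) L \<sigma>"
    using entropy_pam[OF KK assms(4), of L 0] by simp
  finally show ?thesis
    by (simp add: algebra_simps)
qed

lemma normal_density_convolution:
  assumes "0 < \<sigma>" "0 < \<tau>"
  shows "(\<integral>s. normal_density x \<sigma> (y - s) \<partial>density lborel (normal_density 0 \<tau>)) = normal_density x (sqrt (\<sigma>\<^sup>2 + \<tau>\<^sup>2)) y"
proof -
  have "(\<integral>s. normal_density x \<sigma> (y - s) \<partial>density lborel (normal_density 0 \<tau>))
      = (\<integral>s. normal_density 0 \<sigma> ((y - x) - s) * normal_density 0 \<tau> s \<partial>lborel)"
    by (subst integral_density) (auto simp: normal_density_def algebra_simps)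
  also have "\<dots> = enn2real (\<integral>\<^sup>+s. ennreal (normal_density 0 \<sigma> ((y - x) - s) * normal_density 0 \<tau> s) \<partial>lborel)"
    by (intro integral_eq_nn_integral) auto
  also have "\<dots> = normal_density 0 (sqrt (\<sigma>\<^sup>2 + \<tau>\<^sup>2)) (y - x)"
    using fun_cong[OF conv_normal_density_zero_mean[OF assms], of "y - x"] by simp
  finally show ?thesis
    by (simp add: normal_density_shift)
qed

text \<open>The second channel is the first one followed by independent Gaussian noise of variance
  \<sigma>2^2 - \<sigma>1^2. Hence a cloud rate chosen for receiver 2 is also decodable at receiver
  1.\<close>

lemma superposition_information_antimono:
  assumes K: "0 < K1" "0 < K2" and L: "0 \<le> L" and \<sigma>: "0 < \<sigma>1" "\<sigma>1 < \<sigma>2"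
  shows "pam_entropy (K1 * K2) L \<sigma>2 - pam_entropy K1 L \<sigma>2 \<le> pam_entropy (K1 * K2) L \<sigma>1 - pam_entropy K1 L \<sigma>1"
proof -
  have \<sigma>2: "0 < \<sigma>2" using \<sigma> by simp
  define \<tau> where "\<tau> = sqrt (\<sigma>2\<^sup>2 - \<sigma>1\<^sup>2)"
  have d: "0 < \<sigma>2\<^sup>2 - \<sigma>1\<^sup>2"
    using power_strict_mono[of \<sigma>1 \<sigma>2 2] \<sigma> by simp
  have \<tau>: "0 < \<tau>" "sqrt (\<sigma>1\<^sup>2 + \<tau>\<^sup>2) = \<sigma>2"
    using d \<sigma> by (auto simp: \<tau>_def)
  let ?\<kappa> = "density lborel (normal_density 0 \<tau>)"
  interpret \<kappa>: prob_space ?\<kappa>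
    using \<tau>(1) by (rule prob_space_normal_density)
  let ?p = "\<lambda>\<sigma> u. pam K1 L \<sigma> (real (u * K1) * L)" and ?f = "\<lambda>\<sigma>. pam (K1 * K2) L \<sigma> 0"
  have KK: "0 < K1 * K2" using K by simp
  have int: "integrable ?\<kappa> (\<lambda>s. normal_density x \<sigma>1 (y - s))" for x y
    by (rule \<kappa>.integrable_const_bound[where B = "1 / sqrt (2 * pi * \<sigma>1\<^sup>2)"])
       (auto intro!: normal_density_le_peak \<sigma>)
  have lnint: "integrable lborel (\<lambda>y. ?p \<sigma> u y * ln (?f \<sigma> y / ?p \<sigma> u y))"
    "integrable lborel (\<lambda>y. ?p \<sigma> u y * ln (?p \<sigma> u y / ?f \<sigma> y))" if "0 < \<sigma>" for \<sigma> u
  proof -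
    have *: "ln (?f \<sigma> y / ?p \<sigma> u y) = ln (?f \<sigma> y) - ln (?p \<sigma> u y)" "ln (?p \<sigma> u y / ?f \<sigma> y) = ln (?p \<sigma> u y) - ln (?f \<sigma> y)" for y
      using K KK that by (auto intro!: ln_divide_pos pam_pos)
    show "integrable lborel (\<lambda>y. ?p \<sigma> u y * ln (?f \<sigma> y / ?p \<sigma> u y))"
      "integrable lborel (\<lambda>y. ?p \<sigma> u y * ln (?p \<sigma> u y / ?f \<sigma> y))"
      unfolding * using K KK L that
      by (auto intro!: integrable_pam_quadratic_growth quadratic_growth_diff quadratic_growth_ln_pam)
  qed
  have "(\<Sum>u<K2. \<integral>y. ?p \<sigma>2 u y * ln (?p \<sigma>2 u y / ?f \<sigma>2 y) \<partial>lborel)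
      \<le> (\<Sum>u<K2. \<integral>y. ?p \<sigma>1 u y * ln (?p \<sigma>1 u y / ?f \<sigma>1 y) \<partial>lborel)"
  proof (rule data_processing[of ?\<kappa> K2 "?p \<sigma>1" "?p \<sigma>2"])
    show "integrable ?\<kappa> (\<lambda>s. ?p \<sigma>1 u (y - s))" for u y
      unfolding pam_def using int by auto
    show "?p \<sigma>2 u y = (\<integral>s. ?p \<sigma>1 u (y - s) \<partial>?\<kappa>)" for u y
      unfolding pam_def using int by (simp add: normal_density_convolution[OF \<sigma>(1) \<tau>(1)] \<tau>(2) Bochner_Integration.integral_sum)
  qed (use K \<sigma> \<sigma>2 \<kappa>.prob_space_axioms lnint pam_group[OF K] in
      \<open>auto simp: pam_pos integrable_pam integral_pam_1\<close>)
  then have "real K2 * (pam_entropy (K1 * K2) L \<sigma>2 - pam_entropy K1 L \<sigma>2)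
      \<le> real K2 * (pam_entropy (K1 * K2) L \<sigma>1 - pam_entropy K1 L \<sigma>1)"
    using superposition_information_eq[OF K L] \<sigma> \<sigma>2 by simp
  then show ?thesis
    using K by simp
qed

section \<open>Random superposition codes\<close>

text \<open>At \<open>h = 0\<close>, the derivative of the mean of \<open>exp (- h * l)\<close> is
  minus the mean of \<open>l\<close>. Thus a small Chernoff parameter makes the exponent positive
  for every threshold below the mean.\<close>

lemma chernoff_tendsto:
  fixes p l :: "'a \<Rightarrow> real"
  assumes p: "\<And>x. 0 \<le> p x" "integrable M p"
    and l: "integrable M (\<lambda>x. p x * l x)" "integrable M (\<lambda>x. p x * exp (- l x))"
    and [measurable]: "l \<in> borel_measurable M"
  shows "(\<lambda>n. \<integral>x. p x * ((1 - exp (- (l x) / real (Suc n))) * real (Suc n)) \<partial>M) \<longlonglongrightarrow> (\<integral>x. p x * l x \<partial>M)"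
proof (rule integral_dominated_convergence[where w = "\<lambda>x. \<bar>p x * l x\<bar> + p x + p x * exp (- l x)"])
  have [measurable]: "p \<in> borel_measurable M"
    using p by auto
  show "(\<lambda>x. p x * l x) \<in> borel_measurable M" "\<And>n. (\<lambda>x. p x * ((1 - exp (- (l x) / real (Suc n))) * real (Suc n))) \<in> borel_measurable M"
    by measurable
  show "integrable M (\<lambda>x. \<bar>p x * l x\<bar> + p x + p x * exp (- l x))"
    using p l by auto
  show "AE x in M. (\<lambda>n. p x * ((1 - exp (- (l x) / real (Suc n))) * real (Suc n))) \<longlonglongrightarrow> p x * l x"
  proof (intro AE_I2 tendsto_mult_left)
    fix x
    have "((\<lambda>h. - exp (- l x * h)) has_real_derivative l x) (at 0)"
      by (auto intro!: derivative_eq_intros)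
    then have "(\<lambda>h. (1 - exp (- l x * h)) / h) \<midarrow>0\<rightarrow> l x"
      by (simp add: has_field_derivative_iff)
    moreover have "filterlim (\<lambda>n. 1 / real (Suc n)) (at 0) sequentially"
      using LIMSEQ_inverse_real_of_nat by (auto simp: filterlim_at inverse_eq_divide simp del: of_nat_Suc)
    ultimately have "(\<lambda>n. (1 - exp (- l x * (1 / real (Suc n)))) / (1 / real (Suc n))) \<longlonglongrightarrow> l x"
      by (rule filterlim_compose)
    then show "(\<lambda>n. (1 - exp (- (l x) / real (Suc n))) * real (Suc n)) \<longlonglongrightarrow> l x"
      by simp
  qed
  show "AE x in M. norm (p x * ((1 - exp (- (l x) / real (Suc n))) * real (Suc n))) \<le> \<bar>p x * l x\<bar> + p x + p x * exp (- l x)" for n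
  proof (intro AE_I2)
    fix x
    define h where "h = 1 / real (Suc n)"
    have h: "0 < h" "h \<le> 1"
      by (auto simp: h_def)
    \<comment> \<open>The difference quotient is at most \<open>l x\<close> by the tangent of
      \<open>exp\<close>, and at least its value at \<open>h = 1\<close> by convexity; the two give
      an integrable dominating function independent of \<open>n\<close>.\<close>
    have "1 + (- l x * h) \<le> exp (- l x * h)"
      by (rule exp_ge_add_one_self)
    then have up: "(1 - exp (- l x * h)) / h \<le> l x"
      using h by (simp add: field_simps)
    have "exp ((1 - h) *\<^sub>R 0 + h *\<^sub>R (- l x)) \<le> (1 - h) * exp 0 + h * exp (- l x)"
      using h by (intro convex_onD[OF exp_convex]) auto
    then have lo: "1 - exp (- l x) \<le> (1 - exp (- l x * h)) / h"
      using h by (simp add: field_simps)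
    have "\<bar>(1 - exp (- l x * h)) / h\<bar> \<le> \<bar>l x\<bar> + 1 + exp (- l x)"
      using up lo exp_ge_zero[of "- l x"] by linarith
    then have "p x * \<bar>(1 - exp (- l x * h)) / h\<bar> \<le> p x * (\<bar>l x\<bar> + 1 + exp (- l x))"
      using p by (intro mult_left_mono) auto
    moreover have "(1 - exp (- (l x) / real (Suc n))) * real (Suc n) = (1 - exp (- l x * h)) / h"
      by (simp add: h_def)
    ultimately show "norm (p x * ((1 - exp (- (l x) / real (Suc n))) * real (Suc n))) \<le> \<bar>p x * l x\<bar> + p x + p x * exp (- l x)"
      using p(1)[of x] by (simp only: real_norm_def abs_mult[of "p x"] abs_of_nonneg distrib_left mult_1_right)
  qed
qed

text \<open>Expectation under the uniform law on a finite set. It stands for the random choice of a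
  code, so that random coding becomes counting.\<close>

definition avg :: "'a set \<Rightarrow> ('a \<Rightarrow> real) \<Rightarrow> real" where
  "avg A f = (\<Sum>x\<in>A. f x) / real (card A)"

lemma avg_mono: "(\<And>x. x \<in> A \<Longrightarrow> f x \<le> g x) \<Longrightarrow> avg A f \<le> avg A g"
  unfolding avg_def by (intro divide_right_mono sum_mono) auto

lemma avg_cong: "(\<And>x. x \<in> A \<Longrightarrow> f x = g x) \<Longrightarrow> avg A f = avg A g"
  unfolding avg_def by (intro arg_cong2[where f = "(/)"] sum.cong) auto

lemma avg_const: "finite A \<Longrightarrow> A \<noteq> {} \<Longrightarrow> avg A (\<lambda>_. c) = c"
  unfolding avg_def by simp

lemma avg_le_const: "finite A \<Longrightarrow> A \<noteq> {} \<Longrightarrow> (\<And>x. x \<in> A \<Longrightarrow> f x \<le> c) \<Longrightarrow> avg A f \<le> c"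
  using avg_mono[of A f "\<lambda>_. c"] avg_const[of A c] by simp

lemma avg_add: "avg A (\<lambda>x. f x + g x) = avg A f + avg A g"
  unfolding avg_def by (simp add: sum.distrib add_divide_distrib)

lemma avg_sum: "avg A (\<lambda>x. \<Sum>j\<in>J. f j x) = (\<Sum>j\<in>J. avg A (f j))"
  unfolding avg_def by (simp add: sum_divide_distrib[symmetric] sum.swap[of _ J A])

lemma avg_divide: "avg A (\<lambda>x. f x / c) = avg A f / c"
  unfolding avg_def by (simp add: sum_divide_distrib[symmetric])

lemma avg_diff: "avg A (\<lambda>x. f x - g x) = avg A f - avg A g"
  unfolding avg_def by (simp add: sum_subtractf diff_divide_distrib)

lemma avg_cmult: "avg A (\<lambda>x. k * f x) = k * avg A f"
  unfolding avg_def by (simp add: sum_distrib_left[symmetric])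

lemma avg_swap: "avg A (\<lambda>x. avg B (f x)) = avg B (\<lambda>y. avg A (\<lambda>x. f x y))"
  unfolding avg_def by (simp add: sum_divide_distrib[symmetric] sum.swap[of f B A] mult.commute)

text \<open>Extracts a deterministic code from an average over codes.\<close>

lemma exists_le_avg:
  assumes "finite A" "A \<noteq> {}"
  shows "\<exists>x\<in>A. f x \<le> avg A f"
proof (rule ccontr)
  assume "\<not> ?thesis"
  then have "(\<Sum>x\<in>A. avg A f) < (\<Sum>x\<in>A. f x)"
    using assms by (intro sum_strict_mono) (auto simp: not_le)
  then show False
    using assms by (simp add: avg_def)
qed

text \<open>Two codewords with distinct indices are independent and uniform: prescribing both leaves
  \<open>card C ^ (card I - 2)\<close> codebooks, whatever their values. Pairwise independence is
  all that the union bound uses.\<close>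

lemma avg_PiE_pair:
  assumes "finite I" "finite C" "C \<noteq> {}" "i \<in> I" "j \<in> I" "i \<noteq> j"
  shows "avg (I \<rightarrow>\<^sub>E C) (\<lambda>U. g (U i) (U j)) = avg C (\<lambda>c. avg C (g c))"
proof -
  let ?N = "card C ^ (card I - 2)"
  have card: "card {U \<in> I \<rightarrow>\<^sub>E C. U i = c \<and> U j = d} = ?N" if "c \<in> C" "d \<in> C" for c d
  proof -
    have "{U \<in> I \<rightarrow>\<^sub>E C. U i = c \<and> U j = d} = (\<Pi>\<^sub>E k\<in>I. if k = i then {c} else if k = j then {d} else C)"
      using assms that by (auto simp: PiE_iff extensional_def split: if_splits)
    then have "card {U \<in> I \<rightarrow>\<^sub>E C. U i = c \<and> U j = d} = (\<Prod>k\<in>I. card (if k = i then {c} else if k = j then {d} else C))"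
      using assms by (simp add: card_PiE)
    also have "\<dots> = (\<Prod>k\<in>I - {i, j}. card C)"
      using assms by (intro prod.mono_neutral_cong_right) auto
    also have "\<dots> = ?N"
      using assms by (simp add: card_Diff_subset numeral_2_eq_2)
    finally show ?thesis .
  qed
  have "(\<Sum>U\<in>I \<rightarrow>\<^sub>E C. g (U i) (U j)) = (\<Sum>(c, d)\<in>C \<times> C. \<Sum>U\<in>{U \<in> I \<rightarrow>\<^sub>E C. (U i, U j) = (c, d)}. g (U i) (U j))"
    using assms by (subst sum.group[symmetric, of _ "C \<times> C" "\<lambda>U. (U i, U j)"])
      (auto intro!: finite_PiE sum.cong simp: case_prod_beta)
  also have "\<dots> = (\<Sum>(c, d)\<in>C \<times> C. real ?N * g c d)"
  proof (rule sum.cong[OF refl], clarify)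
    fix c d assume "c \<in> C" "d \<in> C"
    have "(\<Sum>U\<in>{U \<in> I \<rightarrow>\<^sub>E C. (U i, U j) = (c, d)}. g (U i) (U j)) = (\<Sum>U\<in>{U \<in> I \<rightarrow>\<^sub>E C. U i = c \<and> U j = d}. g c d)"
      by (rule sum.cong) auto
    then show "(\<Sum>U\<in>{U \<in> I \<rightarrow>\<^sub>E C. (U i, U j) = (c, d)}. g (U i) (U j)) = real ?N * g c d"
      using card[OF \<open>c \<in> C\<close> \<open>d \<in> C\<close>] by simp
  qed
  also have "\<dots> = real ?N * (\<Sum>c\<in>C. \<Sum>d\<in>C. g c d)"
    by (simp add: sum.cartesian_product sum_distrib_left case_prod_beta)
  finally have *: "(\<Sum>U\<in>I \<rightarrow>\<^sub>E C. g (U i) (U j)) = real ?N * (\<Sum>c\<in>C. \<Sum>d\<in>C. g c d)" .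
  have "card {i, j} \<le> card I"
    using assms by (intro card_mono) auto
  then have "card I = card I - 2 + 2"
    using assms by simp
  then have cI: "card (I \<rightarrow>\<^sub>E C) = ?N * card C ^ 2"
    using assms by (metis card_funcsetE power_add)
  have "card C \<noteq> 0"
    using assms by simp
  then show ?thesis
    unfolding avg_def * cI by (simp add: sum_divide_distrib[symmetric] power2_eq_square)
qed

lemma avg_PiE_single:
  assumes "finite I" "finite C" "C \<noteq> {}" "i \<in> I"
  shows "avg (I \<rightarrow>\<^sub>E C) (\<lambda>U. g (U i)) = avg C g"
proof -
  let ?N = "card C ^ (card I - 1)"
  have card: "card {U \<in> I \<rightarrow>\<^sub>E C. U i = c} = ?N" if "c \<in> C" for c
  proof -
    have "{U \<in> I \<rightarrow>\<^sub>E C. U i = c} = (\<Pi>\<^sub>E k\<in>I. if k = i then {c} else C)"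
      using assms that by (auto simp: PiE_iff extensional_def split: if_splits)
    then have "card {U \<in> I \<rightarrow>\<^sub>E C. U i = c} = (\<Prod>k\<in>I. card (if k = i then {c} else C))"
      using assms by (simp add: card_PiE)
    also have "\<dots> = (\<Prod>k\<in>I - {i}. card C)"
      using assms by (intro prod.mono_neutral_cong_right) auto
    finally show ?thesis
      using assms by simp
  qed
  have "(\<Sum>U\<in>I \<rightarrow>\<^sub>E C. g (U i)) = (\<Sum>c\<in>C. \<Sum>U\<in>{U \<in> I \<rightarrow>\<^sub>E C. U i = c}. g (U i))"
    using assms by (subst sum.group[symmetric, of _ C "\<lambda>U. U i"]) (auto intro!: finite_PiE)
  also have "\<dots> = (\<Sum>c\<in>C. real ?N * g c)"
  proof (rule sum.cong[OF refl])
    fix c assume "c \<in> C"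
    have "(\<Sum>U\<in>{U \<in> I \<rightarrow>\<^sub>E C. U i = c}. g (U i)) = (\<Sum>U\<in>{U \<in> I \<rightarrow>\<^sub>E C. U i = c}. g c)"
      by (rule sum.cong) auto
    then show "(\<Sum>U\<in>{U \<in> I \<rightarrow>\<^sub>E C. U i = c}. g (U i)) = real ?N * g c"
      using card[OF \<open>c \<in> C\<close>] by simp
  qed
  finally have *: "(\<Sum>U\<in>I \<rightarrow>\<^sub>E C. g (U i)) = real ?N * (\<Sum>c\<in>C. g c)"
    by (simp add: sum_distrib_left)
  have "0 < card I"
    using assms by (auto simp: card_gt_0_iff)
  then have "card I = card I - 1 + 1"
    by simp
  then have cI: "card (I \<rightarrow>\<^sub>E C) = ?N * card C"
    using assms by (metis card_funcsetE power_add power_one_right)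
  have "card C \<noteq> 0"
    using assms by simp
  then show ?thesis
    unfolding avg_def * cI by simp
qed

section \<open>Words, threshold tests and their error probabilities\<close>

abbreviation words :: "nat \<Rightarrow> nat \<Rightarrow> (nat \<Rightarrow> nat) set" where
  "words n K \<equiv> {..<n} \<rightarrow>\<^sub>E {..<K}"

lemma finite_words: "finite (words n K)"
  by (intro finite_PiE) auto

lemma words_nonempty: "0 < K \<Longrightarrow> words n K \<noteq> {}"
  by (auto simp: PiE_eq_empty_iff)

text \<open>A uniform word has independent uniform letters, so per-letter bounds turn into powers of
  a single-letter average.\<close>

lemma avg_words_prod: "avg (words n K) (\<lambda>w. \<Prod>i<n. f i (w i)) = (\<Prod>i<n. avg {..<K} (f i))"
proof -
  have "(\<Sum>w\<in>words n K. \<Prod>i<n. f i (w i)) = (\<Prod>i<n. \<Sum>c<K. f i c)"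
    by (subst prod_sum_PiE) auto
  then show ?thesis
    unfolding avg_def by (simp add: card_PiE prod_dividef)
qed

text \<open>A threshold, in nats per letter, on the information density of a word pair. The ratio
  \<open>r\<close> takes both letters, so that cloud tests and satellite tests are instances of the
  same definition.\<close>

definition test :: "nat \<Rightarrow> real \<Rightarrow> (nat \<Rightarrow> nat \<Rightarrow> real \<Rightarrow> real) \<Rightarrow> (nat \<Rightarrow> nat) \<Rightarrow> (nat \<Rightarrow> nat) \<Rightarrow> (nat \<Rightarrow> real) \<Rightarrow> bool" where
  "test n \<gamma> r u s y \<longleftrightarrow> real n * \<gamma> < (\<Sum>i<n. ln (r (u i) (s i) (y i)))"

text \<open>\<open>loc u s\<close> is the channel input for the cloud letter \<open>u\<close> and the satellite letter \<open>s\<close>.\<close>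

definition out_prob :: "(nat \<Rightarrow> nat \<Rightarrow> real) \<Rightarrow> nat \<Rightarrow> real \<Rightarrow> (nat \<Rightarrow> nat) \<Rightarrow> (nat \<Rightarrow> nat) \<Rightarrow> ((nat \<Rightarrow> real) \<Rightarrow> bool) \<Rightarrow> real" where
  "out_prob loc n \<sigma> u s E = measure (noise n \<sigma>)
     {z \<in> space (noise n \<sigma>). E (chan_out n (\<lambda>i. loc (u i) (s i)) z)}"

lemma prob_space_noise: "0 < \<sigma> \<Longrightarrow> prob_space (noise n \<sigma>)"
  unfolding noise_def by (intro prob_space_PiM prob_space_normal_density)

lemma measurable_chan_out[measurable]: "chan_out n x \<in> measurable (noise n \<sigma>) (PiM {..<n} (\<lambda>_. borel))"
proof -
  have "(\<lambda>z. \<lambda>i\<in>{..<n}. x i + z i) \<in> measurable (PiM {..<n} (\<lambda>_. density lborel (normal_density 0 \<sigma>))) (PiM {..<n} (\<lambda>_. borel))"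
  proof (rule measurable_restrict)
    fix i assume "i \<in> {..<n}"
    then have "(\<lambda>z. z i) \<in> borel_measurable (PiM {..<n} (\<lambda>_. density lborel (normal_density 0 \<sigma>)))"
      using measurable_component_singleton[of i "{..<n}" "\<lambda>_. density lborel (normal_density 0 \<sigma>)"] by simp
    then show "(\<lambda>z. x i + z i) \<in> borel_measurable (PiM {..<n} (\<lambda>_. density lborel (normal_density 0 \<sigma>)))"
      by simp
  qed
  then show ?thesis
    unfolding noise_def chan_out_def[abs_def] .
qed

lemma test_measurable[measurable]:
  assumes "\<And>u s. r u s \<in> borel_measurable borel"
  shows "Measurable.pred (PiM {..<n} (\<lambda>_. borel)) (test n \<gamma> r u s)"
proof -
  have "(\<lambda>y. r (u i) (s i) (y i)) \<in> borel_measurable (PiM {..<n} (\<lambda>_. borel))" if "i \<in> {..<n}" for i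
    using assms that by (intro measurable_compose[OF measurable_component_singleton]) auto
  then have "(\<lambda>y. \<Sum>i<n. ln (r (u i) (s i) (y i))) \<in> borel_measurable (PiM {..<n} (\<lambda>_. borel))"
    by (intro borel_measurable_sum borel_measurable_ln) auto
  then show ?thesis
    unfolding test_def[abs_def] by measurable
qed

lemma out_prob_event:
  assumes "Measurable.pred (PiM {..<n} (\<lambda>_. borel)) E"
  shows "{z \<in> space (noise n \<sigma>). E (chan_out n x z)} \<in> sets (noise n \<sigma>)"
  using measurable_compose[OF measurable_chan_out assms] by (simp add: pred_def)

lemma out_prob_mono:
  assumes "0 < \<sigma>" "Measurable.pred (PiM {..<n} (\<lambda>_. borel)) E" "Measurable.pred (PiM {..<n} (\<lambda>_. borel)) F"
    and "\<And>y. E y \<Longrightarrow> F y"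
  shows "out_prob loc n \<sigma> u s E \<le> out_prob loc n \<sigma> u s F"
proof -
  interpret prob_space "noise n \<sigma>" using assms(1) by (rule prob_space_noise)
  show ?thesis
    unfolding out_prob_def using assms out_prob_event[OF assms(3)] by (intro finite_measure_mono) auto
qed

lemma out_prob_disj:
  assumes "0 < \<sigma>" "Measurable.pred (PiM {..<n} (\<lambda>_. borel)) E" "Measurable.pred (PiM {..<n} (\<lambda>_. borel)) F"
  shows "out_prob loc n \<sigma> u s (\<lambda>y. E y \<or> F y) \<le> out_prob loc n \<sigma> u s E + out_prob loc n \<sigma> u s F"
proof -
  interpret prob_space "noise n \<sigma>" using assms(1) by (rule prob_space_noise)
  have "{z \<in> space (noise n \<sigma>). E (chan_out n x z) \<or> F (chan_out n x z)}
      = {z \<in> space (noise n \<sigma>). E (chan_out n x z)} \<union> {z \<in> space (noise n \<sigma>). F (chan_out n x z)}" for x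
    by auto
  then show ?thesis
    unfolding out_prob_def by (simp add: measure_Un_le out_prob_event assms)
qed

lemma out_prob_bex:
  assumes "0 < \<sigma>" "finite W" "\<And>w. w \<in> W \<Longrightarrow> Measurable.pred (PiM {..<n} (\<lambda>_. borel)) (E w)"
  shows "out_prob loc n \<sigma> u s (\<lambda>y. \<exists>w\<in>W. E w y) \<le> (\<Sum>w\<in>W. out_prob loc n \<sigma> u s (E w))"
proof -
  interpret prob_space "noise n \<sigma>" using assms(1) by (rule prob_space_noise)
  have "{z \<in> space (noise n \<sigma>). \<exists>w\<in>W. E w (chan_out n x z)}
      = (\<Union>w\<in>W. {z \<in> space (noise n \<sigma>). E w (chan_out n x z)})" for x
    by auto
  then show ?thesis
    unfolding out_prob_def using assms
    by simp (intro measure_UNION_le, auto intro!: out_prob_event)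
qed

text \<open>The hypothesis \<open>card\<close> bounds the passing fraction of \<open>C\<close> for
  each received word separately; the bound therefore holds whatever was transmitted and whatever the
  noise level.\<close>

lemma avg_out_prob_le:
  assumes "0 < \<sigma>" "finite C" "C \<noteq> {}" and meas: "\<And>c. c \<in> C \<Longrightarrow> Measurable.pred (PiM {..<n} (\<lambda>_. borel)) (E c)"
    and card: "\<And>y. real (card {c \<in> C. E c y}) \<le> real (card C) * \<epsilon>"
  shows "avg C (\<lambda>c. out_prob loc n \<sigma> u s (E c)) \<le> \<epsilon>"
proof -
  interpret prob_space "noise n \<sigma>" using assms(1) by (rule prob_space_noise)
  let ?x = "\<lambda>i. loc (u i) (s i)"
  let ?S = "\<lambda>c. {z \<in> space (noise n \<sigma>). E c (chan_out n ?x z)}"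
  have ev: "c \<in> C \<Longrightarrow> ?S c \<in> sets (noise n \<sigma>)" for c
    using meas by (rule out_prob_event)
  then have int: "c \<in> C \<Longrightarrow> integrable (noise n \<sigma>) (indicator (?S c) :: _ \<Rightarrow> real)" for c
    by (simp add: emeasure_eq_measure)
  have "(\<Sum>c\<in>C. out_prob loc n \<sigma> u s (E c)) = (\<Sum>c\<in>C. \<integral>z. indicator (?S c) z \<partial>noise n \<sigma>)"
    unfolding out_prob_def using ev by (intro sum.cong) auto
  also have "\<dots> = (\<integral>z. (\<Sum>c\<in>C. indicator (?S c) z) \<partial>noise n \<sigma>)"
    using int by (intro Bochner_Integration.integral_sum[symmetric])
  also have "\<dots> \<le> (\<integral>z. real (card C) * \<epsilon> \<partial>noise n \<sigma>)"
  proof (rule integral_mono)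
    fix z assume z: "z \<in> space (noise n \<sigma>)"
    have "(\<Sum>c\<in>C. indicator (?S c) z) = (\<Sum>c\<in>C. if E c (chan_out n ?x z) then 1 else (0::real))"
      using z by (intro sum.cong) (auto simp: indicator_def)
    also have "\<dots> = real (card {c \<in> C. E c (chan_out n ?x z)})"
      using assms(2) by (simp add: sum.inter_filter[symmetric])
    finally show "(\<Sum>c\<in>C. indicator (?S c) z) \<le> real (card C) * \<epsilon>"
      using card by simp
  qed (use int in auto)
  finally have "(\<Sum>c\<in>C. out_prob loc n \<sigma> u s (E c)) \<le> real (card C) * \<epsilon>"
    by (simp add: prob_space)
  moreover have "0 < card C"
    using assms by (simp add: card_gt_0_iff)
  ultimately show ?thesis
    unfolding avg_def by (simp add: field_simps)
qed

text \<open>Markov's inequality by counting: the product of the ratios averages to at most 1 over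
  all words, so it exceeds \<open>exp (n * \<gamma>)\<close> on at most a fraction
  \<open>exp (- n * \<gamma>)\<close> of them.\<close>

lemma card_words_passing_le:
  fixes \<rho> :: "nat \<Rightarrow> nat \<Rightarrow> real"
  assumes pos: "\<And>i c. 0 < \<rho> i c" and le: "\<And>i. i < n \<Longrightarrow> (\<Sum>c<K. \<rho> i c) \<le> real K"
  shows "real (card {c \<in> words n K. real n * \<gamma> < (\<Sum>i<n. ln (\<rho> i (c i)))}) \<le> real (card (words n K)) * exp (- (real n * \<gamma>))"
proof -
  let ?P = "\<lambda>c. real n * \<gamma> < (\<Sum>i<n. ln (\<rho> i (c i)))"
  have "real (card {c \<in> words n K. ?P c}) = (\<Sum>c\<in>words n K. if ?P c then 1 else 0)"
    using finite_words by (simp add: sum.inter_filter[symmetric])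
  also have "\<dots> \<le> (\<Sum>c\<in>words n K. exp (- (real n * \<gamma>)) * (\<Prod>i<n. \<rho> i (c i)))"
  proof (rule sum_mono)
    fix c
    have *: "exp (\<Sum>i<n. ln (\<rho> i (c i))) = (\<Prod>i<n. \<rho> i (c i))"
      using pos by (simp add: exp_sum)
    show "(if ?P c then 1 else 0) \<le> exp (- (real n * \<gamma>)) * (\<Prod>i<n. \<rho> i (c i))"
    proof (cases "?P c")
      case True
      then have "exp 0 \<le> exp (- (real n * \<gamma>) + (\<Sum>i<n. ln (\<rho> i (c i))))"
        unfolding exp_le_cancel_iff by linarith
      then show ?thesis
        unfolding exp_add * using True by simp
    next
      case False
      have "0 \<le> (\<Prod>i<n. \<rho> i (c i))"
        using pos by (intro prod_nonneg) (auto intro: less_imp_le)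
      then show ?thesis
        using False by simp
    qed
  qed
  also have "\<dots> = exp (- (real n * \<gamma>)) * (\<Prod>i<n. \<Sum>c<K. \<rho> i c)"
    by (subst prod_sum_PiE) (auto simp: sum_distrib_left)
  also have "\<dots> \<le> exp (- (real n * \<gamma>)) * (\<Prod>i<n. real K)"
    using pos le by (intro mult_left_mono prod_mono) (auto intro!: sum_nonneg simp: less_imp_le)
  also have "\<dots> = real (card (words n K)) * exp (- (real n * \<gamma>))"
    by (simp add: card_PiE)
  finally show ?thesis .
qed

lemma nn_integral_normal_shift:
  assumes [measurable]: "g \<in> borel_measurable borel"
  shows "(\<integral>\<^sup>+z. g (x + z) \<partial>density lborel (normal_density 0 \<sigma>)) = (\<integral>\<^sup>+y. ennreal (normal_density x \<sigma> y) * g y \<partial>lborel)"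
proof -
  have "(\<integral>\<^sup>+y. ennreal (normal_density x \<sigma> y) * g y \<partial>lborel)
      = ennreal \<bar>1\<bar> * (\<integral>\<^sup>+z. ennreal (normal_density x \<sigma> (x + 1 * z)) * g (x + 1 * z) \<partial>lborel)"
    by (intro nn_integral_real_affine) auto
  also have "\<dots> = (\<integral>\<^sup>+z. ennreal (normal_density 0 \<sigma> z) * g (x + z) \<partial>lborel)"
    by (simp add: normal_density_def)
  finally show ?thesis
    by (simp add: nn_integral_density)
qed

text \<open>Chernoff's bound: the indicator of failure is at most the exponential of
  \<open>t\<close> times the shortfall, and this factorises over the independent noise
  coordinates.\<close>

lemma out_prob_not_test_le:
  assumes \<sigma>: "0 < \<sigma>" and t: "0 < t" and [measurable]: "\<And>u s. r u s \<in> borel_measurable borel"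
    and int: "\<And>i. i < n \<Longrightarrow> integrable lborel (\<lambda>y. normal_density (loc (u i) (s i)) \<sigma> y * exp (- t * ln (r (u i) (s i) y)))"
  shows "out_prob loc n \<sigma> u s (\<lambda>y. \<not> test n \<gamma> r u s y)
    \<le> (\<Prod>i<n. exp (t * \<gamma>) * (\<integral>y. normal_density (loc (u i) (s i)) \<sigma> y * exp (- t * ln (r (u i) (s i) y)) \<partial>lborel))"
proof -
  interpret prob_space "noise n \<sigma>" using \<sigma> by (rule prob_space_noise)
  let ?N = "density lborel (normal_density 0 \<sigma>)"
  interpret P: product_sigma_finite "\<lambda>_::nat. ?N"
    using prob_space_normal_density[OF \<sigma>, of 0]
    by (simp add: product_sigma_finite_def prob_space_imp_sigma_finite)
  define g where "g i y = exp (t * \<gamma>) * exp (- t * ln (r (u i) (s i) y))" for i y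
  have [measurable]: "g i \<in> borel_measurable borel" for i
    unfolding g_def by measurable
  let ?x = "\<lambda>i. loc (u i) (s i)"
  let ?S = "{z \<in> space (noise n \<sigma>). \<not> test n \<gamma> r u s (chan_out n ?x z)}"
  have S: "?S \<in> sets (noise n \<sigma>)"
    by (rule out_prob_event) measurable
  have "emeasure (noise n \<sigma>) ?S = (\<integral>\<^sup>+z. indicator ?S z \<partial>noise n \<sigma>)"
    using S by simp
  also have "\<dots> \<le> (\<integral>\<^sup>+z. (\<Prod>i<n. ennreal (g i (?x i + z i))) \<partial>noise n \<sigma>)"
  proof (rule nn_integral_mono)
    fix z
    have prod: "(\<Prod>i<n. ennreal (g i (?x i + z i))) = ennreal (\<Prod>i<n. g i (?x i + z i))"
      by (intro prod_ennreal) (simp add: g_def)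
    show "indicator ?S z \<le> (\<Prod>i<n. ennreal (g i (?x i + z i)))"
    proof (cases "z \<in> ?S")
      case True
      have "(\<Sum>i<n. ln (r (u i) (s i) (chan_out n ?x z i))) = (\<Sum>i<n. ln (r (u i) (s i) (?x i + z i)))"
        by (intro sum.cong) (auto simp: chan_out_def)
      with True have "(\<Sum>i<n. ln (r (u i) (s i) (?x i + z i))) \<le> real n * \<gamma>"
        by (simp add: test_def)
      then have "0 \<le> t * (real n * \<gamma> - (\<Sum>i<n. ln (r (u i) (s i) (?x i + z i))))"
        using t by simp
      also have "\<dots> = (\<Sum>i<n. t * \<gamma> + - t * ln (r (u i) (s i) (?x i + z i)))"
        by (simp add: sum_subtractf sum_distrib_left right_diff_distrib)
      finally have "exp 0 \<le> exp (\<Sum>i<n. t * \<gamma> + - t * ln (r (u i) (s i) (?x i + z i)))"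
        unfolding exp_le_cancel_iff .
      also have "\<dots> = (\<Prod>i<n. g i (?x i + z i))"
        unfolding exp_sum[OF finite_lessThan] exp_add g_def ..
      finally show ?thesis
        unfolding prod using True by (simp add: ennreal_ge_1)
    qed simp
  qed
  also have "\<dots> = (\<Prod>i<n. \<integral>\<^sup>+z. ennreal (g i (?x i + z)) \<partial>?N)"
    unfolding noise_def by (intro P.product_nn_integral_prod) auto
  also have "\<dots> = (\<Prod>i<n. ennreal (exp (t * \<gamma>) * (\<integral>y. normal_density (?x i) \<sigma> y * exp (- t * ln (r (u i) (s i) y)) \<partial>lborel)))"
  proof (rule prod.cong[OF refl])
    fix i assume i: "i \<in> {..<n}"
    have "(\<integral>\<^sup>+z. ennreal (g i (?x i + z)) \<partial>?N) = (\<integral>\<^sup>+y. ennreal (normal_density (?x i) \<sigma> y) * ennreal (g i y) \<partial>lborel)"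
      by (rule nn_integral_normal_shift) simp
    also have "\<dots> = (\<integral>\<^sup>+y. ennreal (exp (t * \<gamma>) * (normal_density (?x i) \<sigma> y * exp (- t * ln (r (u i) (s i) y)))) \<partial>lborel)"
      by (intro nn_integral_cong) (simp add: g_def ennreal_mult'[symmetric] mult_ac)
    also have "\<dots> = ennreal (\<integral>y. exp (t * \<gamma>) * (normal_density (?x i) \<sigma> y * exp (- t * ln (r (u i) (s i) y))) \<partial>lborel)"
      using int i by (intro nn_integral_eq_integral) auto
    finally show "(\<integral>\<^sup>+z. ennreal (g i (?x i + z)) \<partial>?N)
        = ennreal (exp (t * \<gamma>) * (\<integral>y. normal_density (?x i) \<sigma> y * exp (- t * ln (r (u i) (s i) y)) \<partial>lborel))"
      by simp
  qed
  also have "\<dots> = ennreal (\<Prod>i<n. exp (t * \<gamma>) * (\<integral>y. normal_density (?x i) \<sigma> y * exp (- t * ln (r (u i) (s i) y)) \<partial>lborel))"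
    by (intro prod_ennreal mult_nonneg_nonneg integral_nonneg_AE) auto
  finally show ?thesis
    unfolding out_prob_def emeasure_eq_measure
    by (subst (asm) ennreal_le_iff) (auto intro!: prod_nonneg mult_nonneg_nonneg integral_nonneg_AE)
qed

text \<open>The Chernoff bound is averaged over the codewords as well as over the noise, so
  independence of the letters turns it into the \<open>n\<close>-th power of one number. The
  integrability of density over \<open>r\<close> is the exponential moment at \<open>t = 1\<close>
  needed to dominate smaller \<open>t\<close>.\<close>

lemma miss_exponent:
  fixes r :: "nat \<Rightarrow> nat \<Rightarrow> real \<Rightarrow> real"
  assumes K: "0 < K1" "0 < K2" and \<sigma>: "0 < \<sigma>" and [measurable]: "\<And>u s. r u s \<in> borel_measurable borel"
    and rpos: "\<And>u s y. 0 < r u s y"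
    and int1: "\<And>u s. u < K2 \<Longrightarrow> s < K1 \<Longrightarrow> integrable lborel (\<lambda>y. normal_density (loc u s) \<sigma> y * ln (r u s y))"
    and int2: "\<And>u s. u < K2 \<Longrightarrow> s < K1 \<Longrightarrow> integrable lborel (\<lambda>y. normal_density (loc u s) \<sigma> y / r u s y)"
    and \<gamma>: "\<gamma> < avg {..<K2} (\<lambda>u. avg {..<K1} (\<lambda>s. \<integral>y. normal_density (loc u s) \<sigma> y * ln (r u s y) \<partial>lborel))"
  shows "\<exists>\<theta>. 0 \<le> \<theta> \<and> \<theta> < 1 \<and> (\<forall>n. avg (words n K2) (\<lambda>u. avg (words n K1)
    (\<lambda>s. out_prob loc n \<sigma> u s (\<lambda>y. \<not> test n \<gamma> r u s y))) \<le> \<theta> ^ n)"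
proof -
  let ?p = "\<lambda>u s. normal_density (loc u s) \<sigma>"
  let ?J = "\<lambda>f. avg {..<K2} (\<lambda>u. avg {..<K1} (f u))"
  have rexp: "exp (- ln (r u s y)) = 1 / r u s y" for u s y
    using rpos by (simp add: exp_minus inverse_eq_divide)
  have "(\<lambda>n. ?J (\<lambda>u s. \<integral>y. ?p u s y * ((1 - exp (- ln (r u s y) / real (Suc n))) * real (Suc n)) \<partial>lborel))
      \<longlonglongrightarrow> ?J (\<lambda>u s. \<integral>y. ?p u s y * ln (r u s y) \<partial>lborel)"
    unfolding avg_def
  proof (intro tendsto_divide tendsto_sum tendsto_const)
    fix u s assume "u \<in> {..<K2}" "s \<in> {..<K1}"
    then show "(\<lambda>n. \<integral>y. ?p u s y * ((1 - exp (- ln (r u s y) / real (Suc n))) * real (Suc n)) \<partial>lborel)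
      \<longlonglongrightarrow> (\<integral>y. ?p u s y * ln (r u s y) \<partial>lborel)"
      using \<sigma> int1 int2 by (intro chernoff_tendsto) (auto simp: rexp)
  qed (use K in auto)
  from order_tendstoD(1)[OF this \<gamma>] obtain n where
    n: "\<gamma> < ?J (\<lambda>u s. \<integral>y. ?p u s y * ((1 - exp (- ln (r u s y) / real (Suc n))) * real (Suc n)) \<partial>lborel)"
    by (auto simp: eventually_sequentially)
  \<comment> \<open>The limit above makes the averaged difference quotient exceed \<gamma> already
    at this finite \<open>t\<close>, which is then kept for all block lengths.\<close>
  define t where "t = 1 / real (Suc n)"
  have t: "0 < t" "t \<le> 1"
    by (auto simp: t_def)
  define c where "c u s = (\<integral>y. ?p u s y * exp (- t * ln (r u s y)) \<partial>lborel)" for u s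
  have int3: "integrable lborel (\<lambda>y. ?p u s y * exp (- t * ln (r u s y)))" if us: "u < K2" "s < K1" for u s
  proof (rule Bochner_Integration.integrable_bound[of _ "\<lambda>y. ?p u s y + ?p u s y / r u s y"])
    show "AE y in lborel. norm (?p u s y * exp (- t * ln (r u s y))) \<le> norm (?p u s y + ?p u s y / r u s y)"
    proof (intro AE_I2)
      fix y
      have "exp (- t * ln (r u s y)) \<le> 1 + exp (- ln (r u s y))"
      proof (cases "0 \<le> ln (r u s y)")
        case True
        then have "exp (- t * ln (r u s y)) \<le> 1"
          using t by simp
        then show ?thesis
          by (simp add: add_increasing2)
      next
        case False
        then have "t * (- ln (r u s y)) \<le> 1 * (- ln (r u s y))"
          using t by (intro mult_right_mono) auto
        then have "exp (- t * ln (r u s y)) \<le> exp (- ln (r u s y))"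
          by simp
        then show ?thesis by linarith
      qed
      then have "?p u s y * exp (- t * ln (r u s y)) \<le> ?p u s y * (1 + 1 / r u s y)"
        unfolding rexp by (intro mult_left_mono) auto
      then show "norm (?p u s y * exp (- t * ln (r u s y))) \<le> norm (?p u s y + ?p u s y / r u s y)"
        using rpos[of u s y] by (simp add: distrib_left)
    qed
  qed (use \<sigma> int2 us in auto)
  have "?J (\<lambda>u s. \<integral>y. ?p u s y * ((1 - exp (- ln (r u s y) / real (Suc n))) * real (Suc n)) \<partial>lborel)
      = ?J (\<lambda>u s. (1 - c u s) / t)"
  proof (intro avg_cong)
    fix u s assume us: "u \<in> {..<K2}" "s \<in> {..<K1}"
    have "(\<integral>y. ?p u s y * ((1 - exp (- ln (r u s y) / real (Suc n))) * real (Suc n)) \<partial>lborel)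
        = (\<integral>y. (?p u s y - ?p u s y * exp (- t * ln (r u s y))) / t \<partial>lborel)"
      by (intro Bochner_Integration.integral_cong refl) (simp add: t_def right_diff_distrib)
    then show "(\<integral>y. ?p u s y * ((1 - exp (- ln (r u s y) / real (Suc n))) * real (Suc n)) \<partial>lborel) = (1 - c u s) / t"
      using int3 us \<sigma> by (simp add: c_def)
  qed
  also have "\<dots> = (1 - ?J c) / t"
  proof -
    have ne: "{..<K1} \<noteq> {}" "{..<K2} \<noteq> {}"
      using K by auto
    show ?thesis
      by (simp only: avg_divide avg_diff avg_const[OF finite_lessThan ne(1)] avg_const[OF finite_lessThan ne(2)])
  qed
  finally have "\<gamma> < (1 - ?J c) / t"
    using n by (simp only:)
  \<comment> \<open>Since 1 - t\<gamma> is at most exp (-t\<gamma>), the averaged moment times exp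
    (t\<gamma>) is below 1; this product is the base \<theta>.\<close>
  then have "t * \<gamma> < 1 - ?J c"
    using t by (simp only: pos_less_divide_eq mult.commute)
  then have Jc: "?J c < 1 - t * \<gamma>" by linarith
  also have "1 - t * \<gamma> \<le> exp (- (t * \<gamma>))"
    using exp_ge_add_one_self[of "- (t * \<gamma>)"] by simp
  finally have "exp (t * \<gamma>) * ?J c < exp (t * \<gamma>) * exp (- (t * \<gamma>))"
    by (intro mult_strict_left_mono) auto
  then have lt: "exp (t * \<gamma>) * ?J c < 1"
    by (simp add: exp_minus)
  have c0: "0 \<le> c u s" for u s
    unfolding c_def by (intro integral_nonneg_AE) auto
  have nn: "0 \<le> exp (t * \<gamma>) * ?J c"
    unfolding avg_def using c0 by (intro mult_nonneg_nonneg divide_nonneg_nonneg sum_nonneg) auto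
  have "avg (words n K2) (\<lambda>u. avg (words n K1) (\<lambda>s. out_prob loc n \<sigma> u s (\<lambda>y. \<not> test n \<gamma> r u s y)))
      \<le> (exp (t * \<gamma>) * ?J c) ^ n" for n
  proof -
    have "avg (words n K2) (\<lambda>u. avg (words n K1) (\<lambda>s. out_prob loc n \<sigma> u s (\<lambda>y. \<not> test n \<gamma> r u s y)))
        \<le> avg (words n K2) (\<lambda>u. avg (words n K1) (\<lambda>s. \<Prod>i<n. exp (t * \<gamma>) * c (u i) (s i)))"
      unfolding c_def using \<sigma> t by (intro avg_mono out_prob_not_test_le int3) (auto simp: PiE_iff)
    also have "\<dots> = avg (words n K2) (\<lambda>u. \<Prod>i<n. avg {..<K1} (\<lambda>s. exp (t * \<gamma>) * c (u i) s))"
      by (intro avg_cong avg_words_prod)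
    also have "\<dots> = (\<Prod>i<n. ?J (\<lambda>u s. exp (t * \<gamma>) * c u s))"
      by (rule avg_words_prod)
    also have "\<dots> = (exp (t * \<gamma>) * ?J c) ^ n"
      by (simp only: avg_cmult prod_constant card_lessThan)
    finally show ?thesis .
  qed
  then show ?thesis
    using lt nn by blast
qed

lemma test_cloud_indep: "test n \<gamma> (\<lambda>u _. r u) u s = test n \<gamma> (\<lambda>u _. r u) u s'"
  by (simp add: test_def fun_eq_iff)

text \<open>Random coding with a cloud book \<open>U\<close> indexed by the second message and a
  satellite book \<open>S\<close> indexed by the first. Receiver 1 looks for a \<open>w1\<close> for
  which some cloud passes both tests, receiver 2 uses the cloud test alone. The two error averages
  are bounded together, which yields one code good for both.\<close>

lemma superposition_code_exists:
  fixes loc :: "nat \<Rightarrow> nat \<Rightarrow> real" and rU1 rU2 :: "nat \<Rightarrow> real \<Rightarrow> real" and rS :: "nat \<Rightarrow> nat \<Rightarrow> real \<Rightarrow> real"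
  assumes K: "0 < K1" "0 < K2" and M: "0 < M1" "0 < M2" and \<sigma>: "0 < \<sigma>1" "0 < \<sigma>2"
    and meas: "\<And>u. rU1 u \<in> borel_measurable borel" "\<And>u. rU2 u \<in> borel_measurable borel"
      "\<And>u s. rS u s \<in> borel_measurable borel"
    and pos: "\<And>u y. 0 < rU1 u y" "\<And>u y. 0 < rU2 u y" "\<And>u s y. 0 < rS u s y"
    and sums: "\<And>y. (\<Sum>u<K2. rU1 u y) \<le> real K2" "\<And>y. (\<Sum>u<K2. rU2 u y) \<le> real K2"
      "\<And>u y. (\<Sum>s<K1. rS u s y) \<le> real K1"
    and miss1: "avg (words n K2) (\<lambda>u. avg (words n K1)
        (\<lambda>s. out_prob loc n \<sigma>1 u s (\<lambda>y. \<not> test n \<gamma>2 (\<lambda>u _. rU1 u) u s y))) \<le> a1"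
    and miss2: "avg (words n K2) (\<lambda>u. avg (words n K1)
        (\<lambda>s. out_prob loc n \<sigma>1 u s (\<lambda>y. \<not> test n \<gamma>1 rS u s y))) \<le> a2"
    and miss3: "avg (words n K2) (\<lambda>u. avg (words n K1)
        (\<lambda>s. out_prob loc n \<sigma>2 u s (\<lambda>y. \<not> test n \<gamma>2 (\<lambda>u _. rU2 u) u s y))) \<le> a3"
  shows "\<exists>enc dec1 dec2. (\<forall>w1 w2 i. w1 < M1 \<longrightarrow> w2 < M2 \<longrightarrow> i < n \<longrightarrow> (\<exists>u<K2. \<exists>s<K1. enc w1 w2 i = loc u s))
    \<and> dec1 \<in> measurable (PiM {..<n} (\<lambda>_. borel)) (count_space UNIV)
    \<and> dec2 \<in> measurable (PiM {..<n} (\<lambda>_. borel)) (count_space UNIV)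
    \<and> avg_err n \<sigma>1 M1 M2 enc dec1 (\<lambda>w1 w2. w1) + avg_err n \<sigma>2 M1 M2 enc dec2 (\<lambda>w1 w2. w2)
      \<le> (a1 + a2 + real M2 * exp (- (real n * \<gamma>2)) + real M1 * exp (- (real n * \<gamma>1)))
        + (a3 + real M2 * exp (- (real n * \<gamma>2)))"
proof -
  \<comment> \<open>The cloud tests ignore the satellite word, so a dummy one is inserted.\<close>
  define a where "a u = test n \<gamma>2 (\<lambda>u _. rU1 u) u (\<lambda>_. 0)" for u
  define b where "b = test n \<gamma>1 rS"
  define c where "c u = test n \<gamma>2 (\<lambda>u _. rU2 u) u (\<lambda>_. 0)" for u
  have a_eq: "test n \<gamma>2 (\<lambda>u _. rU1 u) u s = a u" and c_eq: "test n \<gamma>2 (\<lambda>u _. rU2 u) u s = c u" for u s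
    unfolding a_def c_def by (rule test_cloud_indep)+
  let ?Y = "PiM {..<n} (\<lambda>_. borel) :: (nat \<Rightarrow> real) measure"
  have [measurable]: "Measurable.pred ?Y (a u)" "Measurable.pred ?Y (b u s)" "Measurable.pred ?Y (c u)" for u s
    unfolding a_def b_def c_def using meas by auto
  let ?Wu = "words n K2" and ?Ws = "words n K1"
  have fin: "finite ?Wu" "?Wu \<noteq> {}" "finite ?Ws" "?Ws \<noteq> {}"
    using finite_words words_nonempty K by auto
  define CU where "CU = {..<M2} \<rightarrow>\<^sub>E ?Wu"
  define CS where "CS = {..<M1} \<rightarrow>\<^sub>E ?Ws"
  have finC: "finite CU" "CU \<noteq> {}" "finite CS" "CS \<noteq> {}"
    using fin by (auto simp: CU_def CS_def PiE_eq_empty_iff intro!: finite_PiE)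
  \<comment> \<open>If no message qualifies, \<open>LEAST\<close> returns some number; this does no
    harm, as the true message then fails a test and the case is already counted as an error.\<close>
  define D1 where "D1 U S y = (LEAST w1. w1 < M1 \<and> (\<exists>w2\<in>{..<M2}. a (U w2) y \<and> b (U w2) (S w1) y))" for U S y
  define D2 where "D2 U y = (LEAST w2. w2 < M2 \<and> c (U w2) y)" for U y
  have [measurable]: "D1 U S \<in> measurable ?Y (count_space UNIV)" "D2 U \<in> measurable ?Y (count_space UNIV)" for U S
    unfolding D1_def D2_def by measurable
  let ?P1 = "out_prob loc n \<sigma>1" and ?P2 = "out_prob loc n \<sigma>2"
  let ?\<epsilon>1 = "exp (- (real n * \<gamma>1))" and ?\<epsilon>2 = "exp (- (real n * \<gamma>2))"

  \<comment> \<open>Four ways to fail: the true cloud or the true satellite is rejected, a wrong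
    cloud passes its own test, or a wrong satellite passes with the true cloud. A wrong cloud paired
    with any satellite is covered by the third.\<close>
  have err1: "?P1 (U w2) (S w1) (\<lambda>y. D1 U S y \<noteq> w1) \<le> ?P1 (U w2) (S w1) (\<lambda>y. \<not> a (U w2) y)
      + ?P1 (U w2) (S w1) (\<lambda>y. \<not> b (U w2) (S w1) y)
      + (\<Sum>v\<in>{..<M2} - {w2}. ?P1 (U w2) (S w1) (a (U v)))
      + (\<Sum>v\<in>{..<M1} - {w1}. ?P1 (U w2) (S w1) (b (U w2) (S v)))" if w: "w1 < M1" "w2 < M2" for U S w1 w2
  proof -
    have "?P1 (U w2) (S w1) (\<lambda>y. D1 U S y \<noteq> w1) \<le> ?P1 (U w2) (S w1) (\<lambda>y. ((\<not> a (U w2) y \<or> \<not> b (U w2) (S w1) y)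
        \<or> (\<exists>v\<in>{..<M2} - {w2}. a (U v) y)) \<or> (\<exists>v\<in>{..<M1} - {w1}. b (U w2) (S v) y))"
    proof (rule out_prob_mono[OF \<sigma>(1)])
      fix y assume "D1 U S y \<noteq> w1"
      then show "((\<not> a (U w2) y \<or> \<not> b (U w2) (S w1) y)
        \<or> (\<exists>v\<in>{..<M2} - {w2}. a (U v) y)) \<or> (\<exists>v\<in>{..<M1} - {w1}. b (U w2) (S v) y)"
      proof (rule contrapos_np)
        assume *: "\<not> ?thesis"
        show "D1 U S y = w1"
          unfolding D1_def
        proof (rule Least_equality)
          show "w1 < M1 \<and> (\<exists>w2\<in>{..<M2}. a (U w2) y \<and> b (U w2) (S w1) y)"
            using * w by auto
          fix v assume "v < M1 \<and> (\<exists>w2\<in>{..<M2}. a (U w2) y \<and> b (U w2) (S v) y)"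
          then show "w1 \<le> v"
            using * by (metis DiffI eq_iff lessThan_iff singletonD)
        qed
      qed
    qed measurable
    also have "\<dots> \<le> ?P1 (U w2) (S w1) (\<lambda>y. (\<not> a (U w2) y \<or> \<not> b (U w2) (S w1) y) \<or> (\<exists>v\<in>{..<M2} - {w2}. a (U v) y))
        + ?P1 (U w2) (S w1) (\<lambda>y. \<exists>v\<in>{..<M1} - {w1}. b (U w2) (S v) y)"
      by (rule out_prob_disj[OF \<sigma>(1)]) measurable
    also have "?P1 (U w2) (S w1) (\<lambda>y. (\<not> a (U w2) y \<or> \<not> b (U w2) (S w1) y) \<or> (\<exists>v\<in>{..<M2} - {w2}. a (U v) y))
        \<le> ?P1 (U w2) (S w1) (\<lambda>y. \<not> a (U w2) y \<or> \<not> b (U w2) (S w1) y) + ?P1 (U w2) (S w1) (\<lambda>y. \<exists>v\<in>{..<M2} - {w2}. a (U v) y)"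
      by (rule out_prob_disj[OF \<sigma>(1)]) measurable
    also have "?P1 (U w2) (S w1) (\<lambda>y. \<not> a (U w2) y \<or> \<not> b (U w2) (S w1) y)
        \<le> ?P1 (U w2) (S w1) (\<lambda>y. \<not> a (U w2) y) + ?P1 (U w2) (S w1) (\<lambda>y. \<not> b (U w2) (S w1) y)"
      by (rule out_prob_disj[OF \<sigma>(1)]) measurable
    also have "?P1 (U w2) (S w1) (\<lambda>y. \<exists>v\<in>{..<M2} - {w2}. a (U v) y) \<le> (\<Sum>v\<in>{..<M2} - {w2}. ?P1 (U w2) (S w1) (a (U v)))"
      by (rule out_prob_bex[OF \<sigma>(1)]) auto
    also have "?P1 (U w2) (S w1) (\<lambda>y. \<exists>v\<in>{..<M1} - {w1}. b (U w2) (S v) y) \<le> (\<Sum>v\<in>{..<M1} - {w1}. ?P1 (U w2) (S w1) (b (U w2) (S v)))"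
      by (rule out_prob_bex[OF \<sigma>(1)]) auto
    finally show ?thesis by simp
  qed
  have err2: "?P2 (U w2) (S w1) (\<lambda>y. D2 U y \<noteq> w2) \<le> ?P2 (U w2) (S w1) (\<lambda>y. \<not> c (U w2) y)
      + (\<Sum>v\<in>{..<M2} - {w2}. ?P2 (U w2) (S w1) (c (U v)))" if w: "w2 < M2" for U S w1 w2
  proof -
    have "?P2 (U w2) (S w1) (\<lambda>y. D2 U y \<noteq> w2) \<le> ?P2 (U w2) (S w1) (\<lambda>y. \<not> c (U w2) y \<or> (\<exists>v\<in>{..<M2} - {w2}. c (U v) y))"
    proof (rule out_prob_mono[OF \<sigma>(2)])
      fix y assume "D2 U y \<noteq> w2"
      then show "\<not> c (U w2) y \<or> (\<exists>v\<in>{..<M2} - {w2}. c (U v) y)"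
      proof (rule contrapos_np)
        assume *: "\<not> ?thesis"
        show "D2 U y = w2"
          unfolding D2_def by (rule Least_equality) (use * w in auto)
      qed
    qed measurable
    also have "\<dots> \<le> ?P2 (U w2) (S w1) (\<lambda>y. \<not> c (U w2) y) + ?P2 (U w2) (S w1) (\<lambda>y. \<exists>v\<in>{..<M2} - {w2}. c (U v) y)"
      by (rule out_prob_disj[OF \<sigma>(2)]) measurable
    also have "?P2 (U w2) (S w1) (\<lambda>y. \<exists>v\<in>{..<M2} - {w2}. c (U v) y) \<le> (\<Sum>v\<in>{..<M2} - {w2}. ?P2 (U w2) (S w1) (c (U v)))"
      by (rule out_prob_bex[OF \<sigma>(2)]) auto
    finally show ?thesis by simp
  qed

  let ?A = "\<lambda>f. avg CU (\<lambda>U. avg CS (f U))"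
  have A_mono: "?A f \<le> ?A g" if "\<And>U S. U \<in> CU \<Longrightarrow> S \<in> CS \<Longrightarrow> f U S \<le> g U S" for f g :: "_ \<Rightarrow> _ \<Rightarrow> real"
    using that by (intro avg_mono) auto
  have A_us: "?A (\<lambda>U S. g (U w2) (S w1)) = avg ?Wu (\<lambda>u. avg ?Ws (g u))" if "w1 < M1" "w2 < M2" for g w1 w2
  proof -
    have "?A (\<lambda>U S. g (U w2) (S w1)) = avg CU (\<lambda>U. avg ?Ws (g (U w2)))"
      unfolding CS_def using fin that by (intro avg_cong avg_PiE_single) auto
    also have "\<dots> = avg ?Wu (\<lambda>u. avg ?Ws (g u))"
      unfolding CU_def using fin that by (intro avg_PiE_single) auto
    finally show ?thesis .
  qed
  \<comment> \<open>A wrong codeword is independent of the transmitted pair, so the false-alarm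
    bound can be averaged over it first, with the transmitted pair held fixed; \<open>A_uss\<close>
    is the analogue for satellites.\<close>
  have A_uus: "?A (\<lambda>U S. g (U w2) (U v) (S w1)) \<le> \<epsilon>"
    if "w1 < M1" "w2 < M2" "v < M2" "v \<noteq> w2" and g: "\<And>u s. avg ?Wu (\<lambda>u'. g u u' s) \<le> \<epsilon>" for g w1 w2 v \<epsilon>
  proof -
    have "?A (\<lambda>U S. g (U w2) (U v) (S w1)) = avg CU (\<lambda>U. avg ?Ws (g (U w2) (U v)))"
      unfolding CS_def using fin that by (intro avg_cong avg_PiE_single) auto
    also have "\<dots> = avg ?Wu (\<lambda>u. avg ?Wu (\<lambda>u'. avg ?Ws (g u u')))"
      unfolding CU_def using fin that by (intro avg_PiE_pair) auto
    also have "\<dots> = avg ?Wu (\<lambda>u. avg ?Ws (\<lambda>s. avg ?Wu (\<lambda>u'. g u u' s)))"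
      by (intro avg_cong avg_swap)
    also have "\<dots> \<le> \<epsilon>"
      by (rule avg_le_const[OF fin(1,2)], rule avg_le_const[OF fin(3,4)], rule g)
    finally show ?thesis .
  qed
  have A_uss: "?A (\<lambda>U S. g (U w2) (S w1) (S v)) \<le> \<epsilon>"
    if "w1 < M1" "w2 < M2" "v < M1" "v \<noteq> w1" and g: "\<And>u s. avg ?Ws (g u s) \<le> \<epsilon>" for g w1 w2 v \<epsilon>
  proof -
    have "?A (\<lambda>U S. g (U w2) (S w1) (S v)) = avg CU (\<lambda>U. avg ?Ws (\<lambda>s. avg ?Ws (g (U w2) s)))"
      unfolding CS_def using fin that by (intro avg_cong avg_PiE_pair) auto
    also have "\<dots> \<le> \<epsilon>"
      by (rule avg_le_const[OF finC(1,2)], rule avg_le_const[OF fin(3,4)], rule g)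
    finally show ?thesis .
  qed
  have fa_a: "avg ?Wu (\<lambda>u'. ?P1 u s (a u')) \<le> ?\<epsilon>2" for u s
  proof (rule avg_out_prob_le[OF \<sigma>(1) fin(1,2)])
    show "real (card {u \<in> ?Wu. a u y}) \<le> real (card ?Wu) * ?\<epsilon>2" for y
      unfolding a_def test_def using pos sums by (intro card_words_passing_le) auto
  qed simp
  have fa_c: "avg ?Wu (\<lambda>u'. ?P2 u s (c u')) \<le> ?\<epsilon>2" for u s
  proof (rule avg_out_prob_le[OF \<sigma>(2) fin(1,2)])
    show "real (card {u \<in> ?Wu. c u y}) \<le> real (card ?Wu) * ?\<epsilon>2" for y
      unfolding c_def test_def using pos sums by (intro card_words_passing_le) auto
  qed simp
  have fa_b: "avg ?Ws (\<lambda>s'. ?P1 u s (b u s')) \<le> ?\<epsilon>1" for u s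
  proof (rule avg_out_prob_le[OF \<sigma>(1) fin(3,4)])
    show "real (card {s \<in> ?Ws. b u s y}) \<le> real (card ?Ws) * ?\<epsilon>1" for y
      unfolding b_def test_def using pos sums by (intro card_words_passing_le) auto
  qed simp
  have count: "(\<Sum>v\<in>{..<m} - {w}. f v) \<le> real m * \<epsilon>" if "0 \<le> \<epsilon>" "\<And>v. v < m \<Longrightarrow> v \<noteq> w \<Longrightarrow> f v \<le> \<epsilon>"
    for m w :: nat and f :: "nat \<Rightarrow> real" and \<epsilon>
  proof -
    have "(\<Sum>v\<in>{..<m} - {w}. f v) \<le> real (card ({..<m} - {w})) * \<epsilon>"
      using that by (intro sum_bounded_above) auto
    also have "\<dots> \<le> real m * \<epsilon>"
      using that(1) card_mono[of "{..<m}" "{..<m} - {w}"] by (intro mult_right_mono) auto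
    finally show ?thesis .
  qed
  define \<beta>1 where "\<beta>1 = a1 + a2 + real M2 * ?\<epsilon>2 + real M1 * ?\<epsilon>1"
  define \<beta>2 where "\<beta>2 = a3 + real M2 * ?\<epsilon>2"
  have A1: "?A (\<lambda>U S. ?P1 (U w2) (S w1) (\<lambda>y. D1 U S y \<noteq> w1)) \<le> \<beta>1" if w: "w1 < M1" "w2 < M2" for w1 w2
  proof -
    have "?A (\<lambda>U S. ?P1 (U w2) (S w1) (\<lambda>y. D1 U S y \<noteq> w1))
      \<le> ?A (\<lambda>U S. ?P1 (U w2) (S w1) (\<lambda>y. \<not> a (U w2) y)
      + ?P1 (U w2) (S w1) (\<lambda>y. \<not> b (U w2) (S w1) y)
      + (\<Sum>v\<in>{..<M2} - {w2}. ?P1 (U w2) (S w1) (a (U v)))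
      + (\<Sum>v\<in>{..<M1} - {w1}. ?P1 (U w2) (S w1) (b (U w2) (S v))))"
      by (intro A_mono err1 w)
    also have "\<dots> = ?A (\<lambda>U S. ?P1 (U w2) (S w1) (\<lambda>y. \<not> a (U w2) y))
      + ?A (\<lambda>U S. ?P1 (U w2) (S w1) (\<lambda>y. \<not> b (U w2) (S w1) y))
      + (\<Sum>v\<in>{..<M2} - {w2}. ?A (\<lambda>U S. ?P1 (U w2) (S w1) (a (U v))))
      + (\<Sum>v\<in>{..<M1} - {w1}. ?A (\<lambda>U S. ?P1 (U w2) (S w1) (b (U w2) (S v))))"
      by (simp only: avg_add avg_sum)
    also have "\<dots> \<le> a1 + a2 + real M2 * ?\<epsilon>2 + real M1 * ?\<epsilon>1"
    proof (intro add_mono)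
      show "?A (\<lambda>U S. ?P1 (U w2) (S w1) (\<lambda>y. \<not> a (U w2) y)) \<le> a1"
        using A_us[OF w, of "\<lambda>u s. ?P1 u s (\<lambda>y. \<not> a u y)"] miss1 by (simp add: a_eq)
      show "?A (\<lambda>U S. ?P1 (U w2) (S w1) (\<lambda>y. \<not> b (U w2) (S w1) y)) \<le> a2"
        using A_us[OF w, of "\<lambda>u s. ?P1 u s (\<lambda>y. \<not> b u s y)"] miss2 by (simp add: b_def)
      show "(\<Sum>v\<in>{..<M2} - {w2}. ?A (\<lambda>U S. ?P1 (U w2) (S w1) (a (U v)))) \<le> real M2 * ?\<epsilon>2"
        by (intro count A_uus[of w1 w2 _ "\<lambda>u u' s. ?P1 u s (a u')"] w fa_a) auto
      show "(\<Sum>v\<in>{..<M1} - {w1}. ?A (\<lambda>U S. ?P1 (U w2) (S w1) (b (U w2) (S v)))) \<le> real M1 * ?\<epsilon>1"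
        by (intro count A_uss[of w1 w2 _ "\<lambda>u s s'. ?P1 u s (b u s')"] w fa_b) auto
    qed
    finally show ?thesis by (simp add: \<beta>1_def)
  qed
  have A2: "?A (\<lambda>U S. ?P2 (U w2) (S w1) (\<lambda>y. D2 U y \<noteq> w2)) \<le> \<beta>2" if w: "w1 < M1" "w2 < M2" for w1 w2
  proof -
    have "?A (\<lambda>U S. ?P2 (U w2) (S w1) (\<lambda>y. D2 U y \<noteq> w2))
      \<le> ?A (\<lambda>U S. ?P2 (U w2) (S w1) (\<lambda>y. \<not> c (U w2) y)
      + (\<Sum>v\<in>{..<M2} - {w2}. ?P2 (U w2) (S w1) (c (U v))))"
      by (intro A_mono err2 w)
    also have "\<dots> = ?A (\<lambda>U S. ?P2 (U w2) (S w1) (\<lambda>y. \<not> c (U w2) y))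
      + (\<Sum>v\<in>{..<M2} - {w2}. ?A (\<lambda>U S. ?P2 (U w2) (S w1) (c (U v))))"
      by (simp only: avg_add avg_sum)
    also have "\<dots> \<le> a3 + real M2 * ?\<epsilon>2"
    proof (intro add_mono)
      show "?A (\<lambda>U S. ?P2 (U w2) (S w1) (\<lambda>y. \<not> c (U w2) y)) \<le> a3"
        using A_us[OF w, of "\<lambda>u s. ?P2 u s (\<lambda>y. \<not> c u y)"] miss3 by (simp add: c_eq)
      show "(\<Sum>v\<in>{..<M2} - {w2}. ?A (\<lambda>U S. ?P2 (U w2) (S w1) (c (U v)))) \<le> real M2 * ?\<epsilon>2"
        by (intro count A_uus[of w1 w2 _ "\<lambda>u u' s. ?P2 u s (c u')"] w fa_c) auto
    qed
    finally show ?thesis by (simp add: \<beta>2_def)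
  qed
  define enc where "enc U S w1 w2 i = loc (U w2 i) (S w1 i)" for U S :: "nat \<Rightarrow> nat \<Rightarrow> nat" and w1 w2 i
  define e1 where "e1 U S = avg_err n \<sigma>1 M1 M2 (enc U S) (D1 U S) (\<lambda>w1 w2. w1)" for U S
  define e2 where "e2 U S = avg_err n \<sigma>2 M1 M2 (enc U S) (D2 U) (\<lambda>w1 w2. w2)" for U S
  have e1: "e1 U S = (\<Sum>w1<M1. \<Sum>w2<M2. ?P1 (U w2) (S w1) (\<lambda>y. D1 U S y \<noteq> w1)) / (real M1 * real M2)"
    and e2: "e2 U S = (\<Sum>w1<M1. \<Sum>w2<M2. ?P2 (U w2) (S w1) (\<lambda>y. D2 U y \<noteq> w2)) / (real M1 * real M2)" for U S
    unfolding e1_def e2_def avg_err_def out_prob_def enc_def by simp_all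
  have total: "(\<Sum>w1<M1. \<Sum>w2<M2. f w1 w2) / (real M1 * real M2) \<le> \<beta>"
    if "\<And>w1 w2. w1 < M1 \<Longrightarrow> w2 < M2 \<Longrightarrow> f w1 w2 \<le> \<beta>" for f :: "nat \<Rightarrow> nat \<Rightarrow> real" and \<beta>
  proof -
    have "(\<Sum>w1<M1. \<Sum>w2<M2. f w1 w2) \<le> (\<Sum>w1<M1. \<Sum>w2<M2. \<beta>)"
      using that by (intro sum_mono) auto
    then show ?thesis
      using M by (simp add: field_simps)
  qed
  have "?A e1 \<le> \<beta>1" "?A e2 \<le> \<beta>2"
    unfolding e1 e2 avg_divide avg_sum by (intro total A1 A2; assumption)+
  \<comment> \<open>Choosing codebooks by the sum of the two errors keeps both receivers under
    control with the same choice.\<close>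
  then have "?A (\<lambda>U S. e1 U S + e2 U S) \<le> \<beta>1 + \<beta>2"
    by (simp add: avg_add)
  moreover obtain U where U: "U \<in> CU" "avg CS (\<lambda>S. e1 U S + e2 U S) \<le> ?A (\<lambda>U S. e1 U S + e2 U S)"
    using exists_le_avg[OF finC(1,2), of "\<lambda>U. avg CS (\<lambda>S. e1 U S + e2 U S)"] by blast
  moreover obtain S where S: "S \<in> CS" "e1 U S + e2 U S \<le> avg CS (\<lambda>S. e1 U S + e2 U S)"
    using exists_le_avg[OF finC(3,4), of "\<lambda>S. e1 U S + e2 U S"] by blast
  ultimately have "e1 U S + e2 U S \<le> \<beta>1 + \<beta>2"
    by linarith
  moreover have "\<exists>u<K2. \<exists>s<K1. enc U S w1 w2 i = loc u s" if "w1 < M1" "w2 < M2" "i < n" for w1 w2 i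
  proof -
    have "U w2 i < K2" "S w1 i < K1"
      using U(1) S(1) that unfolding CU_def CS_def by (auto simp: PiE_iff)
    then show ?thesis
      unfolding enc_def by blast
  qed
  ultimately show ?thesis
    unfolding e1_def e2_def \<beta>1_def \<beta>2_def
    by (intro exI[of _ "enc U S"] exI[of _ "D1 U S"] exI[of _ "D2 U"]) auto
qed

section \<open>Achievability\<close>

text \<open>As \<open>R\<close> is nonnegative, 2^(nR) is at least 1 and rounding it up at most
  doubles it; the rest decays geometrically.\<close>

lemma tendsto_ceiling_rate:
  assumes "0 \<le> R" "R * ln 2 < \<gamma>"
  shows "(\<lambda>n. real (nat \<lceil>2 powr (real n * R)\<rceil>) * exp (- (real n * \<gamma>))) \<longlonglongrightarrow> 0"
proof -
  define q where "q = exp (R * ln 2 - \<gamma>)"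
  have q: "0 < q" "q < 1"
    using assms by (auto simp: q_def)
  have lim: "(\<lambda>n. 2 * q ^ n) \<longlonglongrightarrow> 0"
    using q tendsto_mult_left[OF LIMSEQ_realpow_zero[of q], of 2] by simp
  have le: "real (nat \<lceil>2 powr (real n * R)\<rceil>) * exp (- (real n * \<gamma>)) \<le> 2 * q ^ n" for n
  proof -
    have "1 \<le> (2::real) powr (real n * R)"
      using assms by (intro ge_one_powr_ge_zero) auto
    then have "real (nat \<lceil>2 powr (real n * R)\<rceil>) \<le> 2 * 2 powr (real n * R)"
      by linarith
    then have "real (nat \<lceil>2 powr (real n * R)\<rceil>) * exp (- (real n * \<gamma>)) \<le> 2 * 2 powr (real n * R) * exp (- (real n * \<gamma>))"
      by (intro mult_right_mono) auto
    also have "\<dots> = 2 * q ^ n"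
      unfolding q_def exp_of_nat_mult[symmetric] powr_def
      by (simp add: mult_exp_exp right_diff_distrib mult.assoc)
    finally show ?thesis .
  qed
  show ?thesis
    by (intro tendsto_sandwich[OF _ _ tendsto_const lim] always_eventually allI le mult_nonneg_nonneg of_nat_0_le_iff exp_ge_zero)
qed

section \<open>Information densities of the cloud and satellite letters\<close>

definition pam_point :: "nat \<Rightarrow> real \<Rightarrow> nat \<Rightarrow> nat \<Rightarrow> real" where
  "pam_point K1 L u s = real (u * K1) * L + real s * L"

text \<open>The likelihood ratio p(y|u) / p(y), whose mean logarithm is the information of the cloud
  letter; its satellite counterpart is p(y|u,s) / p(y|u).\<close>

definition cloud_ratio :: "nat \<Rightarrow> nat \<Rightarrow> real \<Rightarrow> real \<Rightarrow> nat \<Rightarrow> real \<Rightarrow> real" where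
  "cloud_ratio K1 K2 L \<sigma> u y = pam K1 L \<sigma> (real (u * K1) * L) y / pam (K1 * K2) L \<sigma> 0 y"

definition satellite_ratio :: "nat \<Rightarrow> real \<Rightarrow> real \<Rightarrow> nat \<Rightarrow> nat \<Rightarrow> real \<Rightarrow> real" where
  "satellite_ratio K1 L \<sigma> u s y = normal_density (pam_point K1 L u s) \<sigma> y / pam K1 L \<sigma> (real (u * K1) * L) y"

lemma cloud_ratio_miss:
  assumes K: "0 < K1" "0 < K2" and L: "0 \<le> L" and \<sigma>: "0 < \<sigma>"
    and \<gamma>: "\<gamma> < pam_entropy (K1 * K2) L \<sigma> - pam_entropy K1 L \<sigma>"
  shows "\<exists>\<theta>. 0 \<le> \<theta> \<and> \<theta> < 1 \<and> (\<forall>n. avg (words n K2) (\<lambda>u. avg (words n K1)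
    (\<lambda>s. out_prob (pam_point K1 L) n \<sigma> u s (\<lambda>y. \<not> test n \<gamma> (\<lambda>u _. cloud_ratio K1 K2 L \<sigma> u) u s y))) \<le> \<theta> ^ n)"
proof -
  let ?W = "\<lambda>u. pam K1 L \<sigma> (real (u * K1) * L)" and ?f = "pam (K1 * K2) L \<sigma> 0"
  let ?p = "\<lambda>u s. normal_density (pam_point K1 L u s) \<sigma>"
  have KK: "0 < K1 * K2" using K by simp
  have Wpos: "0 < ?W u y" and fpos: "0 < ?f y" for u y
    using K KK \<sigma> by (auto intro!: pam_pos)
  have ln_ratio: "ln (cloud_ratio K1 K2 L \<sigma> u y) = ln (?W u y) - ln (?f y)" for u y
    unfolding cloud_ratio_def using Wpos fpos by (intro ln_divide_pos)
  have q: "quadratic_growth (\<lambda>y. ln (cloud_ratio K1 K2 L \<sigma> u y))" for u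
    unfolding ln_ratio using K KK L \<sigma> by (intro quadratic_growth_diff quadratic_growth_ln_pam)
  \<comment> \<open>A point of a cloud has weight \<open>1 / K1\<close> in it, so its density is at
    most \<open>K1\<close> times that of the cloud; divided by the cloud ratio it is dominated by
    \<open>K1\<close> times the total output density.\<close>
  have p_le: "?p u s y \<le> real K1 * ?W u y" if "s < K1" for u s y
  proof -
    have "?p u s y \<le> (\<Sum>s<K1. ?p u s y)"
      using that by (intro member_le_sum[of s _ "\<lambda>s. ?p u s y"]) auto
    then show ?thesis
      using K by (simp add: pam_def pam_point_def)
  qed
  show ?thesis
  proof (rule miss_exponent[OF K \<sigma>])
    show "cloud_ratio K1 K2 L \<sigma> u \<in> borel_measurable borel" for u
      unfolding cloud_ratio_def by measurable
    show "0 < cloud_ratio K1 K2 L \<sigma> u y" for u y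
      unfolding cloud_ratio_def using Wpos fpos by simp
    show "integrable lborel (\<lambda>y. ?p u s y * ln (cloud_ratio K1 K2 L \<sigma> u y))" for u s
      using \<sigma> q by (rule integrable_normal_quadratic_growth)
    show "integrable lborel (\<lambda>y. ?p u s y / cloud_ratio K1 K2 L \<sigma> u y)" if "s < K1" for u s
    proof (rule Bochner_Integration.integrable_bound[of _ "\<lambda>y. real K1 * ?f y"])
      show "integrable lborel (\<lambda>y. real K1 * ?f y)"
        using KK \<sigma> by (simp add: integrable_pam)
      show "(\<lambda>y. ?p u s y / cloud_ratio K1 K2 L \<sigma> u y) \<in> borel_measurable lborel"
        unfolding cloud_ratio_def by measurable
      show "AE y in lborel. norm (?p u s y / cloud_ratio K1 K2 L \<sigma> u y) \<le> norm (real K1 * ?f y)"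
      proof (intro AE_I2)
        fix y
        have "?p u s y * ?f y \<le> real K1 * ?W u y * ?f y"
          using p_le[OF that] fpos[of y] by (intro mult_right_mono) auto
        then have "?p u s y * ?f y / ?W u y \<le> real K1 * ?f y"
          using Wpos[of u y] by (simp add: pos_divide_le_eq mult_ac)
        then show "norm (?p u s y / cloud_ratio K1 K2 L \<sigma> u y) \<le> norm (real K1 * ?f y)"
          using Wpos[of u y] fpos[of y] by (simp add: cloud_ratio_def abs_mult)
      qed
    qed
    have "avg {..<K1} (\<lambda>s. \<integral>y. ?p u s y * ln (cloud_ratio K1 K2 L \<sigma> u y) \<partial>lborel)
        = (\<integral>y. ?W u y * ln (?W u y / ?f y) \<partial>lborel)" for u
      using integral_pam[OF K(1) \<sigma> q[of u], of L "real (u * K1) * L"]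
      unfolding avg_def pam_point_def by (simp add: cloud_ratio_def)
    then show "\<gamma> < avg {..<K2} (\<lambda>u. avg {..<K1} (\<lambda>s. \<integral>y. ?p u s y * ln (cloud_ratio K1 K2 L \<sigma> u y) \<partial>lborel))"
      using \<gamma> superposition_information_eq[OF K L \<sigma>] K by (simp add: avg_def)
  qed
qed

lemma satellite_ratio_miss:
  assumes K: "0 < K1" "0 < K2" and L: "0 \<le> L" and \<sigma>: "0 < \<sigma>"
    and \<gamma>: "\<gamma> < pam_entropy K1 L \<sigma> - normal_entropy \<sigma>"
  shows "\<exists>\<theta>. 0 \<le> \<theta> \<and> \<theta> < 1 \<and> (\<forall>n. avg (words n K2) (\<lambda>u. avg (words n K1)
    (\<lambda>s. out_prob (pam_point K1 L) n \<sigma> u s (\<lambda>y. \<not> test n \<gamma> (satellite_ratio K1 L \<sigma>) u s y))) \<le> \<theta> ^ n)"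
proof -
  let ?W = "\<lambda>u. pam K1 L \<sigma> (real (u * K1) * L)"
  let ?p = "\<lambda>u s. normal_density (pam_point K1 L u s) \<sigma>"
  have Wpos: "0 < ?W u y" for u y
    using K \<sigma> by (intro pam_pos)
  have ppos: "0 < ?p u s y" for u s y
    using \<sigma> by (rule normal_density_pos)
  have ln_ratio: "ln (satellite_ratio K1 L \<sigma> u s y) = ln (?p u s y) - ln (?W u y)" for u s y
    unfolding satellite_ratio_def using Wpos ppos by (intro ln_divide_pos)
  show ?thesis
  proof (rule miss_exponent[OF K \<sigma>])
    show "satellite_ratio K1 L \<sigma> u s \<in> borel_measurable borel" for u s
      unfolding satellite_ratio_def by measurable
    show "0 < satellite_ratio K1 L \<sigma> u s y" for u s y
      unfolding satellite_ratio_def using Wpos ppos by simp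
    show "integrable lborel (\<lambda>y. ?p u s y * ln (satellite_ratio K1 L \<sigma> u s y))" for u s
      unfolding ln_ratio using K L \<sigma>
      by (intro integrable_normal_quadratic_growth quadratic_growth_diff quadratic_growth_ln_pam quadratic_growth_ln_normal_density)
    have "?p u s y / satellite_ratio K1 L \<sigma> u s y = ?W u y" for u s y
      using ppos[of u s y] by (simp add: satellite_ratio_def)
    then show "integrable lborel (\<lambda>y. ?p u s y / satellite_ratio K1 L \<sigma> u s y)" for u s
      using K \<sigma> by (simp add: integrable_pam)
    \<comment> \<open>Translating by the position of the cloud removes \<open>u\<close>: every cloud
      carries the same satellite information.\<close>
    have "(\<integral>y. ?p u s y * ln (satellite_ratio K1 L \<sigma> u s y) \<partial>lborel)
        = (\<integral>y. normal_density (real s * L) \<sigma> y * ln (normal_density (real s * L) \<sigma> y / pam K1 L \<sigma> 0 y) \<partial>lborel)" for u s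
    proof -
      define g where "g y = normal_density (real s * L) \<sigma> y * ln (normal_density (real s * L) \<sigma> y / pam K1 L \<sigma> 0 y)" for y
      have "?p u s y * ln (satellite_ratio K1 L \<sigma> u s y) = g (y - real (u * K1) * L)" for y
        unfolding satellite_ratio_def pam_point_def pam_shift[of K1 L \<sigma> "real (u * K1) * L"] g_def
        by (simp add: normal_density_shift add.commute)
      then have "(\<integral>y. ?p u s y * ln (satellite_ratio K1 L \<sigma> u s y) \<partial>lborel) = integral\<^sup>L lborel g"
        by (simp only: lborel_shift_integral(1))
      then show ?thesis
        by (simp only: g_def[abs_def])
    qed
    then have "avg {..<K1} (\<lambda>s. \<integral>y. ?p u s y * ln (satellite_ratio K1 L \<sigma> u s y) \<partial>lborel)
        = pam_entropy K1 L \<sigma> - normal_entropy \<sigma>" for u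
      using pam_information_eq[OF K(1) L \<sigma>] K by (simp add: avg_def)
    then show "\<gamma> < avg {..<K2} (\<lambda>u. avg {..<K1} (\<lambda>s. \<integral>y. ?p u s y * ln (satellite_ratio K1 L \<sigma> u s y) \<partial>lborel))"
      using \<gamma> K by (simp add: avg_const lessThan_empty_iff)
  qed
qed

theorem theorem1:
  fixes A \<sigma>1 \<sigma>2 R1 R2 :: real and K1 K2 :: nat
  assumes "A > 0" and "0 < \<sigma>1" and "\<sigma>1 < \<sigma>2"
    and "K1 \<ge> 2" and "K2 \<ge> 1"
    and "R1 \<ge> 0" and "R2 \<ge> 0"
    and "R1 \<le> Ffun ((real K1 - 1) * A / (real K1 * real K2 - 1)) K1 \<sigma>1"
    and "R2 \<le> Ffun A (K1 * K2) \<sigma>2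
               - Gfun ((real K1 - 1) * A / (real K1 * real K2 - 1)) K1 \<sigma>2"
  shows "achievable A \<sigma>1 \<sigma>2 R1 R2"
proof -
  have K: "0 < K1" "0 < K2" and \<sigma>: "0 < \<sigma>1" "0 < \<sigma>2"
    using assms(2-5) by auto
  have KK: "2 \<le> K1 * K2"
    using mult_le_mono[OF assms(4,5)] by simp
  \<comment> \<open>The common spacing: the full constellation then has width \<open>A\<close>, and
    the first argument of \<open>F\<close> and \<open>G\<close> for \<open>K1\<close> points is the
    width \<open>(K1 - 1) * L\<close> of one cloud.\<close>
  define L where "L = A / (real (K1 * K2) - 1)"
  have d: "0 < real (K1 * K2) - 1"
    using KK by linarith
  have L: "0 < L"
    unfolding L_def using assms(1) d by simp
  have A: "A = (real (K1 * K2) - 1) * L"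
    unfolding L_def using d by simp
  have a: "(real K1 - 1) * A / (real K1 * real K2 - 1) = (real K1 - 1) * L"
    by (simp add: L_def)
  have rate1: "R1 * ln 2 < pam_entropy K1 L \<sigma>1 - normal_entropy \<sigma>1"
  proof -
    have "R1 * ln 2 \<le> ln 2 * Ffun ((real K1 - 1) * L) K1 \<sigma>1"
      unfolding mult.commute[of R1] using assms(8) unfolding a by (intro mult_left_mono) auto
    then show ?thesis
      using Ffun_less_pam_information[OF assms(4) L \<sigma>(1)] by linarith
  qed
  \<comment> \<open>For \<open>K2 = 1\<close> the right side is 0, so no nonnegative
    \<open>R2\<close> meets the assumption and this case needs no code.\<close>
  have rate2: "R2 * ln 2 < pam_entropy (K1 * K2) L \<sigma>2 - pam_entropy K1 L \<sigma>2"
  proof -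
    have "R2 * ln 2 \<le> ln 2 * (Ffun A (K1 * K2) \<sigma>2 - Gfun ((real K1 - 1) * L) K1 \<sigma>2)"
      unfolding mult.commute[of R2] using assms(9) unfolding a by (intro mult_left_mono) auto
    then show ?thesis
      using Ffun_less_pam_information[OF KK L \<sigma>(2)] pam_information_le_G[OF assms(4) L \<sigma>(2)]
      unfolding A[symmetric] right_diff_distrib by linarith
  qed
  \<comment> \<open>Test thresholds strictly between rate and information: the gap to the rate kills
    false alarms, the gap to the information kills misses.\<close>
  obtain \<gamma>1 where \<gamma>1: "R1 * ln 2 < \<gamma>1" "\<gamma>1 < pam_entropy K1 L \<sigma>1 - normal_entropy \<sigma>1"
    using dense[OF rate1] by blast
  obtain \<gamma>2 where \<gamma>2: "R2 * ln 2 < \<gamma>2" "\<gamma>2 < pam_entropy (K1 * K2) L \<sigma>2 - pam_entropy K1 L \<sigma>2"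
    using dense[OF rate2] by blast
  have L0: "0 \<le> L" using L by simp
  have \<gamma>2': "\<gamma>2 < pam_entropy (K1 * K2) L \<sigma>1 - pam_entropy K1 L \<sigma>1"
    using \<gamma>2(2) superposition_information_antimono[OF K L0 assms(2,3)] by linarith
  obtain \<theta>1 where \<theta>1: "0 \<le> \<theta>1" "\<theta>1 < 1" "\<And>n. avg (words n K2) (\<lambda>u. avg (words n K1)
      (\<lambda>s. out_prob (pam_point K1 L) n \<sigma>1 u s (\<lambda>y. \<not> test n \<gamma>2 (\<lambda>u _. cloud_ratio K1 K2 L \<sigma>1 u) u s y))) \<le> \<theta>1 ^ n"
    using cloud_ratio_miss[OF K L0 \<sigma>(1) \<gamma>2'] by blast
  obtain \<theta>2 where \<theta>2: "0 \<le> \<theta>2" "\<theta>2 < 1" "\<And>n. avg (words n K2) (\<lambda>u. avg (words n K1)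
      (\<lambda>s. out_prob (pam_point K1 L) n \<sigma>1 u s (\<lambda>y. \<not> test n \<gamma>1 (satellite_ratio K1 L \<sigma>1) u s y))) \<le> \<theta>2 ^ n"
    using satellite_ratio_miss[OF K L0 \<sigma>(1) \<gamma>1(2)] by blast
  obtain \<theta>3 where \<theta>3: "0 \<le> \<theta>3" "\<theta>3 < 1" "\<And>n. avg (words n K2) (\<lambda>u. avg (words n K1)
      (\<lambda>s. out_prob (pam_point K1 L) n \<sigma>2 u s (\<lambda>y. \<not> test n \<gamma>2 (\<lambda>u _. cloud_ratio K1 K2 L \<sigma>2 u) u s y))) \<le> \<theta>3 ^ n"
    using cloud_ratio_miss[OF K L0 \<sigma>(2) \<gamma>2(2)] by blast
  define M1 where "M1 n = nat \<lceil>2 powr (real n * R1)\<rceil>" for n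
  define M2 where "M2 n = nat \<lceil>2 powr (real n * R2)\<rceil>" for n
  define \<delta> where "\<delta> n = (\<theta>1 ^ n + \<theta>2 ^ n + real (M2 n) * exp (- (real n * \<gamma>2)) + real (M1 n) * exp (- (real n * \<gamma>1)))
      + (\<theta>3 ^ n + real (M2 n) * exp (- (real n * \<gamma>2)))" for n
  have M: "2 powr (real n * R1) \<le> real (M1 n)" "2 powr (real n * R2) \<le> real (M2 n)" for n
    unfolding M1_def M2_def by (auto intro: real_nat_ceiling_ge)
  have Mpos: "0 < M1 n" "0 < M2 n" for n
    unfolding M1_def M2_def by auto
  have \<delta>: "\<delta> \<longlonglongrightarrow> 0"
  proof -
    have "\<delta> \<longlonglongrightarrow> (0 + 0 + 0 + 0) + (0 + 0)"
      unfolding \<delta>_def M1_def M2_def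
      using \<theta>1 \<theta>2 \<theta>3 assms(6,7) \<gamma>1 \<gamma>2
      by (intro tendsto_add LIMSEQ_realpow_zero tendsto_ceiling_rate) auto
    then show ?thesis by simp
  qed
  have Wpos: "0 < pam K1 L \<sigma> c y" and fpos: "0 < pam (K1 * K2) L \<sigma> c y" if "0 < \<sigma>" for \<sigma> c y
    using K that by (auto intro!: pam_pos)
  have sum_cloud: "(\<Sum>u<K2. cloud_ratio K1 K2 L \<sigma> u y) = real K2" if "0 < \<sigma>" for \<sigma> y
  proof -
    have "(\<Sum>u<K2. pam K1 L \<sigma> (real (u * K1) * L) y) = real K2 * pam (K1 * K2) L \<sigma> 0 y"
      using pam_group[OF K, of L \<sigma> y] K by simp
    then show ?thesis
      unfolding cloud_ratio_def sum_divide_distrib[symmetric] using fpos[OF that, of 0 y] by simp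
  qed
  have sum_sat: "(\<Sum>s<K1. satellite_ratio K1 L \<sigma> u s y) = real K1" if "0 < \<sigma>" for \<sigma> u y
  proof -
    have "(\<Sum>s<K1. normal_density (pam_point K1 L u s) \<sigma> y) = real K1 * pam K1 L \<sigma> (real (u * K1) * L) y"
      using K by (simp add: pam_def pam_point_def)
    then show ?thesis
      unfolding satellite_ratio_def sum_divide_distrib[symmetric]
      using Wpos[OF that, of "real (u * K1) * L" y] by simp
  qed
  have "\<exists>enc dec1 dec2. (\<forall>w1 w2 i. w1 < M1 n \<longrightarrow> w2 < M2 n \<longrightarrow> i < n \<longrightarrow> (\<exists>u<K2. \<exists>s<K1. enc w1 w2 i = pam_point K1 L u s))
    \<and> dec1 \<in> measurable (PiM {..<n} (\<lambda>_. borel)) (count_space UNIV)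
    \<and> dec2 \<in> measurable (PiM {..<n} (\<lambda>_. borel)) (count_space UNIV)
    \<and> avg_err n \<sigma>1 (M1 n) (M2 n) enc dec1 (\<lambda>w1 w2. w1) + avg_err n \<sigma>2 (M1 n) (M2 n) enc dec2 (\<lambda>w1 w2. w2) \<le> \<delta> n" for n
    unfolding \<delta>_def
  proof (rule superposition_code_exists[OF K Mpos \<sigma> _ _ _ _ _ _ _ _ _ \<theta>1(3) \<theta>2(3) \<theta>3(3)])
    show "cloud_ratio K1 K2 L \<sigma>1 u \<in> borel_measurable borel" "cloud_ratio K1 K2 L \<sigma>2 u \<in> borel_measurable borel"
      "satellite_ratio K1 L \<sigma>1 u s \<in> borel_measurable borel" for u s
      unfolding cloud_ratio_def satellite_ratio_def by measurable
    show "0 < cloud_ratio K1 K2 L \<sigma>1 u y" "0 < cloud_ratio K1 K2 L \<sigma>2 u y" "0 < satellite_ratio K1 L \<sigma>1 u s y" for u s y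
      unfolding cloud_ratio_def satellite_ratio_def
      using \<sigma> by (auto intro!: divide_pos_pos Wpos fpos normal_density_pos)
    show "(\<Sum>u<K2. cloud_ratio K1 K2 L \<sigma>1 u y) \<le> real K2" "(\<Sum>u<K2. cloud_ratio K1 K2 L \<sigma>2 u y) \<le> real K2"
      "(\<Sum>s<K1. satellite_ratio K1 L \<sigma>1 u s y) \<le> real K1" for u y
      using sum_cloud sum_sat \<sigma> by auto
  qed
  then obtain enc dec1 dec2 where
    enc: "\<And>n w1 w2 i. w1 < M1 n \<Longrightarrow> w2 < M2 n \<Longrightarrow> i < n \<Longrightarrow> \<exists>u<K2. \<exists>s<K1. enc n w1 w2 i = pam_point K1 L u s"
    and dec: "\<And>n. dec1 n \<in> measurable (PiM {..<n} (\<lambda>_. borel)) (count_space UNIV)"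
      "\<And>n. dec2 n \<in> measurable (PiM {..<n} (\<lambda>_. borel)) (count_space UNIV)"
    and err: "\<And>n. avg_err n \<sigma>1 (M1 n) (M2 n) (enc n) (dec1 n) (\<lambda>w1 w2. w1)
      + avg_err n \<sigma>2 (M1 n) (M2 n) (enc n) (dec2 n) (\<lambda>w1 w2. w2) \<le> \<delta> n"
    by metis
  \<comment> \<open>The largest index \<open>(K2 - 1) * K1 + (K1 - 1)\<close> is
    \<open>K1 * K2 - 1\<close>, the point at which the input equals \<open>A\<close>.\<close>
  have peak: "pam_point K1 L u s \<in> {0..A}" if "u < K2" "s < K1" for u s
  proof -
    have "u * K1 + s + 1 \<le> u * K1 + K1"
      using that by simp
    also have "u * K1 + K1 = (u + 1) * K1"
      by simp
    also have "\<dots> \<le> K2 * K1"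
      using that by (intro mult_right_mono) auto
    finally have "u * K1 + s + 1 \<le> K1 * K2"
      by (simp only: mult.commute)
    then have "real (u * K1 + s) \<le> real (K1 * K2) - 1"
      by linarith
    then have "real (u * K1 + s) * L \<le> A"
      unfolding A using L by (intro mult_right_mono) auto
    then show ?thesis
      using L by (simp add: pam_point_def distrib_right)
  qed
  have nonneg: "0 \<le> avg_err n \<sigma> m1 m2 e d t" for n \<sigma> m1 m2 e d t
    unfolding avg_err_def by (intro divide_nonneg_nonneg sum_nonneg) auto
  have "(\<lambda>n. avg_err n \<sigma>1 (M1 n) (M2 n) (enc n) (dec1 n) (\<lambda>w1 w2. w1)) \<longlonglongrightarrow> 0"
  proof (rule tendsto_sandwich[OF _ _ tendsto_const \<delta>])
    show "\<forall>\<^sub>F n in sequentially. avg_err n \<sigma>1 (M1 n) (M2 n) (enc n) (dec1 n) (\<lambda>w1 w2. w1) \<le> \<delta> n"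
      using err nonneg by (intro always_eventually allI) (smt (verit))
  qed (use nonneg in auto)
  moreover have "(\<lambda>n. avg_err n \<sigma>2 (M1 n) (M2 n) (enc n) (dec2 n) (\<lambda>w1 w2. w2)) \<longlonglongrightarrow> 0"
  proof (rule tendsto_sandwich[OF _ _ tendsto_const \<delta>])
    show "\<forall>\<^sub>F n in sequentially. avg_err n \<sigma>2 (M1 n) (M2 n) (enc n) (dec2 n) (\<lambda>w1 w2. w2) \<le> \<delta> n"
      using err nonneg by (intro always_eventually allI) (smt (verit))
  qed (use nonneg in auto)
  moreover have "enc n w1 w2 i \<in> {0..A}" if "w1 < M1 n" "w2 < M2 n" "i < n" for n w1 w2 i
    using enc[OF that] peak by metis
  ultimately show ?thesis
    unfolding achievable_def using M dec by (intro exI[of _ M1] exI[of _ M2] exI[of _ enc] exI[of _ dec1] exI[of _ dec2]) auto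
qed

end
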